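(* Let $B(t)$, $t\in\mathbb R$, be a standard Brownian motion independent of $Z(t)$, $t\in\mathbb R$, a centered stationary Gaussian process with continuous sample paths, $\operatorname{Var}(Z(t))=\sigma^2\in(0,\infty)$, and covariance function $R(t)=\operatorname{Cov}(Z(0),Z(t))$ satisfying the Pickands condition $R(0)-R(t)=A|t|^\alpha+o(|t|^\alpha)$ as $t\to0$ for some $A>0$, $\alpha\in(0,2]$. Let further, for $c>0$, $V_c(t)$, $t\in\mathbb R$, be a centered Gaussian process with stationary increments, continuous sample paths and variogram $\gamma_{V_c}(t)=\frac12\sqrt{t^2+c\sin^2(t/2)}$. (i) If $Z$ satisfies the Berman condition $\lim_{T\to\infty}\ln(T)R(T)=0$, then for $V(t)=B(t)+Z(t)-Z(0)$, $t\in\mathbb R$, $$e^{-2\sigma\sqrt{\ln T}+O(1)}\le\frac{\mathcal G_V(T)}{\mathcal G_B(T)}\le1,\qquad T\to\infty.$$ (ii) If $V=V_c$, then $$e^{-2\sigma'\sqrt{\ln T}+O(1)}\le\frac{\mathcal G_{V}(T)}{\mathcal G_B(T)}\le1,\qquad T\to\infty,$$ holds for some $\sigma'\in(0,\infty)$. (iii) Let $V(t)=\int_0^tZ(s)\,ds$, $t\ge0$, and suppose that $R(t)\ge0$ for $t\ge0$. Assume further that $$a:=\int_0^\infty R(s)\,ds\in(0,\infty),\qquad m:=\int_0^\infty sR(s)\,ds<\infty,$$ and set $g(t):=\int_t^\infty(s-t)R(s)\,ds$, $t\ge0$. If $t\mapsto g(|t|)$ is positive definite on $\mathbb R$ and $\lim_{t\to\infty}\ln(t)g(t)=0$,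 then $$1\le\frac{\mathcal G_V(T)}{\mathcal G_B(2aT)}\le e^{2\sqrt m\sqrt{\ln T}+m+o(1)},\qquad T\to\infty.$$
   Context: For a centered Gaussian process $V$ with stationary increments and variance function $\sigma_V^2(t)=\operatorname{Var}(V(t))$, the variogram is $\gamma_V(h)=\frac12\mathbb E\{(V(h)-V(0))^2\}$, and $$\mathcal G_V(T)=\mathbb E\Big\{\inf_{t\in[0,T]}e^{\sqrt2V(t)-\sigma_V^2(t)}\Big\},\qquad T>0.$$ For the standard Brownian motion $B$, $\sigma_B^2(t)=|t|$. "Positive definite" is in the sense of covariance functions (all matrices $(g(|t_i-t_j|))_{i,j}$ are positive semidefinite). *)

theory Defs
  imports "HOL-Probability.Probability" "HOL-Library.Landau_Symbols"
begin

definition covariance :: "'a measure \<Rightarrow> ('a \<Rightarrow> real) \<Rightarrow> ('a \<Rightarrow> real) \<Rightarrow> real" where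
  "covariance M X Y =
     prob_space.expectation M (\<lambda>\<omega>. (X \<omega> - prob_space.expectation M X) *
                                    (Y \<omega> - prob_space.expectation M Y))"

text \<open>Point masses count as (degenerate) Gaussian laws.\<close>

definition gaussian_rv :: "'a measure \<Rightarrow> ('a \<Rightarrow> real) \<Rightarrow> bool" where
  "gaussian_rv M X \<longleftrightarrow> X \<in> borel_measurable M \<and>
     ((\<exists>\<mu>. AE \<omega> in M. X \<omega> = \<mu>) \<or>
      (\<exists>\<mu> s. 0 < s \<and> distributed M lborel X (normal_density \<mu> s)))"

definition gaussian_process :: "'a measure \<Rightarrow> (real \<Rightarrow> 'a \<Rightarrow> real) \<Rightarrow> bool" where
  "gaussian_process M X \<longleftrightarrow> (\<forall>t. X t \<in> borel_measurable M) \<and>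
     (\<forall>J c. finite J \<longrightarrow> gaussian_rv M (\<lambda>\<omega>. \<Sum>t\<in>J. c t * X t \<omega>))"

definition centered :: "'a measure \<Rightarrow> (real \<Rightarrow> 'a \<Rightarrow> real) \<Rightarrow> bool" where
  "centered M X \<longleftrightarrow> (\<forall>t. integrable M (X t) \<and> prob_space.expectation M (X t) = 0)"

definition continuous_paths :: "'a measure \<Rightarrow> (real \<Rightarrow> 'a \<Rightarrow> real) \<Rightarrow> bool" where
  "continuous_paths M X \<longleftrightarrow> (\<forall>\<omega>\<in>space M. continuous_on UNIV (\<lambda>t. X t \<omega>))"

definition fdd :: "'a measure \<Rightarrow> (real \<Rightarrow> 'a \<Rightarrow> real) \<Rightarrow> real set \<Rightarrow> (real \<Rightarrow> real) measure" where
  "fdd M X J = distr M (\<Pi>\<^sub>M t\<in>J. borel) (\<lambda>\<omega>. \<lambda>t\<in>J. X t \<omega>)"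

definition stationary :: "'a measure \<Rightarrow> (real \<Rightarrow> 'a \<Rightarrow> real) \<Rightarrow> bool" where
  "stationary M X \<longleftrightarrow> (\<forall>h J. finite J \<longrightarrow> fdd M (\<lambda>t. X (t + h)) J = fdd M X J)"

definition stationary_increments :: "'a measure \<Rightarrow> (real \<Rightarrow> 'a \<Rightarrow> real) \<Rightarrow> bool" where
  "stationary_increments M X \<longleftrightarrow>
     (\<forall>h J. finite J \<longrightarrow>
        fdd M (\<lambda>t \<omega>. X (t + h) \<omega> - X h \<omega>) J = fdd M (\<lambda>t \<omega>. X t \<omega> - X 0 \<omega>) J)"

definition variogram :: "'a measure \<Rightarrow> (real \<Rightarrow> 'a \<Rightarrow> real) \<Rightarrow> real \<Rightarrow> real" where
  "variogram M X h = 1 / 2 * prob_space.expectation M (\<lambda>\<omega>. (X h \<omega> - X 0 \<omega>)\<^sup>2)"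

text \<open>Two-sided standard Brownian motion on the whole real line.\<close>

definition standard_brownian_motion :: "'a measure \<Rightarrow> (real \<Rightarrow> 'a \<Rightarrow> real) \<Rightarrow> bool" where
  "standard_brownian_motion M B \<longleftrightarrow>
     (\<forall>t. B t \<in> borel_measurable M) \<and>
     (AE \<omega> in M. B 0 \<omega> = 0) \<and>
     (\<forall>s t. s < t \<longrightarrow>
        distributed M lborel (\<lambda>\<omega>. B t \<omega> - B s \<omega>) (normal_density 0 (sqrt (t - s)))) \<and>
     (\<forall>(n::nat) (t::nat \<Rightarrow> real). strict_mono_on {..n} t \<longrightarrow>
        prob_space.indep_vars M (\<lambda>_. borel)
          (\<lambda>i \<omega>. B (t (Suc i)) \<omega> - B (t i) \<omega>) {..<n}) \<and>
     continuous_paths M B"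

text \<open>Independence of the path-valued random variables, equivalently of the sigma-algebras
  generated by the two processes.\<close>

definition indep_processes ::
    "'a measure \<Rightarrow> (real \<Rightarrow> 'a \<Rightarrow> real) \<Rightarrow> (real \<Rightarrow> 'a \<Rightarrow> real) \<Rightarrow> bool" where
  "indep_processes M X Y \<longleftrightarrow>
     prob_space.indep_var M (\<Pi>\<^sub>M t\<in>UNIV. borel) (\<lambda>\<omega> t. X t \<omega>)
                            (\<Pi>\<^sub>M t\<in>UNIV. borel) (\<lambda>\<omega> t. Y t \<omega>)"

definition \<G> :: "'a measure \<Rightarrow> (real \<Rightarrow> 'a \<Rightarrow> real) \<Rightarrow> real \<Rightarrow> real" where
  "\<G> M V T = prob_space.expectation M
     (\<lambda>\<omega>. INF t\<in>{0..T}. exp (sqrt 2 * V t \<omega> - prob_space.variance M (V t)))"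

text \<open>Positive definiteness of \<open>t \<mapsto> g \<bar>t\<bar>\<close> on the real line. The matrices involved are symmetric
  by construction, so only nonnegativity of the quadratic forms has to be demanded.\<close>

definition abs_positive_definite :: "(real \<Rightarrow> real) \<Rightarrow> bool" where
  "abs_positive_definite g \<longleftrightarrow>
     (\<forall>(n::nat) (t::nat \<Rightarrow> real) (c::nat \<Rightarrow> real).
        0 \<le> (\<Sum>i<n. \<Sum>j<n. c i * c j * g \<bar>t i - t j\<bar>))"

end

theory Submission
  imports Defs "HOL-Real_Asymp.Real_Asymp"
begin

text \<open>
  Sampled on the dyadic grids of \<open>[0, T]\<close>, the functional \<open>\<G>\<close> is the limit of
  \<open>\<phi> n C = E (Min i<n. exp (sqrt 2 * X i - C i i))\<close> for Gaussian vectors \<open>X\<close> with covariance \<open>C\<close>.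
  A Cameron-Martin shift shows that \<open>\<phi>\<close> depends on the variogram of \<open>C\<close> only, and it is antitone
  in the variogram: once the diagonals agree, raising an off-diagonal entry replaces two independent
  normal contributions by a common one, and the minimum is supermodular. Conditioning gives
  \<open>\<phi> n C * \<phi> n D \<le> \<phi> n (C + D)\<close>. All three claims follow by comparing two variograms whose
  difference lies between \<open>0\<close> and the variogram \<open>r 0 - r h\<close> of a stationary covariance \<open>r\<close>
  (\<open>r = R\<close> in (i), a multiple of the triangle function \<open>max 0 (1 - \<bar>h\<bar>)\<close> in (ii), \<open>r = g\<close> in (iii) with
  the roles of the two processes exchanged): for stationary \<open>r\<close>, Jensen's inequality
  and \<open>E (Max Y) \<le> sqrt (2 * r 0 * ln T) + o(1)\<close>, obtained by chaining, bound the perturbation factor from below.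
\<close>

subsection \<open>Expectations determined by the characteristic function\<close>

text \<open>Densities and differentiation along an interpolation of covariances, the usual means of
  comparing Gaussian functionals, are hampered by singular matrices and by the nonsmooth minimum.
  Hence Gaussian laws are described by characteristic functions, and the comparison consists of
  finitely many small exchanges of noise, each settled by an elementary inequality between minima. A
  little independent noise makes room for the exchanges and is removed in the limit. In the exponent
  \<open>- r 0 - 2 * sqrt (r 0) * sqrt (ln T)\<close> the first term is the variance subtracted in
  \<open>\<G>\<close>; the second is the factor \<open>sqrt 2\<close> in \<open>\<G>\<close> times
  the bound \<open>sqrt (2 * r 0 * ln T)\<close> for an expected maximum. In (iii),
  \<open>V(h)\<close> has variance \<open>2 * (a * h - m + g h)\<close>. Brownian motion at speed
  \<open>2 * a\<close> therefore has the variogram of \<open>V\<close> plus that of a stationary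
  process with covariance \<open>g\<close>, which is why the ratio is at least 1 there and
  \<open>r 0 = g 0 = m\<close> governs the upper bound.\<close>

definition lincomb :: "nat \<Rightarrow> (nat \<Rightarrow> real) \<Rightarrow> (nat \<Rightarrow> real) \<Rightarrow> real" where
  "lincomb n c x = (\<Sum>i<n. c i * x i)"

lemma lincomb_add: "lincomb n (\<lambda>i. c i + d i) x = lincomb n c x + lincomb n d x"
  by (simp add: lincomb_def sum.distrib algebra_simps)

lemma lincomb_diff: "lincomb n (\<lambda>i. c i - d i) x = lincomb n c x - lincomb n d x"
  by (simp add: lincomb_def sum_subtractf algebra_simps)

lemma lincomb_add_right: "lincomb n c (\<lambda>i. x i + y i) = lincomb n c x + lincomb n c y"
  by (simp add: lincomb_def sum.distrib algebra_simps)

lemma lincomb_scale: "lincomb n (\<lambda>i. s * c i) x = s * lincomb n c x"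
  by (simp add: lincomb_def sum_distrib_left algebra_simps)

lemma continuous_on_lincomb [continuous_intros]: "continuous_on A (lincomb n c)"
proof -
  have "continuous_on A (\<lambda>x. x i)" for i :: nat
    by (rule continuous_on_subset[OF continuous_on_product_coordinates subset_UNIV])
  then show ?thesis unfolding lincomb_def[abs_def] by (intro continuous_on_sum continuous_on_mult_left)
qed

text \<open>The phase \<open>b\<close> lets one generator cover cosines, sines and, for
  \<open>c = 0\<close>, constants. The class is an algebra on which expectations are determined by
  the characteristic function of the vector.\<close>

inductive_set trigpoly :: "nat \<Rightarrow> ((nat \<Rightarrow> real) \<Rightarrow> real) set" for n where
  zero: "(\<lambda>_. 0) \<in> trigpoly n"
| add_cos: "f \<in> trigpoly n \<Longrightarrow> (\<lambda>x. f x + a * cos (lincomb n c x + b)) \<in> trigpoly n"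

lemma trigpoly_add:
  assumes "f \<in> trigpoly n" "g \<in> trigpoly n" shows "(\<lambda>x. f x + g x) \<in> trigpoly n"
  using assms(2)
proof induction
  case (add_cos g a c b)
  from trigpoly.add_cos[OF add_cos.IH, of a c b] show ?case by (simp add: add.assoc)
qed (simp add: assms)

text \<open>The product-to-sum formula: frequencies and phases are added and subtracted.\<close>

lemma trigpoly_mult_cos:
  assumes "f \<in> trigpoly n" shows "(\<lambda>x. f x * (a * cos (lincomb n c x + b))) \<in> trigpoly n"
  using assms
proof induction
  case (add_cos f a' c' b')
  have eq: "(f x + a' * cos (lincomb n c' x + b')) * (a * cos (lincomb n c x + b)) =
     f x * (a * cos (lincomb n c x + b))
     + (a * a' / 2) * cos (lincomb n (\<lambda>i. c' i + c i) x + (b' + b))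
     + (a * a' / 2) * cos (lincomb n (\<lambda>i. c' i - c i) x + (b' - b))" for x
  proof -
    define u v where "u = lincomb n c' x + b'" and "v = lincomb n c x + b"
    have "lincomb n (\<lambda>i. c' i + c i) x + (b' + b) = u + v"
      "lincomb n (\<lambda>i. c' i - c i) x + (b' - b) = u - v"
      by (auto simp: u_def v_def lincomb_add lincomb_diff)
    moreover have "(f x + a' * cos u) * (a * cos v) = f x * (a * cos v) + a * a' * (cos u * cos v)"
      by (simp add: algebra_simps)
    ultimately show ?thesis

      unfolding u_def[symmetric] v_def[symmetric]
      by (simp only:) (simp add: cos_times_cos field_simps)
  qed
  show ?case unfolding eq by (intro trigpoly.add_cos add_cos.IH)
qed (simp add: trigpoly.zero)

lemma trigpoly_mult:
  assumes "f \<in> trigpoly n" "g \<in> trigpoly n" shows "(\<lambda>x. f x * g x) \<in> trigpoly n"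
  using assms(2)
proof induction
  case (add_cos g a c b)
  then show ?case
    using trigpoly_add[OF add_cos.IH trigpoly_mult_cos[OF assms(1), of a c b]]
    by (simp add: algebra_simps)
qed (simp add: trigpoly.zero)

lemma trigpoly_const: "(\<lambda>_. k) \<in> trigpoly n"
  using trigpoly.add_cos[OF trigpoly.zero[of n], of k "\<lambda>_. 0" 0] by (simp add: lincomb_def)

lemma trigpoly_bounded:
  assumes "f \<in> trigpoly n" shows "\<exists>B. \<forall>x. \<bar>f x\<bar> \<le> B"
  using assms
proof induction
  case (add_cos f a c b)
  then obtain B where B: "\<And>x. \<bar>f x\<bar> \<le> B" by auto
  have "\<bar>f x + a * cos (lincomb n c x + b)\<bar> \<le> B + \<bar>a\<bar>" for x
  proof -
    have "\<bar>a * cos (lincomb n c x + b)\<bar> \<le> \<bar>a\<bar>"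
      using mult_left_le[OF abs_cos_le_one] by (simp add: abs_mult)
    then show ?thesis using B[of x] by linarith
  qed
  then show ?case by blast
qed auto

lemma trigpoly_continuous: "f \<in> trigpoly n \<Longrightarrow> continuous_on A f"
  by (induction rule: trigpoly.induct) (auto intro!: continuous_intros)

text \<open>Serves to cut off large values: a truncation of \<open>p\<close> leaves the algebra, but
  a polynomial close to the truncation does not.\<close>

lemma trigpoly_polynomial:
  fixes q :: "real \<Rightarrow> real"
  assumes "real_polynomial_function q" "p \<in> trigpoly n" shows "(\<lambda>x. q (p x)) \<in> trigpoly n"
  using assms(1)
proof induction
  case (linear h)
  then interpret bounded_linear h .
  have "(\<lambda>x. h (p x)) = (\<lambda>x. p x * h 1)"
    using scaleR[of "p _" 1] by (auto simp: fun_eq_iff)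
  then show ?case using trigpoly_mult[OF assms(2) trigpoly_const] by simp
qed (auto intro: trigpoly_const trigpoly_add trigpoly_mult)

text \<open>The box is compact in the product topology on sequences; coordinates beyond \<open>n\<close> are frozen
  at 0, so that the first \<open>n\<close> coordinates separate its points.\<close>

definition box_seq :: "nat \<Rightarrow> real \<Rightarrow> (nat \<Rightarrow> real) set" where
  "box_seq n K = PiE UNIV (\<lambda>i. if i < n then {-K..K} else {0})"

lemma box_seq_iff: "x \<in> box_seq n K \<longleftrightarrow> (\<forall>i<n. \<bar>x i\<bar> \<le> K) \<and> (\<forall>i\<ge>n. x i = 0)"
proof -
  have "x \<in> box_seq n K \<longleftrightarrow> (\<forall>i. if i < n then \<bar>x i\<bar> \<le> K else x i = 0)"
    unfolding box_seq_def PiE_iff by (auto simp: abs_le_iff)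
  then show ?thesis by (meson not_le)
qed

lemma compact_box_seq: "compact (box_seq n K)"
proof -
  have "compactin (product_topology (\<lambda>_. euclidean) UNIV) (box_seq n K)"
    unfolding box_seq_def by (subst compactin_PiE) auto
  then show ?thesis by (simp add: euclidean_product_topology)
qed

lemma trigpoly_approx:
  assumes "continuous_on UNIV f" "0 < e"
  obtains p where "p \<in> trigpoly n" "\<And>x. x \<in> box_seq n K \<Longrightarrow> \<bar>f x - p x\<bar> < e"
proof -
  interpret function_ring_on "trigpoly n" "box_seq n K"
  proof
    fix x y assume xy: "x \<in> box_seq n K" "y \<in> box_seq n K" "x \<noteq> y"
    then obtain i where i: "x i \<noteq> y i" by auto
    with xy have "i < n" by (metis box_seq_iff not_le)
    \<comment> \<open>The scale brings both coordinates into \<open>[-1, 1]\<close>, inside the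
      interval where the sine is injective; the phase \<open>- pi/2\<close> below turns the cosine
      into that sine.\<close>
    define s where "s = 1 / (\<bar>x i\<bar> + \<bar>y i\<bar> + 1)"
    have s: "s > 0" by (simp add: s_def add_nonneg_pos)
    have "\<bar>s * x i\<bar> \<le> 1" "\<bar>s * y i\<bar> \<le> 1"
      by (auto simp: s_def abs_mult divide_simps)
    then have b: "\<bar>s * x i\<bar> \<le> pi/2" "\<bar>s * y i\<bar> \<le> pi/2" using pi_gt3 by linarith+
    have lc: "lincomb n (\<lambda>j. if j = i then s else 0) z = s * z i" for z
      unfolding lincomb_def using \<open>i < n\<close>
      by (subst sum.cong[OF refl, of _ _ "\<lambda>j. if j = i then s * z i else 0"]) auto
    have "sin (s * x i) \<noteq> sin (s * y i)"
    proof
      assume "sin (s * x i) = sin (s * y i)"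
      from sin_inj_pi[OF _ _ _ _ this] b have "s * x i = s * y i" by (simp add: abs_le_iff)
      with i s show False by simp
    qed
    then have "cos (s * x i - pi/2) \<noteq> cos (s * y i - pi/2)"
      by (simp add: cos_diff)
    moreover have "(\<lambda>z. cos (s * z i - pi/2)) \<in> trigpoly n"
      using trigpoly.add_cos[OF trigpoly.zero[of n], of 1 "\<lambda>j. if j = i then s else 0" "-pi/2"]
      by (simp add: lc)
    ultimately show "\<exists>f\<in>trigpoly n. f x \<noteq> f y" by (intro bexI)
  qed (auto intro: trigpoly_add trigpoly_mult trigpoly_const trigpoly_continuous compact_box_seq)
  from Stone_Weierstrass_basic[OF continuous_on_subset[OF assms(1)] assms(2)] that
  show ?thesis by auto
qed

lemma (in prob_space) seq_tight:
  assumes U[measurable]: "\<And>i. (\<lambda>\<omega>. U \<omega> i) \<in> borel_measurable M"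
    and U0: "\<And>\<omega> i. i \<ge> n \<Longrightarrow> U \<omega> i = (0::real)" and e: "0 < e"
  obtains k::nat where "\<And>K. real k \<le> K \<Longrightarrow> prob {\<omega>\<in>space M. U \<omega> \<notin> box_seq n K} < e"
proof -
  define A where "A k = {\<omega>\<in>space M. \<exists>i\<in>{..<n}. \<bar>U \<omega> i\<bar> > real k}" for k
  have [measurable]: "A k \<in> sets M" for k unfolding A_def by measurable
  have dec: "decseq A"
  proof (rule decseq_SucI)
    fix k
    have "real k < y" if "real (Suc k) < y" for y using that by simp
    then show "A (Suc k) \<subseteq> A k" unfolding A_def by blast
  qed
  have "(\<Inter>k. A k) = {}"
  proof (rule ccontr)
    assume "(\<Inter>k. A k) \<noteq> {}"
    then obtain \<omega> where w: "\<omega> \<in> A k" for k by auto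
    obtain k where k: "real k \<ge> (\<Sum>i<n. \<bar>U \<omega> i\<bar>)" using real_arch_simple by blast
    from w[of k] obtain i where "i < n" "\<bar>U \<omega> i\<bar> > k" by (auto simp: A_def)
    with k member_le_sum[of i "{..<n}" "\<lambda>i. \<bar>U \<omega> i\<bar>"] show False by auto
  qed
  with finite_Lim_measure_decseq[OF _ dec] have "(\<lambda>k. prob (A k)) \<longlonglongrightarrow> 0" by (simp add: image_subset_iff)
  from order_tendstoD(2)[OF this e] obtain k where k: "prob (A k) < e"
    by (auto simp: eventually_sequentially)
  show thesis
  proof (rule that)
    fix K assume K: "real k \<le> K"
    have "{\<omega>\<in>space M. U \<omega> \<notin> box_seq n K} \<subseteq> A k"
      using K U0 by (force simp: box_seq_iff A_def not_le)
    then have "prob {\<omega>\<in>space M. U \<omega> \<notin> box_seq n K} \<le> prob (A k)"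
      by (intro finite_measure_mono) auto
    with k show "prob {\<omega>\<in>space M. U \<omega> \<notin> box_seq n K} < e" by simp
  qed
qed

text \<open>The two functions differ by at most \<open>e\<close> on the box and by at most
  \<open>2 * F + e\<close> off it, where the probability is below \<open>e\<close>.\<close>

lemma (in prob_space) approx_expectation:
  assumes U[measurable]: "\<And>i. (\<lambda>\<omega>. U \<omega> i) \<in> borel_measurable M"
    and f: "continuous_on UNIV f" and h: "continuous_on UNIV h"
    and F: "\<And>x. \<bar>f x\<bar> \<le> F" and H: "\<And>x. \<bar>h x\<bar> \<le> F + e" and e: "0 < e" "e \<le> 1"
    and fh: "\<And>x. x \<in> box_seq n K \<Longrightarrow> \<bar>f x - h x\<bar> \<le> e"
    and P: "prob {\<omega>\<in>space M. U \<omega> \<notin> box_seq n K} < e"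
  shows "\<bar>expectation (\<lambda>\<omega>. f (U \<omega>)) - expectation (\<lambda>\<omega>. h (U \<omega>))\<bar> \<le> e * (2 * F + 2)"
proof -
  have [measurable]: "U \<in> measurable M borel" by (rule measurable_coordinatewise_then_product) simp
  have [measurable]: "f \<in> borel_measurable borel" "h \<in> borel_measurable borel"
    using f h by (auto intro: borel_measurable_continuous_onI)
  have [measurable]: "box_seq n K \<in> sets borel" by (intro borel_compact compact_box_seq)
  have F0: "0 \<le> F" using F[of undefined] by simp
  have i1: "integrable M (\<lambda>\<omega>. f (U \<omega>))" by (rule integrable_const_bound[of _ F]) (auto simp: F)
  have i2: "integrable M (\<lambda>\<omega>. h (U \<omega>))" by (rule integrable_const_bound[of _ "F + e"]) (auto simp: H)
  let ?S = "{\<omega>\<in>space M. U \<omega> \<notin> box_seq n K}"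
  have "\<bar>expectation (\<lambda>\<omega>. f (U \<omega>)) - expectation (\<lambda>\<omega>. h (U \<omega>))\<bar> = \<bar>expectation (\<lambda>\<omega>. f (U \<omega>) - h (U \<omega>))\<bar>"
    using i1 i2 by simp
  also have "\<dots> \<le> expectation (\<lambda>\<omega>. \<bar>f (U \<omega>) - h (U \<omega>)\<bar>)"
    using integral_norm_bound[of M "\<lambda>\<omega>. f (U \<omega>) - h (U \<omega>)"] by simp
  also have "\<dots> \<le> expectation (\<lambda>\<omega>. e + (2 * F + e) * indicator ?S \<omega>)"
  proof (rule integral_mono)
    show "integrable M (\<lambda>\<omega>. \<bar>f (U \<omega>) - h (U \<omega>)\<bar>)" using i1 i2 by simp
    show "integrable M (\<lambda>\<omega>. e + (2 * F + e) * indicator ?S \<omega>)"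
      by (intro Bochner_Integration.integrable_add integrable_mult_right integrable_const
        integrable_real_indicator) (auto simp: emeasure_eq_measure)
    fix \<omega> assume "\<omega> \<in> space M"
    show "\<bar>f (U \<omega>) - h (U \<omega>)\<bar> \<le> e + (2 * F + e) * indicator ?S \<omega>"
    proof (cases "U \<omega> \<in> box_seq n K")
      case True then show ?thesis using fh by (simp add: indicator_def)
    next
      case False then show ?thesis using F[of "U \<omega>"] H[of "U \<omega>"] e \<open>\<omega> \<in> space M\<close>
        by (simp add: indicator_def)
    qed
  qed
  also have "\<dots> = e + (2 * F + e) * prob ?S"
    by (subst Bochner_Integration.integral_add)
       (auto simp: prob_space emeasure_eq_measure intro!: integrable_mult_right integrable_real_indicator)
  also have "\<dots> \<le> e + (2 * F + 1) * e" using P e F0 by (intro add_left_mono mult_mono) auto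
  finally show ?thesis by (simp add: algebra_simps)
qed

text \<open>Since \<open>cos (u + b)\<close> is the real part of \<open>iexp b * iexp u\<close>,
  each term is integrated by the characteristic function at frequency \<open>c\<close>.
  Integrability is carried along in order to split the sum.\<close>

lemma trigpoly_expectation_cong:
  assumes M: "prob_space M" and N: "prob_space N"
    and U[measurable]: "\<And>i. (\<lambda>\<omega>. U \<omega> i) \<in> borel_measurable M"
    and W[measurable]: "\<And>i. (\<lambda>\<omega>. W \<omega> i) \<in> borel_measurable N"
    and eq: "\<And>c. (CLINT \<omega>|M. iexp (lincomb n c (U \<omega>))) = (CLINT \<omega>|N. iexp (lincomb n c (W \<omega>)))"
    and p: "p \<in> trigpoly n"
  shows "integrable M (\<lambda>\<omega>. p (U \<omega>)) \<and> integrable N (\<lambda>\<omega>. p (W \<omega>)) \<and>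
    (LINT \<omega>|M. p (U \<omega>)) = (LINT \<omega>|N. p (W \<omega>))"
  using p
proof induction
  case (add_cos f a c b)
  have lm[measurable]: "(\<lambda>\<omega>. lincomb n c (U \<omega>)) \<in> borel_measurable M"
     "(\<lambda>\<omega>. lincomb n c (W \<omega>)) \<in> borel_measurable N" unfolding lincomb_def by measurable
  interpret M: prob_space M by fact
  interpret N: prob_space N by fact
  have 1: "integrable M (\<lambda>\<omega>. cos (lincomb n c (U \<omega>) + b))"
    by (rule M.integrable_const_bound[of _ 1]) auto
  have 2: "integrable N (\<lambda>\<omega>. cos (lincomb n c (W \<omega>) + b))"
    by (rule N.integrable_const_bound[of _ 1]) auto
  have re: "cos (u + b) = Re (iexp b * iexp u)" for u by (simp add: Re_exp Im_exp cos_add exp_eq_polar cis.ctr)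
  have i: "integrable M (\<lambda>\<omega>. iexp (lincomb n c (U \<omega>)))" by (rule M.integrable_iexp) auto
  have i': "integrable N (\<lambda>\<omega>. iexp (lincomb n c (W \<omega>)))" by (rule N.integrable_iexp) auto
  have "(LINT \<omega>|M. cos (lincomb n c (U \<omega>) + b)) = Re (CLINT \<omega>|M. iexp b * iexp (lincomb n c (U \<omega>)))"
    unfolding re using i by (intro integral_Re integrable_mult_right)
  also have "\<dots> = Re (CLINT \<omega>|N. iexp b * iexp (lincomb n c (W \<omega>)))"
    using eq[of c] by simp
  also have "\<dots> = (LINT \<omega>|N. cos (lincomb n c (W \<omega>) + b))"
    unfolding re using i' by (intro integral_Re[symmetric] integrable_mult_right)
  finally show ?case using add_cos.IH 1 2 by simp
qed simp

text \<open>The uniqueness theorem for characteristic functions in \<open>n\<close> dimensions: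
  tightness reduces the claim to a box, and there Stone-Weierstrass replaces the test function by a
  trigonometric polynomial. The vectors are sequences that vanish from \<open>n\<close> on, so that
  they can lie in \<open>box_seq\<close>.\<close>

lemma expectation_eq_of_char_eq:
  fixes f :: "(nat \<Rightarrow> real) \<Rightarrow> real"
  assumes M: "prob_space M" and N: "prob_space N"
    and U[measurable]: "\<And>i. (\<lambda>\<omega>. U \<omega> i) \<in> borel_measurable M" and U0: "\<And>\<omega> i. i \<ge> n \<Longrightarrow> U \<omega> i = 0"
    and W[measurable]: "\<And>i. (\<lambda>\<omega>. W \<omega> i) \<in> borel_measurable N" and W0: "\<And>\<omega> i. i \<ge> n \<Longrightarrow> W \<omega> i = 0"
    and eq: "\<And>c. (CLINT \<omega>|M. iexp (lincomb n c (U \<omega>))) = (CLINT \<omega>|N. iexp (lincomb n c (W \<omega>)))"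
    and f: "continuous_on UNIV f" and F: "\<And>x. \<bar>f x\<bar> \<le> F"
  shows "(LINT \<omega>|M. f (U \<omega>)) = (LINT \<omega>|N. f (W \<omega>))"
proof -
  interpret M: prob_space M by fact
  interpret N: prob_space N by fact
  have F0: "0 \<le> F" using F[of undefined] by simp
  have key: "\<bar>(LINT \<omega>|M. f (U \<omega>)) - (LINT \<omega>|N. f (W \<omega>))\<bar> \<le> e * (8 * F + 8)" if e: "0 < e" "e \<le> 1/2" for e
  proof -
    obtain k1 where k1: "\<And>K. real k1 \<le> K \<Longrightarrow> M.prob {\<omega>\<in>space M. U \<omega> \<notin> box_seq n K} < e"
      using M.seq_tight[where U = U and n = n, OF U U0 e(1)] by blast
    obtain k2 where k2: "\<And>K. real k2 \<le> K \<Longrightarrow> N.prob {\<omega>\<in>space N. W \<omega> \<notin> box_seq n K} < e"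
      using N.seq_tight[where U = W and n = n, OF W W0 e(1)] by blast
    define K where "K = real (max k1 k2)"
    obtain p where p: "p \<in> trigpoly n" "\<And>x. x \<in> box_seq n K \<Longrightarrow> \<bar>f x - p x\<bar> < e"
      using trigpoly_approx[OF f e(1)] by blast
    obtain B where B: "\<And>x. \<bar>p x\<bar> \<le> B" using trigpoly_bounded[OF p(1)] by blast
    \<comment> \<open>\<open>p\<close> is uncontrolled off the box, but it is globally bounded, so a polynomial
      approximating the truncation on its range repairs this inside the algebra.\<close>
    have "compact {-B..B}" "continuous_on {-B..B} (\<lambda>y. max (-F) (min F y))"
      by (rule compact_Icc, intro continuous_intros)
    from Stone_Weierstrass_real_polynomial_function[OF this e(1)] obtain q where
      q: "real_polynomial_function q" "\<And>y. y \<in> {-B..B} \<Longrightarrow> \<bar>max (-F) (min F y) - q y\<bar> < e" by blast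
    define h where "h = (\<lambda>x. q (p x))"
    have hT: "h \<in> trigpoly n" unfolding h_def by (rule trigpoly_polynomial[OF q(1) p(1)])
    have q': "\<bar>max (-F) (min F (p x)) - h x\<bar> < e" for x
      unfolding h_def using q(2)[of "p x"] B[of x] by (auto simp: abs_le_iff)
    have H: "\<bar>h x\<bar> \<le> F + 2 * e" for x using q'[of x] F0 e by (auto simp: abs_if max_def min_def split: if_splits)
    have fh: "\<bar>f x - h x\<bar> \<le> 2 * e" if "x \<in> box_seq n K" for x
      using q'[of x] p(2)[OF that] F[of x] by (auto simp: abs_if max_def min_def split: if_splits)
    have e2: "0 < 2 * e" "2 * e \<le> 1" using e by auto
    have "\<bar>(LINT \<omega>|M. f (U \<omega>)) - (LINT \<omega>|M. h (U \<omega>))\<bar> \<le> 2 * e * (2 * F + 2)"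
      by (rule M.approx_expectation[OF U f trigpoly_continuous[OF hT] F H e2 fh])
         (use k1[of K] e in \<open>auto simp: K_def\<close>)
    moreover have "\<bar>(LINT \<omega>|N. f (W \<omega>)) - (LINT \<omega>|N. h (W \<omega>))\<bar> \<le> 2 * e * (2 * F + 2)"
      by (rule N.approx_expectation[OF W f trigpoly_continuous[OF hT] F H e2 fh])
         (use k2[of K] e in \<open>auto simp: K_def\<close>)
    moreover have "(LINT \<omega>|M. h (U \<omega>)) = (LINT \<omega>|N. h (W \<omega>))"
      using trigpoly_expectation_cong[OF M N U W eq hT] by blast
    ultimately show ?thesis by (simp add: algebra_simps)
  qed
  show ?thesis
  proof (rule ccontr)
    assume "(LINT \<omega>|M. f (U \<omega>)) \<noteq> (LINT \<omega>|N. f (W \<omega>))"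
    then have d: "0 < \<bar>(LINT \<omega>|M. f (U \<omega>)) - (LINT \<omega>|N. f (W \<omega>))\<bar>" (is "0 < ?d") by simp
    \<comment> \<open>With this \<open>e\<close> the bound \<open>key\<close> is at most half of the
      difference assumed to be positive.\<close>
    define e where "e = min (1/2) (?d / (2 * (8 * F + 8)))"
    have "0 < e" "e \<le> 1/2" 
      unfolding e_def using d F0 by (simp_all add: min_def)
    from key[OF this] have "?d \<le> e * (8 * F + 8)" .
    also have "\<dots> \<le> ?d / (2 * (8 * F + 8)) * (8 * F + 8)" using F0 by (intro mult_right_mono) (auto simp: e_def)
    also have "\<dots> = ?d / 2" using F0 by (simp add: field_simps)
    finally show False using d by simp
  qed
qed

subsection \<open>Positive semidefinite matrices\<close>

definition qform :: "nat \<Rightarrow> (nat \<Rightarrow> nat \<Rightarrow> real) \<Rightarrow> (nat \<Rightarrow> real) \<Rightarrow> real" where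
  "qform n C c = (\<Sum>i<n. \<Sum>j<n. c i * c j * C i j)"

definition psd :: "nat \<Rightarrow> (nat \<Rightarrow> nat \<Rightarrow> real) \<Rightarrow> bool" where
  "psd n C \<longleftrightarrow> (\<forall>i<n. \<forall>j<n. C i j = C j i) \<and> (\<forall>c. 0 \<le> qform n C c)"

lemma psdD: "psd n C \<Longrightarrow> i < n \<Longrightarrow> j < n \<Longrightarrow> C i j = C j i" "psd n C \<Longrightarrow> 0 \<le> qform n C c"
  by (auto simp: psd_def)

lemma qform_cong:
  "(\<And>i j. i < n \<Longrightarrow> j < n \<Longrightarrow> C i j = D i j) \<Longrightarrow> (\<And>i. i < n \<Longrightarrow> c i = d i) \<Longrightarrow> qform n C c = qform n D d"
  by (simp add: qform_def)

lemma psd_cong: "(\<And>i j. i < n \<Longrightarrow> j < n \<Longrightarrow> C i j = D i j) \<Longrightarrow> psd n C \<longleftrightarrow> psd n D"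
  using qform_cong[of n C D] by (auto simp: psd_def)

lemma qform_add: "qform n (\<lambda>i j. C i j + D i j) c = qform n C c + qform n D c"
  by (simp add: qform_def sum.distrib distrib_left)

lemma qform_diff: "qform n (\<lambda>i j. C i j - D i j) c = qform n C c - qform n D c"
  by (simp add: qform_def sum_subtractf right_diff_distrib)

lemma qform_scale: "qform n (\<lambda>i j. k * C i j) c = k * qform n C c"
  by (simp add: qform_def sum_distrib_left mult.left_commute)

lemma qform_outer: "qform n (\<lambda>i j. b i * d j) c = lincomb n c b * lincomb n c d"
  unfolding qform_def lincomb_def sum_product by (simp add: mult_ac)

lemma qform_coeff_scale: "qform n C (\<lambda>i. s * c i) = s\<^sup>2 * qform n C c"
  by (simp add: qform_def sum_distrib_left power2_eq_square mult_ac)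

lemma qform_sum: "qform n (\<lambda>i j. \<Sum>k\<in>I. C k i j) c = (\<Sum>k\<in>I. qform n (C k) c)"
  by (induction I rule: infinite_finite_induct) (simp_all add: qform_add, simp_all add: qform_def)

lemma psd_add: "psd n C \<Longrightarrow> psd n D \<Longrightarrow> psd n (\<lambda>i j. C i j + D i j)"
  by (auto simp: psd_def qform_add)

lemma psd_scale: "psd n C \<Longrightarrow> 0 \<le> k \<Longrightarrow> psd n (\<lambda>i j. k * C i j)"
  by (auto simp: psd_def qform_scale)

lemma psd_outer: "psd n (\<lambda>i j. b i * b j)"
  by (auto simp: psd_def qform_outer)

lemma qform_Suc:
  assumes "\<And>i. i < n \<Longrightarrow> C n i = C i n"
  shows "qform (Suc n) C c = qform n C c + 2 * c n * lincomb n c (\<lambda>i. C i n) + (c n)\<^sup>2 * C n n"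
proof -
  have "(\<Sum>j<n. c n * c j * C n j) = (\<Sum>j<n. c j * c n * C j n)"
    by (intro sum.cong) (auto simp: assms)
  then show ?thesis
    by (simp add: qform_def lincomb_def sum.distrib sum_distrib_left power2_eq_square mult_ac)
qed

lemma lincomb_single: "k < n \<Longrightarrow> lincomb n (\<lambda>i. if i = k then t else 0) x = t * x k"
  by (simp add: lincomb_def if_distrib[of "\<lambda>a. a * _"] cong: if_cong)

lemma qform_single: "k < n \<Longrightarrow> qform n C (\<lambda>i. if i = k then t else 0) = t\<^sup>2 * C k k"
proof -
  assume k: "k < n"
  have "qform n C (\<lambda>i. if i = k then t else 0) =
    lincomb n (\<lambda>i. if i = k then t else 0) (\<lambda>i. lincomb n (\<lambda>i. if i = k then t else 0) (C i))"
    by (simp add: qform_def lincomb_def sum_distrib_left mult_ac)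
  then show ?thesis using k by (simp add: lincomb_single power2_eq_square)
qed

lemma qform_add_single:
  assumes C: "\<And>i j. i < n \<Longrightarrow> j < n \<Longrightarrow> C i j = C j i" and k: "k < n"
  shows "qform n C (\<lambda>i. c i + (if i = k then t else 0)) =
    qform n C c + 2 * t * lincomb n c (\<lambda>i. C i k) + t\<^sup>2 * C k k"
proof -
  let ?e = "\<lambda>i. if i = k then t else 0"
  have "qform n C (\<lambda>i. c i + ?e i) = qform n C c + lincomb n c (\<lambda>i. lincomb n ?e (C i))
     + lincomb n ?e (\<lambda>i. lincomb n c (C i)) + qform n C ?e"
    by (simp add: qform_def lincomb_def sum.distrib sum_distrib_left algebra_simps)
  moreover have "lincomb n c (C k) = lincomb n c (\<lambda>i. C i k)"
    unfolding lincomb_def using k C by (intro sum.cong) auto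
  moreover have "lincomb n c (\<lambda>i. t * C i k) = t * lincomb n c (\<lambda>i. C i k)"
    by (simp add: lincomb_def sum_distrib_left mult_ac)
  ultimately show ?thesis using k by (simp add: lincomb_single qform_single)
qed

lemma psd_diag_nonneg: "psd n C \<Longrightarrow> k < n \<Longrightarrow> 0 \<le> C k k"
  using qform_single[of k n C 1] psdD(2)[of n C "\<lambda>i. if i = k then 1 else 0"] by simp

lemma psd_zero_diag:
  assumes C: "psd n C" and "i < n" "k < n" and z: "C k k = 0"
  shows "C i k = 0"
proof (rule ccontr)
  assume nz: "C i k \<noteq> 0"
  have "0 \<le> qform n C (\<lambda>j. (if j = i then 1 else 0) + (if j = k then t else 0))" for t
    by (rule psdD(2)[OF C])
  then have "0 \<le> C i i + 2 * t * C i k" for t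
    using assms by (simp add: qform_add_single psdD(1)[OF C] qform_single lincomb_single)
  \<comment> \<open>This \<open>t\<close> gives the linear expression the value
    \<open>- 1\<close>.\<close>
  from this[of "- (C i i + 1) / (2 * C i k)"] nz show False by (simp add: field_simps)
qed

text \<open>The pivot may vanish: then \<open>C i k / sqrt 0 = 0\<close> is the correct value by
  \<open>psd_zero_diag\<close>.\<close>

lemma psd_schur:
  assumes C: "psd n C" and k: "k < n"
  defines "b \<equiv> \<lambda>i. C i k / sqrt (C k k)"
  shows "psd n (\<lambda>i j. C i j - b i * b j)" "\<And>i. i < n \<Longrightarrow> b i * b k = C i k"
proof -
  have d: "0 \<le> C k k" using psd_diag_nonneg[OF C k] .
  show "b i * b k = C i k" if "i < n" for i
    using d psd_zero_diag[OF C that k] by (cases "C k k = 0") (auto simp: b_def)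
  have "0 \<le> qform n C c - (lincomb n c b)\<^sup>2" for c
  proof (cases "C k k = 0")
    case True then show ?thesis using psdD(2)[OF C, of c] by (simp add: b_def lincomb_def)
  next
    case False
    with d have p: "0 < C k k" by simp
    define l where "l = lincomb n c (\<lambda>i. C i k)"
    have "lincomb n c b = l / sqrt (C k k)"
      by (simp add: b_def l_def lincomb_def sum_divide_distrib)
    then have sq: "(lincomb n c b)\<^sup>2 = l\<^sup>2 / C k k" using d by (simp add: power_divide)
    \<comment> \<open>Completing the square: the shift \<open>- l / C k k\<close> minimises the form
      in coordinate \<open>k\<close>, and the minimum is the Schur complement.\<close>
    have "0 \<le> qform n C (\<lambda>i. c i + (if i = k then - l / C k k else 0))" by (rule psdD(2)[OF C])
    also have "\<dots> = qform n C c - l\<^sup>2 / C k k"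
      using p by (subst qform_add_single[OF psdD(1)[OF C] k])
        (auto simp: l_def[symmetric] power2_eq_square field_simps)
    finally show ?thesis using sq by simp
  qed
  then show "psd n (\<lambda>i j. C i j - b i * b j)"
    using psdD(1)[OF C] by (auto simp: psd_def qform_diff qform_outer power2_eq_square mult_ac)
qed

lemma psd_restrict: "psd (Suc n) C \<Longrightarrow> psd n C"
proof -
  assume C: "psd (Suc n) C"
  have "qform n C c = qform (Suc n) C (\<lambda>i. if i < n then c i else 0)" for c
    using psdD(1)[OF C] by (subst qform_Suc) (auto intro: qform_cong)
  with C show ?thesis by (auto simp: psd_def)
qed

text \<open>Eliminating the last coordinate by a Schur complement leaves a matrix whose last row and
  column vanish, to which the induction hypothesis applies after restriction. Singular matrices are
  covered because the pivot may be 0.\<close>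

lemma cholesky:
  "psd n C \<Longrightarrow> \<exists>L. \<forall>i<n. \<forall>j<n. C i j = (\<Sum>k<n. L i k * L j k)"
proof (induction n arbitrary: C)
  case (Suc n)
  define b where "b = (\<lambda>i. C i n / sqrt (C n n))"
  have schur1: "psd (Suc n) (\<lambda>i j. C i j - b i * b j)"
    unfolding b_def by (rule psd_schur(1)[OF Suc.prems lessI])
  have schur2: "b i * b n = C i n" if "i < Suc n" for i
    unfolding b_def by (rule psd_schur(2)[OF Suc.prems lessI that])
  have "psd n (\<lambda>i j. C i j - b i * b j)" by (rule psd_restrict[OF schur1])
  from Suc.IH[OF this] obtain L where
    L: "\<And>i j. i < n \<Longrightarrow> j < n \<Longrightarrow> C i j - b i * b j = (\<Sum>k<n. L i k * L j k)" by blast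
  \<comment> \<open>The new column is \<open>b\<close>; row \<open>n\<close> is 0 in the old columns
    because the complement vanishes in that row.\<close>
  define L' where "L' = (\<lambda>i k. if k = n then b i else if i = n then 0 else L i k)"
  have "C i j = (\<Sum>k<Suc n. L' i k * L' j k)" if ij: "i < Suc n" "j < Suc n" for i j
  proof (cases "i = n \<or> j = n")
    case True
    then have "(\<Sum>k<n. L' i k * L' j k) = 0" by (intro sum.neutral) (auto simp: L'_def)
    moreover have "C i j = b i * b j"
      using True schur2[of i] schur2[of j] ij psdD(1)[OF Suc.prems, of i j] by (auto simp: mult.commute)
    ultimately show ?thesis by (simp add: L'_def)
  next
    case False
    with ij have "i < n" "j < n" by auto
    moreover have "(\<Sum>k<n. L' i k * L' j k) = (\<Sum>k<n. L i k * L j k)"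
      using False by (intro sum.cong) (auto simp: L'_def)
    ultimately show ?thesis using L[of i j] by (simp add: L'_def)
  qed
  then show ?case by blast
qed simp

subsection \<open>Gaussian vectors and the expected minimum\<close>

text \<open>A centered Gaussian vector, given by the characteristic functions of its linear
  combinations: singular \<open>C\<close> is allowed, and sums, linear images and limits are easy to
  treat. Only the symmetric part of \<open>C\<close> enters, so symmetry is demanded separately
  where the entries themselves matter.\<close>

definition gvec :: "'a measure \<Rightarrow> (nat \<Rightarrow> 'a \<Rightarrow> real) \<Rightarrow> nat \<Rightarrow> (nat \<Rightarrow> nat \<Rightarrow> real) \<Rightarrow> bool" where
  "gvec M X n C \<longleftrightarrow> prob_space M \<and> (\<forall>i<n. X i \<in> borel_measurable M) \<and>
     (\<forall>c. (CLINT \<omega>|M. iexp (lincomb n c (\<lambda>i. X i \<omega>))) = complex_of_real (exp (- qform n C c / 2)))"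

lemma gvecD:
  assumes "gvec M X n C"
  shows "prob_space M" "\<And>i. i < n \<Longrightarrow> X i \<in> borel_measurable M"
    "(CLINT \<omega>|M. iexp (lincomb n c (\<lambda>i. X i \<omega>))) = complex_of_real (exp (- qform n C c / 2))"
  using assms by (auto simp: gvec_def)

lemma measurable_lincomb [measurable (raw)]:
  "(\<And>i. i < n \<Longrightarrow> X i \<in> borel_measurable M) \<Longrightarrow> (\<lambda>\<omega>. lincomb n c (\<lambda>i. X i \<omega>)) \<in> borel_measurable M"
  unfolding lincomb_def by (intro borel_measurable_sum borel_measurable_times) auto

lemma gvec_cong: "gvec M X n C \<Longrightarrow> (\<And>i j. i < n \<Longrightarrow> j < n \<Longrightarrow> C i j = D i j) \<Longrightarrow> gvec M X n D"
  using qform_cong[of n C D] by (auto simp: gvec_def)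

text \<open>A characteristic function has modulus at most 1.\<close>

lemma gvec_qform_nonneg: assumes "gvec M X n C" shows "0 \<le> qform n C c"
proof -
  interpret prob_space M by (rule gvecD[OF assms])
  have [measurable]: "\<And>i. i < n \<Longrightarrow> X i \<in> borel_measurable M" by (rule gvecD[OF assms])
  have "cmod (CLINT \<omega>|M. iexp (lincomb n c (\<lambda>i. X i \<omega>))) \<le> (LINT \<omega>|M. 1)"
    by (rule order_trans[OF integral_norm_bound]) (simp add: prob_space)
  then show ?thesis by (simp add: gvecD(3)[OF assms] prob_space)
qed

lemma gvec_psd: "gvec M X n C \<Longrightarrow> (\<And>i j. i < n \<Longrightarrow> j < n \<Longrightarrow> C i j = C j i) \<Longrightarrow> psd n C"
  by (simp add: psd_def gvec_qform_nonneg)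

text \<open>Both laws have the same characteristic function. Exponential moments and variances
  thereby become one-dimensional integrals; a vanishing form gives the point mass at 0.\<close>

lemma gvec_distr:
  assumes X: "gvec M X n C"
  shows "distr M borel (\<lambda>\<omega>. lincomb n c (\<lambda>i. X i \<omega>)) =
    distr std_normal_distribution borel (\<lambda>z. sqrt (qform n C c) * z)"
proof (rule Levy_uniqueness)
  interpret prob_space M by (rule gvecD[OF X])
  interpret SN: real_distribution std_normal_distribution by (rule real_dist_normal_dist)
  have [measurable]: "\<And>i. i < n \<Longrightarrow> X i \<in> borel_measurable M" by (rule gvecD[OF X])
  show "real_distribution (distr M borel (\<lambda>\<omega>. lincomb n c (\<lambda>i. X i \<omega>)))"
    by (rule real_distribution_distr) measurable
  show "real_distribution (distr std_normal_distribution borel (\<lambda>z. sqrt (qform n C c) * z))"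
    by (rule SN.real_distribution_distr) simp
  have q: "0 \<le> qform n C c" by (rule gvec_qform_nonneg[OF X])
  have "char (distr M borel (\<lambda>\<omega>. lincomb n c (\<lambda>i. X i \<omega>))) s =
      char (distr std_normal_distribution borel (\<lambda>z. sqrt (qform n C c) * z)) s" for s
  proof -
    have "char (distr M borel (\<lambda>\<omega>. lincomb n c (\<lambda>i. X i \<omega>))) s =
        (CLINT \<omega>|M. iexp (lincomb n (\<lambda>i. s * c i) (\<lambda>i. X i \<omega>)))"
      unfolding char_def by (subst integral_distr) (simp_all add: lincomb_scale)
    also have "\<dots> = complex_of_real (exp (- (s * sqrt (qform n C c))\<^sup>2 / 2))"
      using q by (simp add: gvecD(3)[OF X] qform_coeff_scale power_mult_distrib)
    also have "\<dots> = char std_normal_distribution (s * sqrt (qform n C c))"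
      by (simp add: char_std_normal_distribution)
    also have "\<dots> = char (distr std_normal_distribution borel (\<lambda>z. sqrt (qform n C c) * z)) s"
      unfolding char_def by (subst integral_distr) (simp_all add: mult.assoc)
    finally show ?thesis .
  qed
  then show "char (distr M borel (\<lambda>\<omega>. lincomb n c (\<lambda>i. X i \<omega>))) =
      char (distr std_normal_distribution borel (\<lambda>z. sqrt (qform n C c) * z))" by (rule ext)
qed

text \<open>Completing the square: the factor \<open>exp (a * z - a\<^sup>2 / 2)\<close> turns the
  standard normal density into the one centered at \<open>a\<close>. This is the Cameron-Martin
  formula in dimension one.\<close>

lemma std_normal_tilt:
  fixes h :: "real \<Rightarrow> real"
  assumes [measurable]: "h \<in> borel_measurable borel"
  shows "(LINT z|std_normal_distribution. exp (a * z - a\<^sup>2 / 2) * h z) =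
    (LINT z|std_normal_distribution. h (z + a))"
proof -
  have eq: "std_normal_density (a + z) * exp (a * (a + z) - a\<^sup>2 / 2) = std_normal_density z" for z
    by (simp add: std_normal_density_def exp_add[symmetric] power2_eq_square field_simps)
  have "(LINT z|std_normal_distribution. exp (a * z - a\<^sup>2 / 2) * h z) =
      (LINT z|lborel. std_normal_density z * (exp (a * z - a\<^sup>2 / 2) * h z))"
    by (subst integral_density) auto
  also have "\<dots> = (LINT z|lborel. std_normal_density (a + 1 * z) * (exp (a * (a + 1 * z) - a\<^sup>2 / 2) * h (a + 1 * z)))"
    by (subst lborel_integral_real_affine[where c = 1 and t = a]) simp_all
  also have "\<dots> = (LINT z|lborel. std_normal_density z * h (z + a))"
    by (simp add: mult.assoc[symmetric] eq) (simp add: add.commute)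
  also have "\<dots> = (LINT z|std_normal_distribution. h (z + a))"
    by (subst integral_density) auto
  finally show ?thesis .
qed

lemma std_normal_exp:
  shows "integrable std_normal_distribution (\<lambda>z. exp (a * z))"
    and "(LINT z|std_normal_distribution. exp (a * z)) = exp (a\<^sup>2 / 2)"
proof -
  have eq: "std_normal_density z * exp (a * z) = exp (a\<^sup>2 / 2) * normal_density a 1 z" for z
    by (simp add: normal_density_def exp_add[symmetric] power2_eq_square field_simps)
  show "integrable std_normal_distribution (\<lambda>z. exp (a * z))"
    by (subst integrable_density) (auto simp: eq)
  show "(LINT z|std_normal_distribution. exp (a * z)) = exp (a\<^sup>2 / 2)"
    by (subst integral_density) (auto simp: eq)
qed

lemma gvec_exp_lincomb:
  assumes X: "gvec M X n C"
  shows "integrable M (\<lambda>\<omega>. exp (lincomb n c (\<lambda>i. X i \<omega>)))"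
    and "(LINT \<omega>|M. exp (lincomb n c (\<lambda>i. X i \<omega>))) = exp (qform n C c / 2)"
proof -
  have [measurable]: "\<And>i. i < n \<Longrightarrow> X i \<in> borel_measurable M" by (rule gvecD[OF X])
  have q: "0 \<le> qform n C c" by (rule gvec_qform_nonneg[OF X])
  have "integrable (distr std_normal_distribution borel (\<lambda>z. sqrt (qform n C c) * z)) exp"
    by (subst integrable_distr_eq) (simp_all add: std_normal_exp)
  then show "integrable M (\<lambda>\<omega>. exp (lincomb n c (\<lambda>i. X i \<omega>)))"
    unfolding gvec_distr[OF X, symmetric] by (subst (asm) integrable_distr_eq) simp_all
  have "(LINT \<omega>|M. exp (lincomb n c (\<lambda>i. X i \<omega>))) =
      integral\<^sup>L (distr std_normal_distribution borel (\<lambda>z. sqrt (qform n C c) * z)) exp"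
    unfolding gvec_distr[OF X, symmetric] by (subst integral_distr) simp_all
  also have "\<dots> = exp (qform n C c / 2)"
    using q by (subst integral_distr) (simp_all add: std_normal_exp)
  finally show "(LINT \<omega>|M. exp (lincomb n c (\<lambda>i. X i \<omega>))) = exp (qform n C c / 2)" .
qed

lemma gvec_exp_coord:
  assumes X: "gvec M X n C" and k: "k < n"
  shows "integrable M (\<lambda>\<omega>. exp (a * X k \<omega>))" and "(LINT \<omega>|M. exp (a * X k \<omega>)) = exp (a\<^sup>2 * C k k / 2)"
  using gvec_exp_lincomb[OF X, of "\<lambda>i. if i = k then a else 0"] k by (simp_all add: lincomb_single qform_single)

lemma integral_pair_mult:
  fixes f :: "'a \<Rightarrow> 'c::{real_normed_field, banach, second_countable_topology}"
  assumes "prob_space M" "prob_space N" and f: "integrable M f" and g: "integrable N g"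
  shows "integrable (M \<Otimes>\<^sub>M N) (\<lambda>p. f (fst p) * g (snd p))"
    and "(LINT p|(M \<Otimes>\<^sub>M N). f (fst p) * g (snd p)) = integral\<^sup>L M f * integral\<^sup>L N g"
proof -
  interpret M: prob_space M by fact
  interpret N: prob_space N by fact
  interpret pair_prob_space M N ..
  have [measurable]: "f \<in> borel_measurable M" "g \<in> borel_measurable N" using f g by auto
  show i: "integrable (M \<Otimes>\<^sub>M N) (\<lambda>p. f (fst p) * g (snd p))"
  proof (rule Fubini_integrable)
    show "integrable M (\<lambda>x. \<integral>y. norm (f (fst (x, y)) * g (snd (x, y))) \<partial>N)"
      using f by (simp add: norm_mult)
    show "AE x in M. integrable N (\<lambda>y. f (fst (x, y)) * g (snd (x, y)))"
      using g by simp
  qed measurable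
  show "(LINT p|(M \<Otimes>\<^sub>M N). f (fst p) * g (snd p)) = integral\<^sup>L M f * integral\<^sup>L N g"
    using f g by (subst integral_fst'[OF i, symmetric]) simp
qed

lemma prob_space_pair: "prob_space M \<Longrightarrow> prob_space N \<Longrightarrow> prob_space (M \<Otimes>\<^sub>M N)"
proof -
  assume "prob_space M" "prob_space N"
  then interpret M: prob_space M + N: prob_space N .
  interpret pair_prob_space M N ..
  show ?thesis by unfold_locales
qed

lemma gvec_pair_add:
  assumes X: "gvec M X n C" and Y: "gvec N Y n D"
  shows "gvec (M \<Otimes>\<^sub>M N) (\<lambda>i p. X i (fst p) + Y i (snd p)) n (\<lambda>i j. C i j + D i j)"
proof -
  have m[measurable]: "\<And>i. i < n \<Longrightarrow> X i \<in> borel_measurable M" "\<And>i. i < n \<Longrightarrow> Y i \<in> borel_measurable N"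
    using X Y gvecD by auto
  interpret M: prob_space M by (rule gvecD[OF X])
  interpret N: prob_space N by (rule gvecD[OF Y])
  have i: "integrable M (\<lambda>\<omega>. iexp (lincomb n c (\<lambda>i. X i \<omega>)))" "integrable N (\<lambda>\<omega>. iexp (lincomb n c (\<lambda>i. Y i \<omega>)))" for c
    by (auto intro!: M.integrable_iexp N.integrable_iexp)
  have "(CLINT p|(M \<Otimes>\<^sub>M N). iexp (lincomb n c (\<lambda>i. X i (fst p) + Y i (snd p)))) =
      complex_of_real (exp (- qform n (\<lambda>i j. C i j + D i j) c / 2))" for c
  proof -
    have "(CLINT p|(M \<Otimes>\<^sub>M N). iexp (lincomb n c (\<lambda>i. X i (fst p) + Y i (snd p)))) =
      (CLINT p|(M \<Otimes>\<^sub>M N). iexp (lincomb n c (\<lambda>i. X i (fst p))) * iexp (lincomb n c (\<lambda>i. Y i (snd p))))"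
      by (simp add: lincomb_add_right distrib_left exp_add)
    also have "\<dots> = complex_of_real (exp (- qform n C c / 2)) * complex_of_real (exp (- qform n D c / 2))"
      using integral_pair_mult(2)[OF M.prob_space_axioms N.prob_space_axioms i]
      unfolding gvecD(3)[OF X] gvecD(3)[OF Y] .
    also have "\<dots> = complex_of_real (exp (- qform n (\<lambda>i j. C i j + D i j) c / 2))"
      by (simp only: of_real_mult[symmetric] exp_add[symmetric] qform_add) (simp add: add_divide_distrib)
    finally show ?thesis .
  qed
  moreover have "(\<lambda>p. X i (fst p) + Y i (snd p)) \<in> borel_measurable (M \<Otimes>\<^sub>M N)" if "i < n" for i
    using m(1)[OF that] m(2)[OF that] by simp
  ultimately show ?thesis
    unfolding gvec_def by (auto intro!: prob_space_pair M.prob_space_axioms N.prob_space_axioms)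
qed

lemma gvec_std_normal: "gvec std_normal_distribution (\<lambda>i z. b i * z) n (\<lambda>i j. b i * b j)"
proof -
  have "lincomb n c (\<lambda>i. b i * z) = lincomb n c b * z" for c z
    by (simp add: lincomb_def sum_distrib_right mult.assoc)
  moreover have "(CLINT z|std_normal_distribution. iexp (t * z)) = complex_of_real (exp (- t\<^sup>2 / 2))" for t
    using fun_cong[OF char_std_normal_distribution, of t] by (simp add: char_def)
  ultimately show ?thesis
    using real_dist_normal_dist unfolding gvec_def real_distribution_def
    by (auto simp: qform_outer power2_eq_square)
qed

text \<open>The Cholesky factor is applied to \<open>n\<close> independent standard normal
  variables. Their product space has points of type \<open>nat \<Rightarrow> real\<close>, the type
  over which \<open>\<phi>\<close> chooses its sample space.\<close>

lemma gvec_exists: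
  assumes "psd n C"
  shows "\<exists>(M :: (nat \<Rightarrow> real) measure) X. gvec M X n C"
proof -
  obtain L where L: "\<And>i j. i < n \<Longrightarrow> j < n \<Longrightarrow> C i j = (\<Sum>k<n. L i k * L j k)"
    using cholesky[OF assms] by blast
  interpret SN: real_distribution std_normal_distribution by (rule real_dist_normal_dist)
  interpret P: product_prob_space "\<lambda>_. std_normal_distribution" "{..<n}" ..
  have "(CLINT x|(\<Pi>\<^sub>M k\<in>{..<n}. std_normal_distribution). iexp (lincomb n c (\<lambda>i. \<Sum>k<n. L i k * x k))) =
      complex_of_real (exp (- qform n C c / 2))" for c
  proof -
    define a where "a k = lincomb n c (\<lambda>i. L i k)" for k
    have "lincomb n c (\<lambda>i. \<Sum>k<n. L i k * x k) = (\<Sum>k<n. a k * x k)" for x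
      unfolding a_def lincomb_def sum_distrib_left sum_distrib_right
      by (subst sum.swap) (simp add: mult.assoc)
    then have "(CLINT x|(\<Pi>\<^sub>M k\<in>{..<n}. std_normal_distribution). iexp (lincomb n c (\<lambda>i. \<Sum>k<n. L i k * x k))) =
       (CLINT x|(\<Pi>\<^sub>M k\<in>{..<n}. std_normal_distribution). (\<Prod>k<n. iexp (a k * x k)))"
      by (simp add: exp_sum sum_distrib_left)
    also have "\<dots> = (\<Prod>k<n. (CLINT z|std_normal_distribution. iexp (a k * z)))"
      by (rule P.product_integral_prod) (auto intro!: SN.integrable_iexp)
    also have "\<dots> = (\<Prod>k<n. complex_of_real (exp (- (a k)\<^sup>2 / 2)))"
      using fun_cong[OF char_std_normal_distribution] by (simp add: char_def)
    also have "\<dots> = complex_of_real (exp (- (\<Sum>k<n. (a k)\<^sup>2) / 2))"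
      by (simp add: exp_sum[symmetric] sum_negf sum_divide_distrib flip: of_real_prod)
    also have "(\<Sum>k<n. (a k)\<^sup>2) = qform n C c"
    proof -
      have "qform n C c = qform n (\<lambda>i j. \<Sum>k<n. L i k * L j k) c" using L by (intro qform_cong) auto
      then show ?thesis by (simp add: qform_sum qform_outer a_def power2_eq_square)
    qed
    finally show ?thesis .
  qed
  moreover have "(\<lambda>x. \<Sum>k<n. L i k * x k) \<in> borel_measurable (\<Pi>\<^sub>M k\<in>{..<n}. std_normal_distribution)" for i
    by measurable
  ultimately have "gvec (\<Pi>\<^sub>M k\<in>{..<n}. std_normal_distribution) (\<lambda>i x. \<Sum>k<n. L i k * x k) n C"
    using P.prob_space_axioms by (simp add: gvec_def)
  then show ?thesis by blast
qed

section \<open>The expected minimum as a function of the covariance matrix\<close>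

definition emin :: "'a measure \<Rightarrow> (nat \<Rightarrow> 'a \<Rightarrow> real) \<Rightarrow> (nat \<Rightarrow> real) \<Rightarrow> nat \<Rightarrow> real" where
  "emin M X v n = (LINT \<omega>|M. Min ((\<lambda>i. exp (sqrt 2 * X i \<omega> - v i)) ` {..<n}))"

lemma Min_exp_le: "i < (n :: nat) \<Longrightarrow> Min ((\<lambda>i. exp (f i)) ` {..<n}) \<le> exp (f i :: real)"
  by (intro Min_le) auto

lemma Min_exp_ge: "0 < (n :: nat) \<Longrightarrow> (\<And>i. i < n \<Longrightarrow> a \<le> exp (f i :: real)) \<Longrightarrow> a \<le> Min ((\<lambda>i. exp (f i)) ` {..<n})"
  by (subst Min_ge_iff) auto

lemma Min_exp_pos: "0 < (n :: nat) \<Longrightarrow> 0 < Min ((\<lambda>i. exp (f i :: real)) ` {..<n})"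
  by (subst Min_gr_iff) auto

lemma Min_exp_cong: "(\<And>i. i < (n :: nat) \<Longrightarrow> f i = g i) \<Longrightarrow> Min ((\<lambda>i. exp (f i)) ` {..<n}) = Min ((\<lambda>i. exp (g i :: real)) ` {..<n})"
  by (rule arg_cong[where f = Min], rule image_cong) auto

lemma Min_exp_add:
  assumes n: "0 < (n :: nat)" shows "Min ((\<lambda>i. exp (f i + a :: real)) ` {..<n}) = exp a * Min ((\<lambda>i. exp (f i)) ` {..<n})"
proof -
  have "mono (\<lambda>x. exp a * x :: real)" by (auto intro: monoI)
  from mono_Min_commute[OF this, of "(\<lambda>i. exp (f i)) ` {..<n}"] n
  have "exp a * Min ((\<lambda>i. exp (f i)) ` {..<n}) = Min ((\<lambda>i. exp a * exp (f i)) ` {..<n})"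
    by (auto simp: image_image)
  then show ?thesis by (simp add: exp_add mult.commute)
qed

lemma continuous_Min_exp:
  assumes "\<And>i. i < n \<Longrightarrow> continuous_on A (f i)" and "0 < (n :: nat)"
  shows "continuous_on A (\<lambda>x. Min ((\<lambda>i. exp (f i x :: real)) ` {..<n}))"
proof -
  have "I \<subseteq> {..<n} \<Longrightarrow> continuous_on A (\<lambda>x. Min ((\<lambda>i. exp (f i x)) ` I))" if "finite I" "I \<noteq> {}" for I
    using that by (induction rule: finite_ne_induct) (auto intro!: continuous_on_exp continuous_on_min assms)
  from this[of "{..<n}"] show ?thesis using \<open>0 < n\<close> by auto
qed

lemma integrable_Min_exp:
  assumes X: "gvec M X n C" and n: "0 < n"
  shows "integrable M (\<lambda>\<omega>. Min ((\<lambda>i. exp (sqrt 2 * X i \<omega> - v i)) ` {..<n}))"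
proof (rule Bochner_Integration.integrable_bound)
  have [measurable]: "\<And>i. i < n \<Longrightarrow> X i \<in> borel_measurable M" by (rule gvecD[OF X])
  show "integrable M (\<lambda>\<omega>. exp (- v 0) * exp (sqrt 2 * X 0 \<omega>))" using gvec_exp_coord[OF X n] by simp
  show "(\<lambda>\<omega>. Min ((\<lambda>i. exp (sqrt 2 * X i \<omega> - v i)) ` {..<n})) \<in> borel_measurable M"
    by (rule borel_measurable_Min) auto
  show "AE \<omega> in M. norm (Min ((\<lambda>i. exp (sqrt 2 * X i \<omega> - v i)) ` {..<n})) \<le> norm (exp (- v 0) * exp (sqrt 2 * X 0 \<omega>))"
    using Min_exp_pos[OF n] Min_exp_le[OF n]
    by (intro AE_I2) (simp add: less_imp_le exp_add[symmetric] abs_of_pos add.commute)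
qed

text \<open>The minimum is a continuous but unbounded function of the vector. It is capped at
  \<open>k\<close>, where the uniqueness theorem applies, and the cap is removed by dominated
  convergence.\<close>

lemma emin_unique:
  assumes X: "gvec M X n C" and Y: "gvec N Y n C" and n: "0 < n"
  shows "emin M X v n = emin N Y v n"
proof -
  let ?f = "\<lambda>x. Min ((\<lambda>i. exp (sqrt 2 * x i - v i)) ` {..<n})"
  have cont: "continuous_on UNIV ?f"
    using n by (intro continuous_Min_exp continuous_intros) auto
  interpret M: prob_space M by (rule gvecD[OF X])
  interpret N: prob_space N by (rule gvecD[OF Y])
  \<comment> \<open>Coordinates from \<open>n\<close> on are set to 0, as the uniqueness theorem
    requires; neither the linear combinations nor the minimum see them.\<close>
  define U where "U \<omega> i = (if i < n then X i \<omega> else 0)" for \<omega> i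
  define W where "W \<omega> i = (if i < n then Y i \<omega> else 0)" for \<omega> i
  have mU: "(\<lambda>\<omega>. U \<omega> i) \<in> borel_measurable M" for i using gvecD(2)[OF X] by (cases "i < n") (simp_all add: U_def)
  have mW: "(\<lambda>\<omega>. W \<omega> i) \<in> borel_measurable N" for i using gvecD(2)[OF Y] by (cases "i < n") (simp_all add: W_def)
  have lU: "lincomb n c (U \<omega>) = lincomb n c (\<lambda>i. X i \<omega>)" for c \<omega> by (simp add: lincomb_def U_def)
  have lW: "lincomb n c (W \<omega>) = lincomb n c (\<lambda>i. Y i \<omega>)" for c \<omega> by (simp add: lincomb_def W_def)
  have fU: "?f (U \<omega>) = ?f (\<lambda>i. X i \<omega>)" for \<omega> by (rule Min_exp_cong) (simp add: U_def)
  have fW: "?f (W \<omega>) = ?f (\<lambda>i. Y i \<omega>)" for \<omega> by (rule Min_exp_cong) (simp add: W_def)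
  have eq: "(LINT \<omega>|M. min (?f (U \<omega>)) (real k)) = (LINT \<omega>|N. min (?f (W \<omega>)) (real k))" for k
  proof (rule expectation_eq_of_char_eq[where n = n and F = "real k" and f = "\<lambda>x. min (?f x) (real k)"])
    show "continuous_on UNIV (\<lambda>x. min (?f x) (real k))" by (intro continuous_on_min cont continuous_on_const)
    show "\<bar>min (?f x) (real k)\<bar> \<le> real k" for x
      using Min_exp_pos[OF n, of "\<lambda>i. sqrt 2 * x i - v i"] by auto
    show "(CLINT \<omega>|M. iexp (lincomb n c (U \<omega>))) = (CLINT \<omega>|N. iexp (lincomb n c (W \<omega>)))" for c
      unfolding lU lW gvecD(3)[OF X] gvecD(3)[OF Y] ..
  qed (auto simp: mU mW, auto simp: U_def W_def M.prob_space_axioms N.prob_space_axioms)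
  have lim: "(\<lambda>k. LINT \<omega>|K. min (h \<omega>) (real k)) \<longlonglongrightarrow> (LINT \<omega>|K. h \<omega>)"
    if h: "integrable K h" "\<And>\<omega>. 0 < h \<omega>" for K and h :: "'c \<Rightarrow> real"
  proof (rule integral_dominated_convergence[where w = h])
    have [measurable]: "h \<in> borel_measurable K" using h by auto
    show "(\<lambda>\<omega>. min (h \<omega>) (real k)) \<in> borel_measurable K" for k by measurable
    show "AE \<omega> in K. (\<lambda>k. min (h \<omega>) (real k)) \<longlonglongrightarrow> h \<omega>"
    proof (rule AE_I2, rule tendsto_eventually)
      fix \<omega>
      obtain k0 :: nat where "h \<omega> \<le> k0" using real_arch_simple by blast
      then show "\<forall>\<^sub>F k in sequentially. min (h \<omega>) (real k) = h \<omega>"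
        unfolding eventually_sequentially by (metis min.absorb1 of_nat_le_iff order_trans)
    qed
    show "AE \<omega> in K. norm (min (h \<omega>) (real k)) \<le> h \<omega>" for k using h(2) by (auto intro!: AE_I2 simp: less_imp_le)
  qed (use h in auto)
  have 1: "(\<lambda>k. LINT \<omega>|M. min (?f (U \<omega>)) (real k)) \<longlonglongrightarrow> (LINT \<omega>|M. ?f (U \<omega>))"
    unfolding fU using integrable_Min_exp[OF X n] Min_exp_pos[OF n] by (intro lim) auto
  have 2: "(\<lambda>k. LINT \<omega>|N. min (?f (W \<omega>)) (real k)) \<longlonglongrightarrow> (LINT \<omega>|N. ?f (W \<omega>))"
    unfolding fW using integrable_Min_exp[OF Y n] Min_exp_pos[OF n] by (intro lim) auto
  have "(\<lambda>k. LINT \<omega>|M. min (?f (U \<omega>)) (real k)) \<longlonglongrightarrow> (LINT \<omega>|N. ?f (W \<omega>))"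
    using 2 by (simp only: eq)
  from LIMSEQ_unique[OF 1 this] show ?thesis unfolding emin_def fU fW .
qed

text \<open>Only meaningful for positive semidefinite \<open>C\<close> and \<open>0 < n\<close>.\<close>

definition \<phi> :: "nat \<Rightarrow> (nat \<Rightarrow> nat \<Rightarrow> real) \<Rightarrow> real" where
  "\<phi> n C = (SOME r. \<exists>(M :: (nat \<Rightarrow> real) measure) X. gvec M X n C \<and> r = emin M X (\<lambda>i. C i i) n)"

text \<open>Well-definedness of \<open>\<phi>\<close>: its choice ranges over one type of sample
  space only, whereas \<open>X\<close> may live on any probability space. Symmetry makes
  \<open>C\<close> positive semidefinite, so that the choice is not vacuous.\<close>

lemma phi_eq:
  assumes X: "gvec M X n C" and sym: "\<And>i j. i < n \<Longrightarrow> j < n \<Longrightarrow> C i j = C j i" and n: "0 < n"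
  shows "emin M X (\<lambda>i. C i i) n = \<phi> n C"
proof -
  have "\<exists>(N :: (nat \<Rightarrow> real) measure) Y. gvec N Y n C" by (rule gvec_exists[OF gvec_psd[OF X sym]])
  then have "\<exists>(N :: (nat \<Rightarrow> real) measure) Y. gvec N Y n C \<and> \<phi> n C = emin N Y (\<lambda>i. C i i) n"
    unfolding \<phi>_def by (intro someI_ex[of "\<lambda>r. \<exists>N Y. gvec N Y n C \<and> r = emin N Y (\<lambda>i. C i i) n"]) blast
  then show ?thesis using emin_unique[OF X _ n] by auto
qed

lemma phi_obtain:
  assumes "psd n C" "0 < n"
  obtains M :: "(nat \<Rightarrow> real) measure" and X where "gvec M X n C" "\<phi> n C = emin M X (\<lambda>i. C i i) n"
  using gvec_exists[OF assms(1)] phi_eq psdD(1)[OF assms(1)] assms(2) by metis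

lemma phi_cong:
  assumes "psd n C" "0 < n" and eq: "\<And>i j. i < n \<Longrightarrow> j < n \<Longrightarrow> C i j = D i j"
  shows "\<phi> n C = \<phi> n D"
proof -
  obtain M :: "(nat \<Rightarrow> real) measure" and X where X: "gvec M X n C" "\<phi> n C = emin M X (\<lambda>i. C i i) n"
    using phi_obtain assms by blast
  have "emin M X (\<lambda>i. C i i) n = emin M X (\<lambda>i. D i i) n"
    unfolding emin_def using eq by (intro Bochner_Integration.integral_cong refl Min_exp_cong) auto
  moreover have "emin M X (\<lambda>i. D i i) n = \<phi> n D"
    using psdD(1)[OF assms(1)] eq assms(2) by (intro phi_eq gvec_cong[OF X(1)]) auto
  ultimately show ?thesis using X(2) by simp
qed

lemma phi_pos:
  assumes "psd n C" "0 < n" shows "0 < \<phi> n C"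
proof -
  obtain M :: "(nat \<Rightarrow> real) measure" and X where X: "gvec M X n C" "\<phi> n C = emin M X (\<lambda>i. C i i) n"
    using phi_obtain assms by blast
  interpret prob_space M by (rule gvecD[OF X(1)])
  show ?thesis
    unfolding X(2) emin_def
    using integral_less_AE_space[of "\<lambda>_. 0" "\<lambda>\<omega>. Min ((\<lambda>i. exp (sqrt 2 * X i \<omega> - C i i)) ` {..<n})"]
      integrable_Min_exp[OF X(1) assms(2)] Min_exp_pos[OF assms(2)] by (simp add: emeasure_space_1)
qed

subsection \<open>Independent sums and invariance under the variogram\<close>

text \<open>For fixed \<open>X\<close>, the expected minimum over \<open>Y\<close> is at most the
  minimum of the expectations, and each factor \<open>exp (sqrt 2 * Y k - D k k)\<close> has mean
  1.\<close>

lemma phi_add_le: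
  assumes C: "psd n C" and D: "psd n D" and n: "0 < n"
  shows "\<phi> n (\<lambda>i j. C i j + D i j) \<le> \<phi> n C"
proof -
  obtain M :: "(nat \<Rightarrow> real) measure" and X where X: "gvec M X n C" "\<phi> n C = emin M X (\<lambda>i. C i i) n"
    using phi_obtain[OF C n] by blast
  obtain N :: "(nat \<Rightarrow> real) measure" and Y where Y: "gvec N Y n D" "\<phi> n D = emin N Y (\<lambda>i. D i i) n"
    using phi_obtain[OF D n] by blast
  interpret M: prob_space M by (rule gvecD[OF X(1)])
  interpret N: prob_space N by (rule gvecD[OF Y(1)])
  interpret pair_prob_space M N ..
  note XY = gvec_pair_add[OF X(1) Y(1)]
  let ?h = "\<lambda>x y. Min ((\<lambda>i. exp (sqrt 2 * (x i + y i) - (C i i + D i i))) ` {..<n})"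
  have int: "integrable (M \<Otimes>\<^sub>M N) (\<lambda>p. ?h (\<lambda>i. X i (fst p)) (\<lambda>i. Y i (snd p)))"
    using integrable_Min_exp[OF XY n] .
  have "\<phi> n (\<lambda>i j. C i j + D i j) = (LINT p|(M \<Otimes>\<^sub>M N). ?h (\<lambda>i. X i (fst p)) (\<lambda>i. Y i (snd p)))"
    using phi_eq[OF XY _ n] psdD(1)[OF C] psdD(1)[OF D] by (simp add: emin_def)
  also have "\<dots> = (LINT \<omega>|M. (LINT \<eta>|N. ?h (\<lambda>i. X i \<omega>) (\<lambda>i. Y i \<eta>)))"
    using integral_fst'[OF int] by simp
  also have "\<dots> \<le> (LINT \<omega>|M. Min ((\<lambda>i. exp (sqrt 2 * X i \<omega> - C i i)) ` {..<n}))"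
  proof (rule integral_mono_AE)
    show "integrable M (\<lambda>\<omega>. LINT \<eta>|N. ?h (\<lambda>i. X i \<omega>) (\<lambda>i. Y i \<eta>))"
      using integrable_fst'[OF int] by simp
    show "integrable M (\<lambda>\<omega>. Min ((\<lambda>i. exp (sqrt 2 * X i \<omega> - C i i)) ` {..<n}))"
      by (rule integrable_Min_exp[OF X(1) n])
    have "AE \<omega> in M. integrable N (\<lambda>\<eta>. ?h (\<lambda>i. X i \<omega>) (\<lambda>i. Y i \<eta>))"
      using AE_integrable_fst'[OF int] by simp
    then show "AE \<omega> in M. (LINT \<eta>|N. ?h (\<lambda>i. X i \<omega>) (\<lambda>i. Y i \<eta>)) \<le> Min ((\<lambda>i. exp (sqrt 2 * X i \<omega> - C i i)) ` {..<n})"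
    proof eventually_elim
      fix \<omega> assume i: "integrable N (\<lambda>\<eta>. ?h (\<lambda>i. X i \<omega>) (\<lambda>i. Y i \<eta>))"
      show "(LINT \<eta>|N. ?h (\<lambda>i. X i \<omega>) (\<lambda>i. Y i \<eta>)) \<le> Min ((\<lambda>i. exp (sqrt 2 * X i \<omega> - C i i)) ` {..<n})"
      proof (rule Min_exp_ge[OF n])
        fix k assume k: "k < n"
        have e: "exp (sqrt 2 * (X k \<omega> + Y k \<eta>) - (C k k + D k k)) =
          exp (sqrt 2 * X k \<omega> - C k k) * (exp (- D k k) * exp (sqrt 2 * Y k \<eta>))" for \<eta>
          by (simp add: exp_add[symmetric] algebra_simps)
        have "(LINT \<eta>|N. ?h (\<lambda>i. X i \<omega>) (\<lambda>i. Y i \<eta>)) \<le>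
          (LINT \<eta>|N. exp (sqrt 2 * X k \<omega> - C k k) * (exp (- D k k) * exp (sqrt 2 * Y k \<eta>)))"
        proof (rule integral_mono[OF i])
          show "integrable N (\<lambda>\<eta>. exp (sqrt 2 * X k \<omega> - C k k) * (exp (- D k k) * exp (sqrt 2 * Y k \<eta>)))"
            using gvec_exp_coord(1)[OF Y(1) k] by simp
          show "?h (\<lambda>i. X i \<omega>) (\<lambda>i. Y i \<eta>) \<le> exp (sqrt 2 * X k \<omega> - C k k) * (exp (- D k k) * exp (sqrt 2 * Y k \<eta>))" for \<eta>
            unfolding e[symmetric] by (rule Min_exp_le[OF k])
        qed
        also have "\<dots> = exp (sqrt 2 * X k \<omega> - C k k)"
          using gvec_exp_coord(2)[OF Y(1) k, of "sqrt 2"] by (simp add: exp_minus)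
        finally show "(LINT \<eta>|N. ?h (\<lambda>i. X i \<omega>) (\<lambda>i. Y i \<eta>)) \<le> exp (sqrt 2 * X k \<omega> - C k k)" .
      qed
    qed
  qed
  also have "\<dots> = \<phi> n C" using X(2) by (simp add: emin_def)
  finally show ?thesis .
qed

text \<open>A minimum of products of positive factors is at least the product of the minima, whose
  expectation factorises by independence.\<close>

lemma phi_add_ge:
  assumes C: "psd n C" and D: "psd n D" and n: "0 < n"
  shows "\<phi> n C * \<phi> n D \<le> \<phi> n (\<lambda>i j. C i j + D i j)"
proof -
  obtain M :: "(nat \<Rightarrow> real) measure" and X where X: "gvec M X n C" "\<phi> n C = emin M X (\<lambda>i. C i i) n"
    using phi_obtain[OF C n] by blast
  obtain N :: "(nat \<Rightarrow> real) measure" and Y where Y: "gvec N Y n D" "\<phi> n D = emin N Y (\<lambda>i. D i i) n"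
    using phi_obtain[OF D n] by blast
  note ps = gvecD(1)[OF X(1)] gvecD(1)[OF Y(1)]
  note XY = gvec_pair_add[OF X(1) Y(1)]
  let ?f = "\<lambda>\<omega>. Min ((\<lambda>i. exp (sqrt 2 * X i \<omega> - C i i)) ` {..<n})"
  let ?g = "\<lambda>\<omega>. Min ((\<lambda>i. exp (sqrt 2 * Y i \<omega> - D i i)) ` {..<n})"
  note fg = integrable_Min_exp[OF X(1) n, of "\<lambda>i. C i i"] integrable_Min_exp[OF Y(1) n, of "\<lambda>i. D i i"]
  have "\<phi> n C * \<phi> n D = (LINT p|(M \<Otimes>\<^sub>M N). ?f (fst p) * ?g (snd p))"
    using integral_pair_mult(2)[OF ps fg] X(2) Y(2) by (simp add: emin_def)
  also have "\<dots> \<le> (LINT p|(M \<Otimes>\<^sub>M N). Min ((\<lambda>i. exp (sqrt 2 * (X i (fst p) + Y i (snd p)) - (C i i + D i i))) ` {..<n}))"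
  proof (rule integral_mono)
    show "integrable (M \<Otimes>\<^sub>M N) (\<lambda>p. ?f (fst p) * ?g (snd p))" by (rule integral_pair_mult(1)[OF ps fg])
    show "integrable (M \<Otimes>\<^sub>M N) (\<lambda>p. Min ((\<lambda>i. exp (sqrt 2 * (X i (fst p) + Y i (snd p)) - (C i i + D i i))) ` {..<n}))"
      by (rule integrable_Min_exp[OF XY n])
    fix p
    show "?f (fst p) * ?g (snd p) \<le> Min ((\<lambda>i. exp (sqrt 2 * (X i (fst p) + Y i (snd p)) - (C i i + D i i))) ` {..<n})"
    proof (rule Min_exp_ge[OF n])
      fix k assume k: "k < n"
      have "?f (fst p) * ?g (snd p) \<le> exp (sqrt 2 * X k (fst p) - C k k) * exp (sqrt 2 * Y k (snd p) - D k k)"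
        by (intro mult_mono Min_exp_le k) (auto intro: less_imp_le Min_exp_pos[OF n])
      then show "?f (fst p) * ?g (snd p) \<le> exp (sqrt 2 * (X k (fst p) + Y k (snd p)) - (C k k + D k k))"
        by (simp add: exp_add[symmetric] algebra_simps)
    qed
  qed
  also have "\<dots> = \<phi> n (\<lambda>i j. C i j + D i j)"
    using phi_eq[OF XY _ n] psdD(1)[OF C] psdD(1)[OF D] by (simp add: emin_def)
  finally show ?thesis .
qed

text \<open>Splitting \<open>X = \<zeta> + b z\<close> with \<open>z\<close> an independent standard normal and \<open>X k = b k * z\<close>, the
  Cameron-Martin shift of \<open>z\<close> removes the density \<open>exp (sqrt 2 * X k - C k k)\<close>.\<close>

lemma phi_pivot:
  assumes C: "psd n C" and k: "k < n"
  shows "\<phi> n C = \<phi> n (\<lambda>i j. C i j - C i k - C j k + C k k)"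
proof -
  have n: "0 < n" using k by simp
  \<comment> \<open>The coefficients of the regression of \<open>X i\<close> on the normalised
    \<open>X k\<close>; \<open>D\<close> is the covariance of the remainder.\<close>
  define b where "b = (\<lambda>i. C i k / sqrt (C k k))"
  define D where "D i j = C i j - b i * b j" for i j
  have D: "psd n D" and bk: "\<And>i. i < n \<Longrightarrow> b i * b k = C i k"
    using psd_schur[OF C k] unfolding b_def D_def by auto
  obtain N :: "(nat \<Rightarrow> real) measure" and Y where Y: "gvec N Y n D"
    using phi_obtain[OF D n] by blast
  interpret N: prob_space N by (rule gvecD[OF Y])
  interpret SN: real_distribution std_normal_distribution by (rule real_dist_normal_dist)
  interpret pair_prob_space N std_normal_distribution ..
  have sg: "emin (N \<Otimes>\<^sub>M std_normal_distribution) (\<lambda>i p. Y i (fst p) + d i * snd p) v n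
      = (LINT \<eta>|N. (LINT z|std_normal_distribution. Min ((\<lambda>i. exp (sqrt 2 * (Y i \<eta> + d i * z) - v i)) ` {..<n})))" for d v
    unfolding emin_def
    using integral_fst'[OF integrable_Min_exp[OF gvec_pair_add[OF Y gvec_std_normal[of d]] n, of v]] by simp
  have "\<phi> n C = emin (N \<Otimes>\<^sub>M std_normal_distribution) (\<lambda>i p. Y i (fst p) + b i * snd p) (\<lambda>i. C i i) n"
    using phi_eq[OF gvec_cong[OF gvec_pair_add[OF Y gvec_std_normal[of b]], of C] _ n] psdD(1)[OF C]
    by (simp add: D_def)
  also have "\<dots> = (LINT \<eta>|N. (LINT z|std_normal_distribution. Min ((\<lambda>i. exp (sqrt 2 * (Y i \<eta> + b i * z) - C i i)) ` {..<n})))"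
    by (rule sg)
  also have "\<dots> = (LINT \<eta>|N. (LINT z|std_normal_distribution.
      Min ((\<lambda>i. exp (sqrt 2 * (Y i \<eta> + (b i - b k) * z) - (C i i - C i k - C i k + C k k))) ` {..<n})))"
  proof (rule Bochner_Integration.integral_cong[OF refl])
    fix \<eta>
    define a where "a = sqrt 2 * b k"
    \<comment> \<open>What is left of the integrand after the factor
      \<open>exp (sqrt 2 * b k * z - C k k)\<close> has been taken out. The shift by
      \<open>a\<close> then adds \<open>2 * (C i k - C k k)\<close> to the exponent with index
      \<open>i\<close>, which turns the subtracted term into the variance of
      \<open>X i - X k\<close>.\<close>
    define h where "h z = Min ((\<lambda>i. exp (sqrt 2 * (Y i \<eta> + (b i - b k) * z) - C i i + C k k)) ` {..<n})" for z
    have [measurable]: "h \<in> borel_measurable borel" unfolding h_def by (rule borel_measurable_Min) auto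
    have a2: "a\<^sup>2 / 2 = C k k" using bk[OF k] by (simp add: a_def power_mult_distrib power2_eq_square[of "b k"])
    have "(LINT z|std_normal_distribution. Min ((\<lambda>i. exp (sqrt 2 * (Y i \<eta> + b i * z) - C i i)) ` {..<n})) =
      (LINT z|std_normal_distribution. exp (a * z - a\<^sup>2 / 2) * h z)"
      unfolding h_def Min_exp_add[OF n, symmetric] a2 by (simp add: a_def algebra_simps)
    also have "\<dots> = (LINT z|std_normal_distribution. h (z + a))" by (rule std_normal_tilt) measurable
    also have "\<dots> = (LINT z|std_normal_distribution.
      Min ((\<lambda>i. exp (sqrt 2 * (Y i \<eta> + (b i - b k) * z) - (C i i - C i k - C i k + C k k))) ` {..<n}))"
    proof (rule Bochner_Integration.integral_cong[OF refl])
      fix z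
      show "h (z + a) = Min ((\<lambda>i. exp (sqrt 2 * (Y i \<eta> + (b i - b k) * z) - (C i i - C i k - C i k + C k k))) ` {..<n})"
        unfolding h_def
      proof (rule Min_exp_cong)
        fix i assume i: "i < n"
        have "sqrt 2 * ((b i - b k) * a) = 2 * (b i * b k) - 2 * (b k * b k)"
          by (simp add: a_def algebra_simps)
        then show "sqrt 2 * (Y i \<eta> + (b i - b k) * (z + a)) - C i i + C k k =
          sqrt 2 * (Y i \<eta> + (b i - b k) * z) - (C i i - C i k - C i k + C k k)"
          using bk[OF i] bk[OF k] by (simp add: distrib_left)
      qed
    qed
    finally show "(LINT z|std_normal_distribution. Min ((\<lambda>i. exp (sqrt 2 * (Y i \<eta> + b i * z) - C i i)) ` {..<n})) =
      (LINT z|std_normal_distribution.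
      Min ((\<lambda>i. exp (sqrt 2 * (Y i \<eta> + (b i - b k) * z) - (C i i - C i k - C i k + C k k))) ` {..<n}))" .
  qed
  also have "\<dots> = emin (N \<Otimes>\<^sub>M std_normal_distribution) (\<lambda>i p. Y i (fst p) + (b i - b k) * snd p)
      (\<lambda>i. C i i - C i k - C i k + C k k) n"
    by (rule sg[symmetric])
  also have "\<dots> = \<phi> n (\<lambda>i j. C i j - C i k - C j k + C k k)"
  proof -
    have "gvec (N \<Otimes>\<^sub>M std_normal_distribution) (\<lambda>i p. Y i (fst p) + (b i - b k) * snd p) n
      (\<lambda>i j. C i j - C i k - C j k + C k k)"
    proof (rule gvec_cong[OF gvec_pair_add[OF Y gvec_std_normal[of "\<lambda>i. b i - b k"]]])
      fix i j assume ij: "i < n" "j < n"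
      show "D i j + (b i - b k) * (b j - b k) = C i j - C i k - C j k + C k k"
        using bk[OF ij(1)] bk[OF ij(2)] bk[OF k] by (simp add: D_def algebra_simps)
    qed
    from phi_eq[OF this _ n] psdD(1)[OF C] show ?thesis by simp
  qed
  finally show ?thesis .
qed

text \<open>The second moment of \<open>X i - X j\<close>, hence twice the variogram in its usual
  normalisation.\<close>

definition vgram :: "(nat \<Rightarrow> nat \<Rightarrow> real) \<Rightarrow> nat \<Rightarrow> nat \<Rightarrow> real" where
  "vgram C i j = C i i + C j j - 2 * C i j"

text \<open>Pivoting at index 0 replaces \<open>C\<close> by the covariance of the differences
  \<open>X i - X 0\<close>, and by polarisation that matrix is a function of
  \<open>vgram C\<close>.\<close>

lemma phi_eq_of_vgram_eq:
  assumes C: "psd n C" and D: "psd n D" and n: "0 < n"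
    and eq: "\<And>i j. i < n \<Longrightarrow> j < n \<Longrightarrow> vgram C i j = vgram D i j"
  shows "\<phi> n C = \<phi> n D"
proof -
  let ?P = "\<lambda>C :: nat \<Rightarrow> nat \<Rightarrow> real. \<lambda>i j. C i j - C i 0 - C j 0 + C 0 0"
  \<comment> \<open>Pivoting amounts to testing \<open>C\<close> on coefficient vectors with sum 0:
    the total of \<open>c\<close> is subtracted at index 0.\<close>
  have "qform n (?P C) c = qform n C (\<lambda>i. c i + (if i = 0 then - (\<Sum>i<n. c i) else 0))" for c
  proof -
    have "qform n (?P C) c = qform n (\<lambda>i j. C i j - C i 0 * 1 - 1 * C j 0 + C 0 0 * 1) c" by simp
    also have "\<dots> = qform n C c - 2 * (lincomb n c (\<lambda>_. 1) * lincomb n c (\<lambda>i. C i 0))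
        + (lincomb n c (\<lambda>_. 1))\<^sup>2 * C 0 0"
      unfolding qform_add qform_diff qform_outer
      by (simp add: lincomb_def sum_distrib_right[symmetric] power2_eq_square)
    finally have "qform n (?P C) c = qform n C c - 2 * ((\<Sum>i<n. c i) * lincomb n c (\<lambda>i. C i 0))
        + (\<Sum>i<n. c i)\<^sup>2 * C 0 0" by (simp add: lincomb_def)
    then show ?thesis by (simp add: qform_add_single[OF psdD(1)[OF C] n])
  qed
  then have P: "psd n (?P C)" using psdD[OF C] by (auto simp: psd_def)
  have "?P C i j = ?P D i j" if "i < n" "j < n" for i j
    using eq[OF that] eq[OF that(1) n] eq[OF that(2) n] by (simp add: vgram_def)
  then have "\<phi> n (?P C) = \<phi> n (?P D)" by (rule phi_cong[OF P n])
  with phi_pivot[OF C n] phi_pivot[OF D n] show ?thesis by simp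
qed

subsection \<open>Comparison of variograms\<close>

lemma gvec_scale:
  assumes "gvec M X n C" shows "gvec M (\<lambda>i \<omega>. s * X i \<omega>) n (\<lambda>i j. s\<^sup>2 * C i j)"
proof -
  have "lincomb n c (\<lambda>i. s * X i \<omega>) = lincomb n (\<lambda>i. s * c i) (\<lambda>i. X i \<omega>)" for c \<omega>
    by (simp add: lincomb_def mult_ac)
  then show ?thesis
    using gvecD[OF assms] by (auto simp: gvec_def qform_coeff_scale qform_scale)
qed

abbreviation (input) delta :: "nat \<Rightarrow> nat \<Rightarrow> real" where "delta i j \<equiv> (if i = j then 1 else 0)"

lemma qform_delta: "qform n (\<lambda>i j. delta i j) c = (\<Sum>i<n. (c i)\<^sup>2)"
  unfolding qform_def by (intro sum.cong refl)
    (simp add: power2_eq_square if_distrib[of "\<lambda>a. _ * a"] cong: if_cong)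

lemma psd_delta: "psd n (\<lambda>i j. delta i j)"
  by (auto simp: psd_def qform_delta sum_nonneg)

text \<open>The smaller of \<open>f x1\<close> and \<open>f x2\<close> is bounded by
  \<open>f x3\<close>, because at every index \<open>x3\<close> dominates one of the two arguments;
  the larger is bounded by \<open>f x4\<close>, by monotonicity.\<close>

lemma Min_exp_supermodular:
  fixes x1 x2 x3 x4 v :: "nat \<Rightarrow> real" and n :: nat
  defines "f \<equiv> \<lambda>x. Min ((\<lambda>i. exp (sqrt 2 * x i - v i)) ` {..<n})"
  assumes n: "0 < n" and 3: "\<And>i. min (x1 i) (x2 i) \<le> x3 i" and 4: "\<And>i. max (x1 i) (x2 i) \<le> x4 i"
  shows "f x1 + f x2 \<le> f x3 + f x4"
proof -
  have f_def': "f x = Min ((\<lambda>i. exp (sqrt 2 * x i - v i)) ` {..<n})" for x by (simp add: f_def)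
  have le: "f x \<le> exp (sqrt 2 * y - v i)" if "x i \<le> y" "i < n" for x i y
  proof -
    have "f x \<le> exp (sqrt 2 * x i - v i)" unfolding f_def' by (rule Min_exp_le[OF that(2)])
    also have "\<dots> \<le> exp (sqrt 2 * y - v i)" using that(1) by simp
    finally show ?thesis .
  qed
  have "min (f x1) (f x2) \<le> f x3"
    unfolding f_def'[of x3]
  proof (rule Min_exp_ge[OF n])
    fix i assume i: "i < n"
    show "min (f x1) (f x2) \<le> exp (sqrt 2 * x3 i - v i)"
      using le[of x1 i "x3 i"] le[of x2 i "x3 i"] 3[of i] i by (auto simp: min_le_iff_disj)
  qed
  moreover have "f x1 \<le> f x4"
    unfolding f_def'[of x4] using le 4 by (intro Min_exp_ge[OF n]) auto
  moreover have "f x2 \<le> f x4"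
    unfolding f_def'[of x4] using le 4 by (intro Min_exp_ge[OF n]) auto
  ultimately show ?thesis by linarith
qed

text \<open>Both sides are invariant under exchanging the two independent normal variables that carry
  the entries \<open>p\<close> and \<open>q\<close>; averaged over the exchange, the comparison holds pointwise by supermodularity.\<close>

lemma phi_correlate:
  assumes C: "psd n C" and pq: "p \<noteq> q \<or> d = 0" "p < n" "q < n" and d: "0 \<le> d"
  shows "\<phi> n (\<lambda>i j. C i j + d * (delta i p * delta j p + delta i q * delta j q))
    \<le> \<phi> n (\<lambda>i j. C i j + d * ((delta i p + delta i q) * (delta j p + delta j q)))"
proof (cases "d = 0")
  case False
  with pq have ne: "p \<noteq> q" by simp
  have n: "0 < n" using pq by simp
  obtain M :: "(nat \<Rightarrow> real) measure" and Y where Y: "gvec M Y n C" using phi_obtain[OF C n] by blast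
  define s where "s = sqrt d"
  have s: "0 \<le> s" "s * s = d" using d by (simp_all add: s_def)
  let ?N = "M \<Otimes>\<^sub>M (std_normal_distribution \<Otimes>\<^sub>M std_normal_distribution)"
  \<comment> \<open>Two independent normal variables are added to \<open>Y\<close> with profiles
    \<open>a\<close> and \<open>b\<close>. Carrying \<open>p\<close> and \<open>q\<close> separately
    or jointly, they realise both covariances on one space.\<close>
  define X where "X a b i z = Y i (fst z) + (a i * fst (snd z) + b i * snd (snd z))" for a b :: "nat \<Rightarrow> real" and i z
  have X: "gvec ?N (X a b) n (\<lambda>i j. C i j + (a i * a j + b i * b j))" for a b
    unfolding X_def by (intro gvec_pair_add Y gvec_std_normal)
  define v where "v i = C i i + d * (delta i p + delta i q)" for i
  define f where "f x = Min ((\<lambda>i. exp (sqrt 2 * x i - v i)) ` {..<n})" for x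
  have int: "integrable ?N (\<lambda>z. f (\<lambda>i. X a b i z))" for a b unfolding f_def by (rule integrable_Min_exp[OF X n])
  have phi: "(LINT z|?N. f (\<lambda>i. X a b i z)) = \<phi> n D"
    if eq: "\<And>i j. i < n \<Longrightarrow> j < n \<Longrightarrow> C i j + (a i * a j + b i * b j) = D i j"
      and dg: "\<And>i. D i i = v i" for a b D
  proof -
    have g: "gvec ?N (X a b) n D" using eq by (intro gvec_cong[OF X]) auto
    have "D i j = D j i" if ij: "i < n" "j < n" for i j
      using eq[OF ij] eq[OF ij(2,1)] psdD(1)[OF C ij] by (simp add: mult_ac)
    from phi_eq[OF g this n] show ?thesis unfolding emin_def f_def dg by simp
  qed
  let ?p = "\<lambda>i. s * delta i p" and ?q = "\<lambda>i. s * delta i q" and ?r = "\<lambda>i. s * (delta i p + delta i q)" and ?o = "\<lambda>i::nat. 0::real"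
  let ?L = "\<lambda>i j. C i j + d * (delta i p * delta j p + delta i q * delta j q)"
  let ?R = "\<lambda>i j. C i j + d * ((delta i p + delta i q) * (delta j p + delta j q))"
  have L: "(LINT z|?N. f (\<lambda>i. X ?p ?q i z)) = \<phi> n ?L" "(LINT z|?N. f (\<lambda>i. X ?q ?p i z)) = \<phi> n ?L"
    by (rule phi; auto simp: s v_def)+
  have R: "(LINT z|?N. f (\<lambda>i. X ?r ?o i z)) = \<phi> n ?R" "(LINT z|?N. f (\<lambda>i. X ?o ?r i z)) = \<phi> n ?R"
    by (rule phi; use ne in \<open>auto simp: s v_def\<close>)+
  have pw: "f (\<lambda>i. X ?p ?q i z) + f (\<lambda>i. X ?q ?p i z) \<le> f (\<lambda>i. X ?r ?o i z) + f (\<lambda>i. X ?o ?r i z)" for z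
  \<comment> \<open>If the first normal value is the smaller one, then giving it to both entries
    produces the pointwise minimum of the two separate vectors, and giving the second to both
    produces the maximum; otherwise the roles are interchanged.\<close>
  proof (cases "fst (snd z) \<le> snd (snd z)")
    case True
    then have "s * fst (snd z) \<le> s * snd (snd z)" using s(1) by (rule mult_left_mono)
    then show ?thesis unfolding f_def using ne by (intro Min_exp_supermodular n) (auto simp: X_def)
  next
    case False
    then have "s * snd (snd z) \<le> s * fst (snd z)" using s(1) by (intro mult_left_mono) auto
    then have "f (\<lambda>i. X ?p ?q i z) + f (\<lambda>i. X ?q ?p i z) \<le> f (\<lambda>i. X ?o ?r i z) + f (\<lambda>i. X ?r ?o i z)"
      unfolding f_def using ne by (intro Min_exp_supermodular n) (auto simp: X_def)
    then show ?thesis by simp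
  qed
  have "(LINT z|?N. f (\<lambda>i. X ?p ?q i z) + f (\<lambda>i. X ?q ?p i z)) \<le>
      (LINT z|?N. f (\<lambda>i. X ?r ?o i z) + f (\<lambda>i. X ?o ?r i z))"
    by (intro integral_mono Bochner_Integration.integrable_add int pw)
  then show ?thesis using L R by (simp only: Bochner_Integration.integral_add[OF int int])
qed simp

lemma phi_correlate_sum:
  assumes "finite P" and "\<And>p q. (p, q) \<in> P \<Longrightarrow> p < n \<and> q < n \<and> 0 \<le> d p q \<and> (p \<noteq> q \<or> d p q = 0)"
    and "psd n C"
  shows "\<phi> n (\<lambda>i j. C i j + (\<Sum>(p,q)\<in>P. d p q * (delta i p * delta j p + delta i q * delta j q)))
    \<le> \<phi> n (\<lambda>i j. C i j + (\<Sum>(p,q)\<in>P. d p q * ((delta i p + delta i q) * (delta j p + delta j q))))"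
  using assms
proof (induction P arbitrary: C)
  case (insert x P)
  obtain p q where x: "x = (p, q)" by fastforce
  have pq: "p < n" "q < n" "0 \<le> d p q" "p \<noteq> q \<or> d p q = 0" using insert.prems(1)[of p q] x by auto
  let ?g = "\<lambda>p q i j. d p q * (delta i p * delta j p + delta i q * delta j q)"
  let ?r = "\<lambda>p q i j. d p q * ((delta i p + delta i q) * (delta j p + delta j q))"
  have psum: "psd n (\<lambda>i j. D i j + (\<Sum>(p,q)\<in>P. ?g p q i j))" if "psd n D" for D
    using insert.hyps(1) insert.prems(1)
  proof (induction P rule: finite_induct)
    case (insert y P)
    obtain a b where y: "y = (a, b)" by fastforce
    have g: "psd n (?g a b)" using insert.prems(1)[of a b] y
      by (intro psd_scale psd_add psd_outer) auto
    have "psd n (\<lambda>i j. D i j + (\<Sum>(p,q)\<in>P. ?g p q i j))" using insert by blast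
    from psd_add[OF this g] show ?case using insert.hyps y by (simp add: add_ac)
  qed (use that in simp)
  have n: "0 < n" using pq by simp
  have r: "psd n (\<lambda>i j. C i j + ?r p q i j)" by (intro psd_add psd_scale psd_outer insert.prems pq)
  have "\<phi> n (\<lambda>i j. C i j + (\<Sum>(p,q)\<in>insert x P. ?g p q i j)) =
      \<phi> n (\<lambda>i j. (C i j + (\<Sum>(p,q)\<in>P. ?g p q i j)) + ?g p q i j)"
    using insert.hyps x by (simp add: add_ac)
  also have "\<dots> \<le> \<phi> n (\<lambda>i j. (C i j + (\<Sum>(p,q)\<in>P. ?g p q i j)) + ?r p q i j)"
    by (intro phi_correlate psum insert.prems pq)
  also have "\<dots> = \<phi> n (\<lambda>i j. (C i j + ?r p q i j) + (\<Sum>(p,q)\<in>P. ?g p q i j))"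
    by (simp add: add_ac)
  also have "\<dots> \<le> \<phi> n (\<lambda>i j. (C i j + ?r p q i j) + (\<Sum>(p,q)\<in>P. ?r p q i j))"
    using insert.prems(1) r by (intro insert.IH) auto
  also have "\<dots> = \<phi> n (\<lambda>i j. C i j + (\<Sum>(p,q)\<in>insert x P. ?r p q i j))"
    using insert.hyps x by (simp add: add_ac)
  finally show ?case .
qed simp

text \<open>A diagonal matrix formed from the row sums of \<open>D\<close> is split off from
  \<open>A\<close>, which stays positive semidefinite by coercivity. Returned as independent noise
  it gives back \<open>A\<close>; returned as noise common to the pairs it gives
  \<open>A + D\<close>.\<close>

lemma phi_mono_offdiag_small:
  assumes n: "0 < n" and sym: "\<And>i j. i < n \<Longrightarrow> j < n \<Longrightarrow> A i j = A j i"
    and coer: "\<And>c. k * (\<Sum>i<n. (c i)\<^sup>2) \<le> qform n A c"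
    and D: "\<And>i j. i < n \<Longrightarrow> j < n \<Longrightarrow> D i j = D j i" "\<And>i j. i < n \<Longrightarrow> j < n \<Longrightarrow> 0 \<le> D i j" "\<And>i. i < n \<Longrightarrow> D i i = 0"
    and row: "\<And>i. i < n \<Longrightarrow> (\<Sum>j<n. D i j) \<le> k"
  shows "\<phi> n A \<le> \<phi> n (\<lambda>i j. A i j + D i j)"
proof -
  let ?P = "{..<n} \<times> {..<n}"
  \<comment> \<open>The weight is halved because every unordered pair occurs twice among the ordered
    ones. On indices below \<open>n\<close> the sum is diagonal, with the row sums of
    \<open>D\<close> as entries.\<close>
  let ?g = "\<lambda>i j. \<Sum>(p,q)\<in>?P. D p q / 2 * (delta i p * delta j p + delta i q * delta j q)"
  let ?r = "\<lambda>i j. \<Sum>(p,q)\<in>?P. D p q / 2 * ((delta i p + delta i q) * (delta j p + delta j q))"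
  have diff: "?r i j = ?g i j + D i j" if "i < n" "j < n" for i j
  proof -
    have "?r i j = ?g i j + (\<Sum>(p,q)\<in>?P. D p q / 2 * (delta i p * delta j q + delta i q * delta j p))"
      by (simp add: sum.distrib[symmetric] case_prod_beta algebra_simps)
    also have "(\<Sum>(p,q)\<in>?P. D p q / 2 * (delta i p * delta j q + delta i q * delta j p)) =
       (\<Sum>p<n. \<Sum>q<n. (if i = p then if j = q then D p q / 2 else 0 else 0)) +
       (\<Sum>p<n. \<Sum>q<n. (if j = p then if i = q then D p q / 2 else 0 else 0))"
      by (subst sum.cartesian_product[symmetric], unfold sum.distrib[symmetric])
        (intro sum.cong refl, auto simp: algebra_simps)
    also have "\<dots> = D i j / 2 + D j i / 2"
    proof -
      have *: "(\<Sum>p<n. \<Sum>q<n. (if i = p then if j = q then D p q / 2 else 0 else 0)) = D i j / 2" if "i < n" "j < n" for i j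
      proof -
        have "(\<Sum>p<n. \<Sum>q<n. (if i = p then if j = q then D p q / 2 else 0 else 0)) =
          (\<Sum>p<n. if i = p then (\<Sum>q<n. if j = q then D p q / 2 else 0) else 0)" by (intro sum.cong) auto
        then show ?thesis using that by simp
      qed
      show ?thesis unfolding *[OF that] *[OF that(2,1)] ..
    qed
    finally show ?thesis using D(1)[OF that] by simp
  qed
  have qg: "qform n ?g c = (\<Sum>p<n. (c p)\<^sup>2 * (\<Sum>q<n. D p q))" for c
  proof -
    have "qform n ?g c = (\<Sum>(p,q)\<in>?P. qform n (\<lambda>i j. D p q / 2 * (delta i p * delta j p + delta i q * delta j q)) c)"
      by (simp add: qform_sum case_prod_beta)
    also have "\<dots> = (\<Sum>(p,q)\<in>?P. D p q / 2 * ((c p)\<^sup>2 + (c q)\<^sup>2))"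
    proof (rule sum.cong[OF refl])
      fix x assume "x \<in> ?P"
      then obtain p q where x: "x = (p, q)" and pq: "p < n" "q < n" by blast
      have l: "lincomb n c (\<lambda>i. delta i p) = c p" if "p < n" for p
        unfolding lincomb_def using that by (subst sum.cong[OF refl, of _ _ "\<lambda>i. if i = p then c p else 0"]) auto
      have "qform n (\<lambda>i j. D p q / 2 * (delta i p * delta j p + delta i q * delta j q)) c = D p q / 2 * ((c p)\<^sup>2 + (c q)\<^sup>2)"
        unfolding qform_scale qform_add qform_outer using pq by (simp add: l power2_eq_square)
      then show "(case x of (p, q) \<Rightarrow> qform n (\<lambda>i j. D p q / 2 * (delta i p * delta j p + delta i q * delta j q)) c) =
        (case x of (p, q) \<Rightarrow> D p q / 2 * ((c p)\<^sup>2 + (c q)\<^sup>2))" by (simp only: x prod.case)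
    qed
    also have "\<dots> = (\<Sum>p<n. \<Sum>q<n. D p q / 2 * (c p)\<^sup>2) + (\<Sum>p<n. \<Sum>q<n. D p q / 2 * (c q)\<^sup>2)"
      by (subst sum.cartesian_product[symmetric]) (simp add: sum.distrib distrib_left)
    also have "(\<Sum>p<n. \<Sum>q<n. D p q / 2 * (c q)\<^sup>2) = (\<Sum>p<n. \<Sum>q<n. D p q / 2 * (c p)\<^sup>2)"
      by (subst sum.swap) (intro sum.cong refl, simp add: D(1))
    also have "(\<Sum>p<n. \<Sum>q<n. D p q / 2 * (c p)\<^sup>2) + (\<Sum>p<n. \<Sum>q<n. D p q / 2 * (c p)\<^sup>2) = (\<Sum>p<n. (c p)\<^sup>2 * (\<Sum>q<n. D p q))"
      by (simp only: sum.distrib[symmetric] sum_distrib_left) (intro sum.cong refl, simp)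
    finally show ?thesis .
  qed
  have gsym: "?g i j = ?g j i" for i j by (simp add: mult_ac)
  have C: "psd n (\<lambda>i j. A i j - ?g i j)"
  proof -
    have "qform n ?g c \<le> k * (\<Sum>i<n. (c i)\<^sup>2)" for c
      unfolding qg sum_distrib_left[of k] by (intro sum_mono) (use row in \<open>auto intro!: mult_right_mono simp: mult.commute\<close>)
    with coer have "qform n ?g c \<le> qform n A c" for c using order_trans by blast
    then show ?thesis using sym gsym by (auto simp: psd_def qform_diff)
  qed
  have Ag: "psd n (\<lambda>i j. A i j + D i j)"
  proof -
    have "psd n (\<lambda>i j. (A i j - ?g i j) + ?r i j)"
    proof (rule psd_add[OF C])
      have "psd n (\<lambda>i j. \<Sum>x\<in>?P. (case x of (p,q) \<Rightarrow> D p q / 2 * ((delta i p + delta i q) * (delta j p + delta j q))))"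
        unfolding psd_def qform_sum case_prod_beta qform_scale qform_outer using D(2)
        by (auto simp: mult_ac intro!: sum_nonneg mult_nonneg_nonneg)
      then show "psd n ?r" .
    qed
    then show ?thesis using diff by (subst psd_cong[of n _ "\<lambda>i j. (A i j - ?g i j) + ?r i j"]) auto
  qed
  have "\<phi> n A = \<phi> n (\<lambda>i j. (A i j - ?g i j) + ?g i j)" by simp
  also have "\<dots> \<le> \<phi> n (\<lambda>i j. (A i j - ?g i j) + ?r i j)"
    using D C by (intro phi_correlate_sum) auto
  also have "\<dots> = \<phi> n (\<lambda>i j. A i j + D i j)"
    using diff by (intro phi_cong[OF Ag n, symmetric]) auto
  finally show ?thesis .
qed

text \<open>The segment from \<open>A\<close> to \<open>B\<close> is traversed in \<open>N\<close>
  equal steps. The coercivity bound is convex, so one \<open>k\<close> serves at every intermediate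
  point, and for large \<open>N\<close> each step is small against \<open>k\<close>.\<close>

lemma phi_mono_offdiag:
  assumes n: "0 < n" and k: "0 < k"
    and sym: "\<And>i j. i < n \<Longrightarrow> j < n \<Longrightarrow> A i j = A j i" "\<And>i j. i < n \<Longrightarrow> j < n \<Longrightarrow> B i j = B j i"
    and coer: "\<And>c. k * (\<Sum>i<n. (c i)\<^sup>2) \<le> qform n A c" "\<And>c. k * (\<Sum>i<n. (c i)\<^sup>2) \<le> qform n B c"
    and le: "\<And>i j. i < n \<Longrightarrow> j < n \<Longrightarrow> A i j \<le> B i j" and diag: "\<And>i. i < n \<Longrightarrow> A i i = B i i"
  shows "\<phi> n A \<le> \<phi> n B"
proof -
  define D where "D i j = B i j - A i j" for i j
  define S where "S = (\<Sum>i<n. \<Sum>j<n. D i j)"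
  have D0: "0 \<le> D i j" if "i < n" "j < n" for i j using le[OF that] by (simp add: D_def)
  have row: "(\<Sum>j<n. D i j) \<le> S" if "i < n" for i
    unfolding S_def using that D0 by (intro member_le_sum) (auto intro!: sum_nonneg)
  obtain m :: nat where m: "S / k < m" using reals_Archimedean2 by blast
  define N where "N = Suc m"
  have N: "0 < real N" "S / N \<le> k"
    using m k by (auto simp: N_def field_simps) 
  have step: "\<phi> n A \<le> \<phi> n (\<lambda>i j. A i j + real l / N * D i j)" if "l \<le> N" for l
    using that
  proof (induction l)
    case (Suc l)
    let ?t = "real l / N"
    have t: "0 \<le> ?t" "?t \<le> 1" using Suc.prems by (auto simp: divide_simps)
    have "\<phi> n A \<le> \<phi> n (\<lambda>i j. A i j + ?t * D i j)" using Suc by simp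
    also have "\<dots> \<le> \<phi> n (\<lambda>i j. (A i j + ?t * D i j) + 1 / N * D i j)"
    proof (rule phi_mono_offdiag_small[OF n, where k = k])
      fix c
      have "k * (\<Sum>i<n. (c i)\<^sup>2) = (1 - ?t) * (k * (\<Sum>i<n. (c i)\<^sup>2)) + ?t * (k * (\<Sum>i<n. (c i)\<^sup>2))"
        by (simp only: distrib_right[symmetric]) simp
      also have "\<dots> \<le> (1 - ?t) * qform n A c + ?t * qform n B c"
        using t coer by (intro add_mono mult_left_mono) auto
      also have "\<dots> = qform n (\<lambda>i j. A i j + ?t * D i j) c"
        unfolding D_def qform_add qform_scale qform_diff by (simp add: algebra_simps)
      finally show "k * (\<Sum>i<n. (c i)\<^sup>2) \<le> qform n (\<lambda>i j. A i j + ?t * D i j) c" .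
    next
      fix i assume i: "i < n"
      have "(\<Sum>j<n. 1 / N * D i j) = (\<Sum>j<n. D i j) / N" by (simp add: sum_divide_distrib)
      also have "\<dots> \<le> S / N" using row[OF i] N by (intro divide_right_mono) auto
      finally show "(\<Sum>j<n. 1 / N * D i j) \<le> k" using N by simp
    qed (use sym diag D0 in \<open>auto simp: D_def\<close>)
    also have "\<dots> = \<phi> n (\<lambda>i j. A i j + real (Suc l) / N * D i j)"
      by (rule arg_cong[where f = "\<phi> n"]) (auto simp: fun_eq_iff add_divide_distrib distrib_right)
    finally show ?case .
  qed simp
  from step[of N] N(1) show ?thesis by (simp add: D_def)
qed

text \<open>Adding noise makes the variogram strictly conditionally negative definite; then
  \<open>K - vgram / 2\<close> is positive definite for large \<open>K\<close> and has constant diagonal, so that the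
  comparison only concerns off-diagonal entries.\<close>

lemma constant_diagonal_coercive:
  assumes C: "psd n C" and e: "0 < e"
  defines "E \<equiv> \<lambda>i j. C i j + e * delta i j"
  shows "\<exists>K0. \<forall>K\<ge>K0. \<forall>c. e / 2 * (\<Sum>i<n. (c i)\<^sup>2) \<le> qform n (\<lambda>i j. K - vgram E i j / 2) c"
proof -
  define V where "V = (\<Sum>i<n. (E i i)\<^sup>2)"
  have V: "0 \<le> V" by (simp add: V_def sum_nonneg)
  \<comment> \<open>The form equals \<open>K * S\<^sup>2 - S * w\<close> plus the form of
    \<open>E\<close>. The cross term is absorbed by a square at the price
    \<open>w\<^sup>2 / (4 * K)\<close>, where \<open>w\<^sup>2\<close> is at most \<open>V\<close>
    times the sum of squares; so \<open>V / (2 * e) \<le> K\<close> keeps the price below half of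
    the coercivity of \<open>E\<close>. The summand 1 makes \<open>K\<close> positive.\<close>
  have "e / 2 * (\<Sum>i<n. (c i)\<^sup>2) \<le> qform n (\<lambda>i j. K - vgram E i j / 2) c" if K: "V / (2 * e) + 1 \<le> K" for K c
  proof -
    let ?Q = "\<Sum>i<n. (c i)\<^sup>2"
    define S where "S = lincomb n c (\<lambda>_. 1)"
    define w where "w = lincomb n c (\<lambda>i. E i i)"
    have K0: "0 < K" using K V e by (smt (verit) divide_nonneg_pos mult_pos_pos)
    have Q: "0 \<le> ?Q" by (simp add: sum_nonneg)
    have qE: "e * ?Q \<le> qform n E c"
      using psdD(2)[OF C, of c] unfolding E_def qform_add qform_scale qform_delta by simp
    have "w\<^sup>2 \<le> ?Q * V" unfolding w_def V_def lincomb_def by (rule Cauchy_Schwarz_ineq_sum)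
    also have "V \<le> K * (2 * e)" using K e by (simp add: field_simps)
    finally have w2: "w\<^sup>2 \<le> ?Q * (K * (2 * e))" using Q by (simp add: mult_left_mono)
    have "0 \<le> (2 * K * S - w)\<^sup>2 / (4 * K)" using K0 by simp
    also have "\<dots> = K * S\<^sup>2 - S * w + w\<^sup>2 / (4 * K)" using K0 by (simp add: power2_eq_square field_simps)
    also have "w\<^sup>2 / (4 * K) \<le> e / 2 * ?Q" using w2 K0 by (simp add: field_simps)
    finally have *: "0 \<le> K * S\<^sup>2 - S * w + e / 2 * ?Q" by simp
    have "qform n (\<lambda>i j. K - vgram E i j / 2) c = qform n (\<lambda>i j. K * (1 * 1) - 1 / 2 * (E i i * 1) - 1 / 2 * (1 * E j j) + E i j) c"
      by (rule qform_cong) (auto simp: vgram_def field_simps)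
    also have "\<dots> = K * S\<^sup>2 - S * w + qform n E c"

      unfolding qform_add qform_diff qform_scale[of n K] qform_scale[of n "1 / 2"]
        qform_outer[of n "\<lambda>_. 1" "\<lambda>_. 1"] qform_outer[of n "\<lambda>_. 1" "\<lambda>j. E j j"]
        qform_outer[of n "\<lambda>i. E i i" "\<lambda>_. 1"]
      by (simp add: S_def w_def power2_eq_square)
    finally show ?thesis using * qE by linarith
  qed
  then show ?thesis by blast
qed

text \<open>By \<open>exp x \<ge> 1 + x\<close> the minimum is bounded below through the sum of the
  \<open>\<bar>X i\<bar>\<close>. The constant \<open>k\<close> does not depend on \<open>e\<close>,
  so the bound tends to 1 as the noise disappears.\<close>

lemma phi_noise:
  assumes n: "0 < n"
  obtains k where "\<And>e. 0 \<le> e \<Longrightarrow> 1 - sqrt (2 * e) * k - e \<le> \<phi> n (\<lambda>i j. e * delta i j)"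
proof -
  obtain M :: "(nat \<Rightarrow> real) measure" and X where X: "gvec M X n (\<lambda>i j. delta i j)"
    using phi_obtain[OF psd_delta n] by blast
  interpret prob_space M by (rule gvecD[OF X])
  define k where "k = expectation (\<lambda>\<omega>. \<Sum>i<n. \<bar>X i \<omega>\<bar>)"
  have Xi: "integrable M (\<lambda>\<omega>. \<bar>X i \<omega>\<bar>)" if i: "i < n" for i
  proof (rule Bochner_Integration.integrable_bound)
    show "integrable M (\<lambda>\<omega>. exp (1 * X i \<omega>) + exp ((-1) * X i \<omega>))"
      by (intro Bochner_Integration.integrable_add gvec_exp_coord(1)[OF X i])
    show "(\<lambda>\<omega>. \<bar>X i \<omega>\<bar>) \<in> borel_measurable M" using gvecD(2)[OF X i] by simp
    have "\<bar>x\<bar> \<le> exp x + exp (- x)" for x :: real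
      using exp_ge_add_one_self[of x] exp_ge_add_one_self[of "-x"] exp_gt_zero[of x] exp_gt_zero[of "-x"] by linarith
    then show "AE \<omega> in M. norm \<bar>X i \<omega>\<bar> \<le> norm (exp (1 * X i \<omega>) + exp ((-1) * X i \<omega>))"
      by (intro AE_I2) (simp add: abs_of_pos add_pos_pos)
  qed
  have S: "integrable M (\<lambda>\<omega>. \<Sum>i<n. \<bar>X i \<omega>\<bar>)"
    using Xi by (intro Bochner_Integration.integrable_sum) auto
  have "1 - sqrt (2 * e) * k - e \<le> \<phi> n (\<lambda>i j. e * delta i j)" if e: "0 \<le> e" for e
  proof -
    have g: "gvec M (\<lambda>i \<omega>. sqrt e * X i \<omega>) n (\<lambda>i j. e * delta i j)"
      using gvec_scale[OF X, of "sqrt e"] e by simp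
    have "1 - sqrt (2 * e) * k - e = expectation (\<lambda>\<omega>. 1 - sqrt (2 * e) * (\<Sum>i<n. \<bar>X i \<omega>\<bar>) - e)"

      using S unfolding k_def by (simp add: prob_space del: Bochner_Integration.integral_sum)
    also have "\<dots> \<le> expectation (\<lambda>\<omega>. Min ((\<lambda>i. exp (sqrt 2 * (sqrt e * X i \<omega>) - e)) ` {..<n}))"
    proof (rule integral_mono)
      show "integrable M (\<lambda>\<omega>. 1 - sqrt (2 * e) * (\<Sum>i<n. \<bar>X i \<omega>\<bar>) - e)"
        using S by (intro Bochner_Integration.integrable_diff integrable_mult_right) simp_all
      show "integrable M (\<lambda>\<omega>. Min ((\<lambda>i. exp (sqrt 2 * (sqrt e * X i \<omega>) - e)) ` {..<n}))"
        by (rule integrable_Min_exp[OF g n])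
      fix \<omega>
      show "1 - sqrt (2 * e) * (\<Sum>i<n. \<bar>X i \<omega>\<bar>) - e \<le> Min ((\<lambda>i. exp (sqrt 2 * (sqrt e * X i \<omega>) - e)) ` {..<n})"
      proof (rule Min_exp_ge[OF n])
        fix i assume i: "i < n"
        have "\<bar>X i \<omega>\<bar> \<le> (\<Sum>i<n. \<bar>X i \<omega>\<bar>)" using i by (intro member_le_sum) auto
        then have "- (\<Sum>i<n. \<bar>X i \<omega>\<bar>) \<le> X i \<omega>" by linarith
        then have "sqrt (2 * e) * (- (\<Sum>i<n. \<bar>X i \<omega>\<bar>)) \<le> sqrt (2 * e) * X i \<omega>"
          using e by (intro mult_left_mono) auto
        then have "1 - sqrt (2 * e) * (\<Sum>i<n. \<bar>X i \<omega>\<bar>) - e \<le> 1 + (sqrt 2 * (sqrt e * X i \<omega>) - e)"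
          by (simp add: real_sqrt_mult)
        also have "\<dots> \<le> exp (sqrt 2 * (sqrt e * X i \<omega>) - e)" by (rule exp_ge_add_one_self)
        finally show "1 - sqrt (2 * e) * (\<Sum>i<n. \<bar>X i \<omega>\<bar>) - e \<le> exp (sqrt 2 * (sqrt e * X i \<omega>) - e)" .
      qed
    qed
    also have "\<dots> = \<phi> n (\<lambda>i j. e * delta i j)"
      using phi_eq[OF g _ n] by (simp add: emin_def)
    finally show ?thesis .
  qed
  then show thesis by (rule that)
qed

text \<open>A Slepian-type comparison. Noise of variance \<open>e\<close> is added to both matrices;
  the comparison with equal diagonals applies, after which the noise is dropped from
  \<open>C\<close> by \<open>phi_add_le\<close> and from \<open>D\<close> by
  \<open>phi_add_ge\<close> and \<open>phi_noise\<close>, as \<open>e\<close> tends to 0.\<close>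

theorem phi_antimono_vgram:
  assumes C: "psd n C" and D: "psd n D" and n: "0 < n"
    and le: "\<And>i j. i < n \<Longrightarrow> j < n \<Longrightarrow> vgram C i j \<le> vgram D i j"
  shows "\<phi> n D \<le> \<phi> n C"
proof -
  obtain k where k: "\<And>e. 0 \<le> e \<Longrightarrow> 1 - sqrt (2 * e) * k - e \<le> \<phi> n (\<lambda>i j. e * delta i j)"
    using phi_noise[OF n] by blast
  have main: "\<phi> n D * (1 - sqrt (2 * e) * k - e) \<le> \<phi> n C" if e: "0 < e" for e
  proof -
    let ?E = "\<lambda>C i j. C i j + e * delta i j"
    have I: "psd n (\<lambda>i j. e * delta i j)" using psd_scale[OF psd_delta] e by simp
    note CE = psd_add[OF C I] and DE = psd_add[OF D I]
    obtain K1 where K1: "\<And>K c. K1 \<le> K \<Longrightarrow> e / 2 * (\<Sum>i<n. (c i)\<^sup>2) \<le> qform n (\<lambda>i j. K - vgram (?E C) i j / 2) c"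
      using constant_diagonal_coercive[OF C e] by blast
    obtain K2 where K2: "\<And>K c. K2 \<le> K \<Longrightarrow> e / 2 * (\<Sum>i<n. (c i)\<^sup>2) \<le> qform n (\<lambda>i j. K - vgram (?E D) i j / 2) c"
      using constant_diagonal_coercive[OF D e] by blast
    \<comment> \<open>One constant for both matrices: since \<open>vgram\<close> vanishes on the
      diagonal, \<open>A\<close> and \<open>B\<close> then agree there.\<close>
    define A where "A = (\<lambda>i j. max K1 K2 - vgram (?E C) i j / 2)"
    define B where "B = (\<lambda>i j. max K1 K2 - vgram (?E D) i j / 2)"
    have cA: "e / 2 * (\<Sum>i<n. (c i)\<^sup>2) \<le> qform n A c" and cB: "e / 2 * (\<Sum>i<n. (c i)\<^sup>2) \<le> qform n B c" for c
      unfolding A_def B_def by (intro K1 K2; simp)+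
    have sA: "A i j = A j i" and sB: "B i j = B j i" if "i < n" "j < n" for i j
      using psdD(1)[OF C that] psdD(1)[OF D that] by (auto simp: A_def B_def vgram_def)
    have Q: "0 \<le> e / 2 * (\<Sum>i<n. (c i)\<^sup>2)" for c :: "nat \<Rightarrow> real" using e by (simp add: sum_nonneg)
    have pA: "psd n A" and pB: "psd n B" using sA sB Q cA cB order_trans unfolding psd_def by blast+
    have eA: "\<phi> n (?E C) = \<phi> n A" and eB: "\<phi> n (?E D) = \<phi> n B"
      by (rule phi_eq_of_vgram_eq; (fact CE DE pA pB n)?; simp add: A_def B_def vgram_def)+
    have "\<phi> n D * (1 - sqrt (2 * e) * k - e) \<le> \<phi> n D * \<phi> n (\<lambda>i j. e * delta i j)"
      using k[of e] e phi_pos[OF D n] by (intro mult_left_mono) auto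
    also have "\<dots> \<le> \<phi> n (?E D)" by (rule phi_add_ge[OF D I n])
    also have "\<dots> \<le> \<phi> n (?E C)" unfolding eA eB
    proof (rule phi_mono_offdiag[OF n, where k = "e / 2"])
      show "B i j \<le> A i j" if "i < n" "j < n" for i j
        using le[OF that] by (auto simp: A_def B_def vgram_def)
      show "B i i = A i i" if "i < n" for i by (simp add: A_def B_def vgram_def)
    qed (use e sA sB cA cB in auto)
    also have "\<dots> \<le> \<phi> n C" by (rule phi_add_le[OF C I n])
    finally show ?thesis .
  qed
  have "((\<lambda>e. \<phi> n D * (1 - sqrt (2 * e) * k - e)) \<longlongrightarrow> \<phi> n D * (1 - sqrt (2 * 0) * k - 0)) (at_right 0)"
    by (intro tendsto_intros)
  moreover have "\<forall>\<^sub>F e in at_right 0. \<phi> n D * (1 - sqrt (2 * e) * k - e) \<le> \<phi> n C"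
    using main by (auto intro: eventually_at_right_less[THEN eventually_mono])
  ultimately have "\<phi> n D * (1 - sqrt (2 * 0) * k - 0) \<le> \<phi> n C"
    by (rule tendsto_upperbound) simp
  then show ?thesis by simp
qed

subsection \<open>Lower bound for stationary vectors\<close>

lemma (in prob_space) exp_expectation_le:
  fixes U :: "'a \<Rightarrow> real"
  assumes "integrable M U" "integrable M (\<lambda>\<omega>. exp (U \<omega>))"
  shows "exp (expectation U) \<le> expectation (\<lambda>\<omega>. exp (U \<omega>))"
proof -
  let ?a = "expectation U"
  have "exp ?a = expectation (\<lambda>\<omega>. exp ?a * (1 + (U \<omega> - ?a)))"
    using assms(1) by (simp add: prob_space)
  also have "\<dots> \<le> expectation (\<lambda>\<omega>. exp (U \<omega>))"
  proof (rule integral_mono[OF _ assms(2)])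
    show "integrable M (\<lambda>\<omega>. exp ?a * (1 + (U \<omega> - ?a)))" using assms(1) by simp
    fix \<omega>
    have "exp ?a * (1 + (U \<omega> - ?a)) \<le> exp ?a * exp (U \<omega> - ?a)"
      by (intro mult_left_mono exp_ge_add_one_self) simp
    then show "exp ?a * (1 + (U \<omega> - ?a)) \<le> exp (U \<omega>)" by (simp add: exp_diff)
  qed
  finally show ?thesis .
qed

lemma gvec_integrable_lincomb:
  assumes X: "gvec M X n C" shows "integrable M (\<lambda>\<omega>. lincomb n c (\<lambda>i. X i \<omega>))"
proof (rule Bochner_Integration.integrable_bound)
  have [measurable]: "\<And>i. i < n \<Longrightarrow> X i \<in> borel_measurable M" by (rule gvecD[OF X])
  show "(\<lambda>\<omega>. lincomb n c (\<lambda>i. X i \<omega>)) \<in> borel_measurable M" by measurable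
  show "integrable M (\<lambda>\<omega>. exp (lincomb n c (\<lambda>i. X i \<omega>)) + exp (lincomb n (\<lambda>i. (-1) * c i) (\<lambda>i. X i \<omega>)))"
    by (intro Bochner_Integration.integrable_add gvec_exp_lincomb(1)[OF X])
  have "\<bar>x\<bar> \<le> exp x + exp (- x)" for x :: real
    using exp_ge_add_one_self[of x] exp_ge_add_one_self[of "-x"] exp_gt_zero[of x] exp_gt_zero[of "-x"] by linarith
  then show "AE \<omega> in M. norm (lincomb n c (\<lambda>i. X i \<omega>)) \<le>
      norm (exp (lincomb n c (\<lambda>i. X i \<omega>)) + exp (lincomb n (\<lambda>i. (-1) * c i) (\<lambda>i. X i \<omega>)))"
    unfolding lincomb_scale by (intro AE_I2) (simp add: abs_of_pos add_pos_pos)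
qed

lemma integrable_Max:
  fixes f :: "'i \<Rightarrow> 'a \<Rightarrow> real"
  assumes "finite I" "I \<noteq> {}" "\<And>i. i \<in> I \<Longrightarrow> integrable M (f i)"
  shows "integrable M (\<lambda>\<omega>. Max ((\<lambda>i. f i \<omega>) ` I))"
  using assms by (induction rule: finite_ne_induct) (auto intro!: integrable_max)

text \<open>Jensen's inequality for \<open>exp (l * Max)\<close>, with the exponential of the
  maximum bounded by the sum of the exponentials, and then the best \<open>l\<close>. Neither
  independence nor distinctness of the combinations enters.\<close>

lemma gvec_expectation_Max_le:
  assumes X: "gvec M X n C" and I: "finite I" "I \<noteq> {}" and s: "0 \<le> s"
    and q: "\<And>k. k \<in> I \<Longrightarrow> qform n C (c k) \<le> s\<^sup>2"
  shows "(LINT \<omega>|M. Max ((\<lambda>k. lincomb n (c k) (\<lambda>i. X i \<omega>)) ` I)) \<le> s * sqrt (2 * ln (real (card I)))"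
proof -
  interpret prob_space M by (rule gvecD[OF X])
  let ?U = "\<lambda>k \<omega>. lincomb n (c k) (\<lambda>i. X i \<omega>)"
  let ?Max = "\<lambda>\<omega>. Max ((\<lambda>k. ?U k \<omega>) ` I)"
  let ?N = "real (card I)"
  have N: "1 \<le> ?N" using I by (simp add: Suc_leI card_gt_0_iff)
  have iM: "integrable M ?Max" by (intro integrable_Max I gvec_integrable_lincomb[OF X])
  have le: "expectation ?Max \<le> ln ?N / l + l * s\<^sup>2 / 2" if l: "0 < l" for l
  proof -
    have eM: "exp (l * ?Max \<omega>) \<le> (\<Sum>k\<in>I. exp (lincomb n (\<lambda>i. l * c k i) (\<lambda>i. X i \<omega>)))" for \<omega>
    proof -
      have "?Max \<omega> \<in> (\<lambda>k. ?U k \<omega>) ` I" using I by (intro Max_in) auto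
      then obtain k where "k \<in> I" "?Max \<omega> = ?U k \<omega>" by auto
      then show ?thesis
        using member_le_sum[of k I "\<lambda>k. exp (lincomb n (\<lambda>i. l * c k i) (\<lambda>i. X i \<omega>))"] I
        by (simp add: lincomb_scale)
    qed
    have iS: "integrable M (\<lambda>\<omega>. \<Sum>k\<in>I. exp (lincomb n (\<lambda>i. l * c k i) (\<lambda>i. X i \<omega>)))"
      by (intro Bochner_Integration.integrable_sum gvec_exp_lincomb(1)[OF X])
    have ie: "integrable M (\<lambda>\<omega>. exp (l * ?Max \<omega>))"
      using borel_measurable_integrable[OF iM] eM
      by (intro Bochner_Integration.integrable_bound[OF iS] AE_I2) (auto intro: order_trans[OF eM abs_ge_self])
    have "exp (l * expectation ?Max) = exp (expectation (\<lambda>\<omega>. l * ?Max \<omega>))" by simp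
    also have "\<dots> \<le> expectation (\<lambda>\<omega>. exp (l * ?Max \<omega>))" using iM ie by (intro exp_expectation_le) auto
    also have "\<dots> \<le> expectation (\<lambda>\<omega>. \<Sum>k\<in>I. exp (lincomb n (\<lambda>i. l * c k i) (\<lambda>i. X i \<omega>)))"
      by (intro integral_mono ie iS eM)
    also have "\<dots> = (\<Sum>k\<in>I. exp (l\<^sup>2 * qform n C (c k) / 2))"
      by (subst Bochner_Integration.integral_sum)
        (auto simp: gvec_exp_lincomb[OF X] qform_coeff_scale)
    also have "\<dots> \<le> (\<Sum>k\<in>I. exp (l\<^sup>2 * s\<^sup>2 / 2))"
      using q by (intro sum_mono) (auto intro!: mult_left_mono)
    also have "\<dots> = exp (ln ?N + l\<^sup>2 * s\<^sup>2 / 2)" using N by (simp add: exp_add)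
    finally have "l * expectation ?Max \<le> ln ?N + l\<^sup>2 * s\<^sup>2 / 2" by simp
    then show ?thesis using l by (simp add: field_simps power2_eq_square)
  qed
  have lN: "0 \<le> ln ?N" using N by simp
  show ?thesis
  proof (cases "ln ?N = 0 \<or> s = 0")
    case True
    \<comment> \<open>Here no \<open>l\<close> is optimal: the bound is approached as
      \<open>l\<close> grows if \<open>s = 0\<close>, and as \<open>l\<close> tends to 0 if there is
      a single index.\<close>
    have "expectation ?Max \<le> 0"
    proof (rule field_le_epsilon)
      fix e :: real assume e: "0 < e"
      show "expectation ?Max \<le> 0 + e"
      proof (cases "s = 0")
        case True
        have "expectation ?Max \<le> ln ?N / ((ln ?N + 1) / e)"
          using le[of "(ln ?N + 1) / e"] e lN True by (simp add: add_nonneg_pos)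
        also have "\<dots> \<le> e" using e lN by (simp add: field_simps add_nonneg_pos)
        finally show ?thesis by simp
      next
        case False
        then show ?thesis using le[of "2 * e / s\<^sup>2"] True e by simp
      qed
    qed
    then show ?thesis using True by auto
  next
    case False
    with lN s have p: "0 < ln ?N" "0 < s" by auto
    \<comment> \<open>The choice \<open>l = sqrt (2 * ln N) / s\<close>, with \<open>N\<close> the
      number of indices, makes the two terms equal.\<close>
    have "expectation ?Max \<le> ln ?N / (sqrt (2 * ln ?N) / s) + sqrt (2 * ln ?N) / s * s\<^sup>2 / 2"
      using p by (intro le) simp
    also have "\<dots> = s * (ln ?N / sqrt (2 * ln ?N)) + s * sqrt (2 * ln ?N) / 2"
      using p by (simp add: power2_eq_square field_simps)
    also have "ln ?N / sqrt (2 * ln ?N) = sqrt (2 * ln ?N) / 2"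
      using p by (simp add: real_div_sqrt field_simps)
    finally show ?thesis by (simp add: field_simps)
  qed
qed

section \<open>Chaining along dyadic grids\<close>

lemma vgram_eq_qform:
  assumes "\<And>i j. i < n \<Longrightarrow> j < n \<Longrightarrow> C i j = C j i" "a < n" "b < n"
  shows "qform n C (\<lambda>i. (if i = a then 1 else 0) + (if i = b then - 1 else 0)) = vgram C a b"
  using assms by (subst qform_add_single) (auto simp: qform_single lincomb_single vgram_def)

text \<open>Level \<open>m\<close> consists of the indices \<open>k * 2 ^ (n - m)\<close>. On the
  coarsest level \<open>m0\<close> the plain maximal inequality with variance \<open>r 0\<close> is
  used; passing from level \<open>l\<close> to the next adds the maximum of the differences between
  the points and their predecessors \<open>k div 2\<close>, whose variances are controlled by the
  mesh.\<close>

lemma stationary_chaining: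
  fixes r :: "real \<Rightarrow> real"
  assumes Y: "gvec M Y (2 ^ n + 1) (\<lambda>i j. r \<bar>real i * T / 2 ^ n - real j * T / 2 ^ n\<bar>)"
    and T: "0 < T" and L: "0 \<le> L" and r0: "0 \<le> r 0"
    and r: "\<And>h. 0 \<le> h \<Longrightarrow> 2 * (r 0 - r h) \<le> L * h powr \<beta>"
    and m: "m0 \<le> m" "m \<le> n"
  shows "(LINT \<omega>|M. Max ((\<lambda>k. Y (k * 2 ^ (n - m)) \<omega>) ` {..2 ^ m})) \<le>
    sqrt (r 0) * sqrt (2 * ln (2 ^ m0 + 1)) +
    (\<Sum>l\<in>{m0..<m}. sqrt (L * (T / 2 ^ Suc l) powr \<beta>) * sqrt (2 * ln (2 ^ Suc l + 1)))"
  using m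
proof (induction m rule: dec_induct)
  let ?n = "2 ^ n + 1 :: nat"
  let ?C = "\<lambda>i j. r \<bar>real i * T / 2 ^ n - real j * T / 2 ^ n\<bar>"
  have idx: "k * 2 ^ (n - m) < ?n" if "k \<le> 2 ^ m" "m \<le> n" for k m :: nat
  proof -
    have "k * 2 ^ (n - m) \<le> 2 ^ m * 2 ^ (n - m)" using that by simp
    also have "\<dots> = 2 ^ n" using that by (simp add: power_add[symmetric])
    finally show ?thesis by simp
  qed
  have iY: "integrable M (\<lambda>\<omega>. Y i \<omega>)" if "i < ?n" for i
    using gvec_integrable_lincomb[OF Y, of "\<lambda>j. if j = i then 1 else 0"] that by (simp add: lincomb_single)
  {
    case base
    have "(LINT \<omega>|M. Max ((\<lambda>k. Y (k * 2 ^ (n - m0)) \<omega>) ` {..2 ^ m0})) =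
      (LINT \<omega>|M. Max ((\<lambda>k. lincomb ?n (\<lambda>j. if j = k * 2 ^ (n - m0) then 1 else 0) (\<lambda>i. Y i \<omega>)) ` {..2 ^ m0}))"
    proof (rule Bochner_Integration.integral_cong[OF refl], rule arg_cong[where f = Max], rule image_cong[OF refl])
      fix \<omega> and k :: nat assume "k \<in> {..2 ^ m0}"
      then show "Y (k * 2 ^ (n - m0)) \<omega> = lincomb ?n (\<lambda>j. if j = k * 2 ^ (n - m0) then 1 else 0) (\<lambda>i. Y i \<omega>)"
        using base idx[of k m0] by (simp add: lincomb_single)
    qed
    also have "\<dots> \<le> sqrt (r 0) * sqrt (2 * ln (real (card {..2 ^ m0 :: nat})))"
      by (rule gvec_expectation_Max_le[OF Y]) (use base idx r0 in \<open>auto simp: qform_single\<close>)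
    finally show ?case by (simp add: add.commute)
  next
    case (step l)
    then have ln: "l < n" by simp
    \<comment> \<open>The difference between point \<open>k\<close> of the finer level and its
      predecessor on level \<open>l\<close>.\<close>
    define c where "c k = (\<lambda>i. (if i = k * 2 ^ (n - Suc l) then 1 else 0) + (if i = k div 2 * 2 ^ (n - l) then - 1 else 0 :: real))" for k :: nat
    let ?s = "sqrt (L * (T / 2 ^ Suc l) powr \<beta>)"
    have pw: "2 ^ (n - l) = 2 * (2 ^ (n - Suc l) :: nat)"
      using ln by (metis Suc_diff_Suc power_Suc)
    have half: "k div 2 \<le> 2 ^ l" if "k \<le> 2 ^ Suc l" for k :: nat using that by auto
    have U: "lincomb ?n (c k) (\<lambda>i. Y i \<omega>) = Y (k * 2 ^ (n - Suc l)) \<omega> - Y (k div 2 * 2 ^ (n - l)) \<omega>"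
      if "k \<le> 2 ^ Suc l" for k \<omega>
      using idx[of k "Suc l"] idx[of "k div 2" l] half[OF that] that ln
      by (simp add: c_def lincomb_add lincomb_single)
    have sym: "?C i j = ?C j i" for i j by (simp add: abs_minus_commute)
    have q: "qform ?n ?C (c k) \<le> ?s\<^sup>2" if k: "k \<le> 2 ^ Suc l" for k
    proof -
      define h where "h = \<bar>real (k * 2 ^ (n - Suc l)) * T / 2 ^ n - real (k div 2 * 2 ^ (n - l)) * T / 2 ^ n\<bar>"
      have "qform ?n ?C (c k) = vgram ?C (k * 2 ^ (n - Suc l)) (k div 2 * 2 ^ (n - l))"
        unfolding c_def using idx[of k "Suc l"] idx[of "k div 2" l] half[OF k] k ln
        by (intro vgram_eq_qform sym) auto
      also have "\<dots> = 2 * (r 0 - r h)" by (simp add: vgram_def h_def)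
      also have "\<dots> \<le> L * h powr \<beta>" by (intro r) (simp add: h_def)
      also have "\<dots> \<le> L * (T / 2 ^ Suc l) powr \<beta>"
      proof -
        have p2: "(2::real) ^ n = 2 ^ (n - Suc l) * 2 ^ Suc l" using ln by (metis Suc_leI le_add_diff_inverse2 power_add)
        \<comment> \<open>An even point coincides with its predecessor, and an odd one lies a single
          fine step to its right.\<close>
        have "k * 2 ^ (n - Suc l) = k div 2 * 2 ^ (n - l) + k mod 2 * 2 ^ (n - Suc l)"
          unfolding pw using div_mult_mod_eq[of k 2] by (metis (no_types, lifting) distrib_right mult.assoc)
        then have "h = real (k mod 2 * 2 ^ (n - Suc l)) * T / 2 ^ n"
          using T by (simp add: h_def distrib_right add_divide_distrib)
        also have "\<dots> = real (k mod 2) * (T / 2 ^ Suc l)" unfolding p2 by simp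
        finally have h: "h = real (k mod 2) * (T / 2 ^ Suc l)" .
        show ?thesis
        proof (cases "k mod 2 = 0")
          case True then show ?thesis using h L T by simp
        next
          case False
          then have "k mod 2 = 1" by simp
          then show ?thesis using h by simp
        qed
      qed
      also have "\<dots> = ?s\<^sup>2" using L T by simp
      finally show ?thesis .
    qed
    let ?D = "\<lambda>\<omega>. Max ((\<lambda>k. lincomb ?n (c k) (\<lambda>i. Y i \<omega>)) ` {..2 ^ Suc l})"
    have "(LINT \<omega>|M. Max ((\<lambda>k. Y (k * 2 ^ (n - Suc l)) \<omega>) ` {..2 ^ Suc l})) \<le>
      (LINT \<omega>|M. Max ((\<lambda>k. Y (k * 2 ^ (n - l)) \<omega>) ` {..2 ^ l}) + ?D \<omega>)"
    proof (rule integral_mono)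
      show "integrable M (\<lambda>\<omega>. Max ((\<lambda>k. Y (k * 2 ^ (n - Suc l)) \<omega>) ` {..2 ^ Suc l}))"
        using idx[of _ "Suc l"] ln by (intro integrable_Max iY) auto
      show "integrable M (\<lambda>\<omega>. Max ((\<lambda>k. Y (k * 2 ^ (n - l)) \<omega>) ` {..2 ^ l}) + ?D \<omega>)"
        using idx[of _ l] ln
        by (intro Bochner_Integration.integrable_add integrable_Max iY gvec_integrable_lincomb[OF Y]) auto
      fix \<omega>
      have "Y (k * 2 ^ (n - Suc l)) \<omega> \<le> Max ((\<lambda>k. Y (k * 2 ^ (n - l)) \<omega>) ` {..2 ^ l}) + ?D \<omega>"
        if k: "k \<le> 2 ^ Suc l" for k
      proof -
        have "Y (k div 2 * 2 ^ (n - l)) \<omega> \<le> Max ((\<lambda>k. Y (k * 2 ^ (n - l)) \<omega>) ` {..2 ^ l})"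
          using half[OF k] by (intro Max_ge) auto
        moreover have "lincomb ?n (c k) (\<lambda>i. Y i \<omega>) \<le> ?D \<omega>" using k by (intro Max_ge) auto
        ultimately show ?thesis using U[OF k, of \<omega>] by linarith
      qed
      then show "Max ((\<lambda>k. Y (k * 2 ^ (n - Suc l)) \<omega>) ` {..2 ^ Suc l}) \<le>
        Max ((\<lambda>k. Y (k * 2 ^ (n - l)) \<omega>) ` {..2 ^ l}) + ?D \<omega>"
        by (subst Max_le_iff) auto
    qed
    also have "\<dots> = (LINT \<omega>|M. Max ((\<lambda>k. Y (k * 2 ^ (n - l)) \<omega>) ` {..2 ^ l})) + (LINT \<omega>|M. ?D \<omega>)"
      using idx[of _ l] ln
      by (intro Bochner_Integration.integral_add integrable_Max iY gvec_integrable_lincomb[OF Y]) auto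
    also have "(LINT \<omega>|M. ?D \<omega>) \<le> ?s * sqrt (2 * ln (real (card {..2 ^ Suc l :: nat})))"
      using q L by (intro gvec_expectation_Max_le[OF Y]) auto
    finally show ?case using step.IH ln step.hyps by (simp add: add.commute)
  }
qed

text \<open>The minimum of \<open>X\<close> is governed by the maximum of \<open>- X\<close>, a
  vector with the same covariance, and Jensen's inequality moves the expectation into the
  exponent.\<close>

lemma phi_stationary_ge:
  fixes r :: "real \<Rightarrow> real"
  assumes psd: "psd (2 ^ n + 1) (\<lambda>i j. r \<bar>real i * T / 2 ^ n - real j * T / 2 ^ n\<bar>)"
    and T: "0 < T" and L: "0 \<le> L" and r0: "0 \<le> r 0"
    and r: "\<And>h. 0 \<le> h \<Longrightarrow> 2 * (r 0 - r h) \<le> L * h powr \<beta>"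
    and m: "m0 \<le> n"
  shows "exp (- r 0 - sqrt 2 * (sqrt (r 0) * sqrt (2 * ln (2 ^ m0 + 1)) +
    (\<Sum>l\<in>{m0..<n}. sqrt (L * (T / 2 ^ Suc l) powr \<beta>) * sqrt (2 * ln (2 ^ Suc l + 1)))))
    \<le> \<phi> (2 ^ n + 1) (\<lambda>i j. r \<bar>real i * T / 2 ^ n - real j * T / 2 ^ n\<bar>)"
proof -
  let ?n = "2 ^ n + 1 :: nat"
  let ?C = "\<lambda>i j. r \<bar>real i * T / 2 ^ n - real j * T / 2 ^ n\<bar>"
  have n: "0 < ?n" by simp
  obtain M :: "(nat \<Rightarrow> real) measure" and X where X: "gvec M X ?n ?C" "\<phi> ?n ?C = emin M X (\<lambda>i. ?C i i) ?n"
    using phi_obtain[OF psd n] by blast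
  interpret prob_space M by (rule gvecD[OF X(1)])
  have Y: "gvec M (\<lambda>i \<omega>. - 1 * X i \<omega>) ?n ?C" using gvec_scale[OF X(1), of "- 1"] by simp
  let ?Max = "\<lambda>\<omega>. Max ((\<lambda>k. - 1 * X k \<omega>) ` {..2 ^ n})"
  let ?Min = "\<lambda>\<omega>. Min ((\<lambda>i. exp (sqrt 2 * X i \<omega> - r 0)) ` {..<?n})"
  let ?B = "sqrt (r 0) * sqrt (2 * ln (2 ^ m0 + 1)) +
    (\<Sum>l\<in>{m0..<n}. sqrt (L * (T / 2 ^ Suc l) powr \<beta>) * sqrt (2 * ln (2 ^ Suc l + 1)))"
  have E: "expectation ?Max \<le> ?B"
    using stationary_chaining[OF Y T L r0 r m order_refl] by simp
  have iY: "integrable M (\<lambda>\<omega>. - 1 * X i \<omega>)" if "i < ?n" for i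
    using gvec_integrable_lincomb[OF Y, of "\<lambda>j. if j = i then 1 else 0"] that by (simp add: lincomb_single)
  have iM: "integrable M ?Max" by (intro integrable_Max iY) auto
  have iMin: "integrable M ?Min" by (rule integrable_Min_exp[OF X(1) n])
  have pw: "exp (- r 0 - sqrt 2 * ?Max \<omega>) \<le> ?Min \<omega>" for \<omega>
  proof (rule Min_exp_ge[OF n])
    fix i assume "i < ?n"
    then have "- 1 * X i \<omega> \<le> ?Max \<omega>" by (intro Max_ge) auto
    then have "sqrt 2 * (- 1 * X i \<omega>) \<le> sqrt 2 * ?Max \<omega>" by (intro mult_left_mono) auto
    then show "exp (- r 0 - sqrt 2 * ?Max \<omega>) \<le> exp (sqrt 2 * X i \<omega> - r 0)" by simp
  qed
  have ie: "integrable M (\<lambda>\<omega>. exp (- r 0 - sqrt 2 * ?Max \<omega>))"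
  proof (rule Bochner_Integration.integrable_bound[OF iMin])
    show "(\<lambda>\<omega>. exp (- r 0 - sqrt 2 * ?Max \<omega>)) \<in> borel_measurable M"
      using borel_measurable_integrable[OF iM] by measurable
    show "AE \<omega> in M. norm (exp (- r 0 - sqrt 2 * ?Max \<omega>)) \<le> norm (?Min \<omega>)"
      unfolding real_norm_def abs_exp_cancel by (intro AE_I2 order_trans[OF pw abs_ge_self])
  qed
  have "exp (- r 0 - sqrt 2 * ?B) \<le> exp (- r 0 - sqrt 2 * expectation ?Max)"
    using E by simp
  also have "\<dots> = exp (expectation (\<lambda>\<omega>. - r 0 - sqrt 2 * ?Max \<omega>))"
    using iM by (simp add: prob_space)
  also have "\<dots> \<le> expectation (\<lambda>\<omega>. exp (- r 0 - sqrt 2 * ?Max \<omega>))"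
    using iM ie by (intro exp_expectation_le) auto
  also have "\<dots> \<le> expectation ?Min" by (intro integral_mono ie iMin pw)
  also have "\<dots> = \<phi> ?n ?C" using X(2) by (simp add: emin_def)
  finally show ?thesis .
qed

text \<open>Starting from a mesh of size \<open>u powr (- 2 / \<beta>)\<close>, the standard
  deviations on level \<open>m + i\<close> are at most \<open>sqrt L / u * q ^ i\<close>, while the
  logarithmic factor grows at most like \<open>Suc i\<close>. The series of
  \<open>Suc i * q ^ i\<close> sums to \<open>1 / (1 - q)\<^sup>2\<close>.\<close>

lemma chaining_sum_le:
  fixes L \<beta> u T :: real
  assumes "0 < \<beta>" "0 \<le> L" "0 < T" and u: "0 < u" and m: "T / 2 ^ m \<le> u powr (- 2 / \<beta>)"
  defines "q \<equiv> 2 powr (- \<beta> / 2)"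
  shows "(\<Sum>l\<in>{m..<n}. sqrt (L * (T / 2 ^ Suc l) powr \<beta>) * sqrt (2 * ln (2 ^ Suc l + 1))) \<le>
    sqrt L / u * sqrt (2 * (real m + 2)) * (1 / (1 - q)\<^sup>2)"
proof -
  have q: "0 < q" "q < 1" using \<open>0 < \<beta>\<close> by (auto simp: q_def powr_less_one)
  let ?K = "sqrt L / u * sqrt (2 * (real m + 2))"
  have K: "0 \<le> ?K" using u assms(2) by simp
  have bnd: "sqrt (L * (T / 2 ^ Suc (m + i)) powr \<beta>) * sqrt (2 * ln (2 ^ Suc (m + i) + 1)) \<le> ?K * (real (Suc i) * q ^ i)" for i
  proof -
    have "T / 2 ^ Suc (m + i) \<le> T / 2 ^ m / 2 ^ i"
      using \<open>0 < T\<close> by (simp add: power_add field_simps)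
    also have "\<dots> \<le> u powr (- 2 / \<beta>) / 2 ^ i" by (intro divide_right_mono m) simp
    also have "\<dots> = u powr (- 2 / \<beta>) * 2 powr (- real i)"
      by (simp add: powr_minus_divide powr_realpow)
    finally have "(T / 2 ^ Suc (m + i)) powr \<beta> \<le> (u powr (- 2 / \<beta>) * 2 powr (- real i)) powr \<beta>"
      using assms by (intro powr_mono2) auto
    also have "\<dots> = (1 / u * q ^ i)\<^sup>2"
    proof -
      have "(u powr (- 2 / \<beta>)) powr \<beta> = (1 / u)\<^sup>2"

      proof -
        have "(u powr (- 2 / \<beta>)) powr \<beta> = u powr (- 2)" using assms(1) by (simp only: powr_powr) simp
        then show ?thesis using u by (simp add: powr_minus_divide power_divide)
      qed
      moreover have "(2 powr (- real i)) powr \<beta> = (q ^ i)\<^sup>2"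
        by (simp add: q_def powr_powr powr_power mult.commute flip: powr_realpow power_mult)
      ultimately show ?thesis by (simp add: powr_mult power_mult_distrib power_divide)
    qed
    finally have "L * (T / 2 ^ Suc (m + i)) powr \<beta> \<le> L * (1 / u * q ^ i)\<^sup>2"
      using assms(2) by (rule mult_left_mono)
    then have "sqrt (L * (T / 2 ^ Suc (m + i)) powr \<beta>) \<le> sqrt (L * (1 / u * q ^ i)\<^sup>2)" by (rule real_sqrt_le_mono)
    also have "\<dots> = sqrt L / u * q ^ i" using u q by (simp add: real_sqrt_mult)
    finally have 1: "sqrt (L * (T / 2 ^ Suc (m + i)) powr \<beta>) \<le> sqrt L / u * q ^ i" .
    have "(1 :: real) \<le> 2 ^ (m + i)" by (rule one_le_power) simp
    then have "(2 :: real) ^ Suc (m + i) + 1 \<le> 2 ^ Suc (Suc (m + i))" unfolding power_Suc by linarith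
    then have "ln (2 ^ Suc (m + i) + 1) \<le> ln (2 ^ Suc (Suc (m + i)) :: real)"
      by (subst ln_le_cancel_iff) (simp_all add: add_pos_pos)
    also have "\<dots> = real (m + i + 2) * ln 2" by (subst ln_realpow) (auto simp: add_ac)
    also have "\<dots> \<le> real (m + i + 2) * 1" using ln_2_less_1 by (intro mult_left_mono) auto
    \<comment> \<open>A crude bound whose purpose is to separate \<open>m\<close> from
      \<open>i\<close>; the square disappears under the root.\<close>
    also have "\<dots> \<le> (real m + 2) * (real (Suc i))\<^sup>2"
    proof -
      have "m + i + 2 \<le> (m + 2) * (Suc i * Suc i)" by (induction i) auto
      then have "real (m + i + 2) \<le> real ((m + 2) * (Suc i * Suc i))" by (rule of_nat_mono)
      then show ?thesis by (simp only: of_nat_mult of_nat_add power2_eq_square) simp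
    qed
    finally have "sqrt (2 * ln (2 ^ Suc (m + i) + 1)) \<le> sqrt (2 * (real m + 2) * (real (Suc i))\<^sup>2)"
      unfolding mult.assoc by (intro real_sqrt_le_mono mult_left_mono) simp_all
    also have "\<dots> = sqrt (2 * (real m + 2)) * real (Suc i)" by (subst real_sqrt_mult) simp
    finally have 2: "sqrt (2 * ln (2 ^ Suc (m + i) + 1)) \<le> sqrt (2 * (real m + 2)) * real (Suc i)" .
    have "sqrt (L * (T / 2 ^ Suc (m + i)) powr \<beta>) * sqrt (2 * ln (2 ^ Suc (m + i) + 1)) \<le>
      (sqrt L / u * q ^ i) * (sqrt (2 * (real m + 2)) * real (Suc i))"
      using u q assms(2) by (intro mult_mono 1 2) (auto intro!: ln_ge_zero)
    then show ?thesis by (simp add: mult_ac)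
  qed
  have sums: "(\<lambda>i. real (Suc i) * q ^ i) sums (1 / (1 - q)\<^sup>2)"
    using geometric_deriv_sums[of q] q by simp
  have "(\<Sum>l\<in>{m..<n}. sqrt (L * (T / 2 ^ Suc l) powr \<beta>) * sqrt (2 * ln (2 ^ Suc l + 1))) =
    (\<Sum>i<n - m. sqrt (L * (T / 2 ^ Suc (m + i)) powr \<beta>) * sqrt (2 * ln (2 ^ Suc (m + i) + 1)))"
    by (rule sum.reindex_bij_witness[of _ "\<lambda>i. m + i" "\<lambda>l. l - m"]) auto
  also have "\<dots> \<le> (\<Sum>i<n - m. ?K * (real (Suc i) * q ^ i))" by (intro sum_mono bnd)
  also have "\<dots> = ?K * (\<Sum>i<n - m. real (Suc i) * q ^ i)" by (simp only: sum_distrib_left)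
  also have "\<dots> \<le> ?K * (\<Sum>i. real (Suc i) * q ^ i)"
    using sums q by (intro mult_left_mono K sum_le_suminf) (auto simp: sums_iff)
  also have "(\<Sum>i. real (Suc i) * q ^ i) = 1 / (1 - q)\<^sup>2" using sums by (simp add: sums_iff)
  finally show ?thesis .
qed

text \<open>The starting level of the chaining is a compromise: fine enough for the remainder of the
  chain to vanish, yet with so few points that the logarithm of their number is \<open>ln T\<close>
  up to a multiple of \<open>ln (ln T)\<close>. The threshold \<open>n0\<close> may depend on
  \<open>T\<close>.\<close>

theorem phi_stationary_asymp:
  fixes r :: "real \<Rightarrow> real"
  assumes \<beta>: "0 < \<beta>" and L: "0 \<le> L" and r0: "0 \<le> r 0"
    and r: "\<And>h. 0 \<le> h \<Longrightarrow> 2 * (r 0 - r h) \<le> L * h powr \<beta>"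
    and psd: "\<And>n (t :: nat \<Rightarrow> real). psd n (\<lambda>i j. r \<bar>t i - t j\<bar>)"
  obtains f where "(f \<longlongrightarrow> 0) at_top"
    "\<forall>\<^sub>F T in at_top. \<exists>n0. \<forall>n\<ge>n0. exp (- r 0 - 2 * sqrt (r 0) * sqrt (ln T) - f T)
       \<le> \<phi> (2 ^ n + 1) (\<lambda>i j. r \<bar>real i * T / 2 ^ n - real j * T / 2 ^ n\<bar>)"
proof -
  define p where "p = 2 / \<beta>"
  have p: "0 < p" using \<beta> by (simp add: p_def)
  define S where "S = 1 / (1 - 2 powr (- \<beta> / 2))\<^sup>2"
  have S: "0 \<le> S" by (simp add: S_def)
  \<comment> \<open>The error \<open>g1\<close> measures the excess of the root of the
    log-cardinality over \<open>sqrt (ln T)\<close>, and \<open>g2\<close> is the size of the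
    chaining remainder.\<close>
  define g1 where "g1 T = sqrt (ln 3 + ln T + p * ln (ln T)) - sqrt (ln T)" for T :: real
  define g2 where "g2 T = sqrt (2 * ((ln T + p * ln (ln T)) / ln 2 + 3)) / ln T" for T :: real
  define f where "f T = 2 * sqrt (r 0) * g1 T + sqrt 2 * (sqrt L * S) * g2 T" for T
  have "(g1 \<longlongrightarrow> 0) at_top" unfolding g1_def[abs_def] using p by real_asymp
  moreover have "(g2 \<longlongrightarrow> 0) at_top" unfolding g2_def[abs_def] using p by real_asymp
  ultimately have lim: "(f \<longlongrightarrow> 0) at_top"
    unfolding f_def[abs_def] by (auto intro!: tendsto_eq_intros)
  have "\<exists>n0. \<forall>n\<ge>n0. exp (- r 0 - 2 * sqrt (r 0) * sqrt (ln T) - f T)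
       \<le> \<phi> (2 ^ n + 1) (\<lambda>i j. r \<bar>real i * T / 2 ^ n - real j * T / 2 ^ n\<bar>)" if T: "exp 1 \<le> T" for T
  proof -
    have T0: "0 < T" using T by (meson exp_gt_zero less_le_trans)
    have u: "1 \<le> ln T" using T T0 by (simp add: ln_ge_iff)
    have T1: "1 \<le> T" using T by (meson exp_ge_add_one_self order_trans one_le_exp_iff zero_le_one)
    \<comment> \<open>The exponent \<open>p = 2 / \<beta>\<close> makes the mesh
      \<open>T / w\<close> equal to \<open>ln T powr (- 2 / \<beta>)\<close>, as
      \<open>chaining_sum_le\<close> asks for \<open>u = ln T\<close>. Rounding up to a power of 2
      at most doubles \<open>w\<close>, and the extra grid point accounts for the constant
      3.\<close>
    define w where "w = T * ln T powr p"
    have w: "1 \<le> w" using mult_mono[OF T1 ge_one_powr_ge_zero[OF u, of p]] p T0 by (simp add: w_def)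
    have lw: "ln w = ln T + p * ln (ln T)" using T0 u by (simp add: w_def ln_mult ln_powr)
    define m where "m = nat \<lceil>log 2 w\<rceil>"
    have l0: "0 \<le> log 2 w" using w by simp
    have m: "log 2 w \<le> m" "real m \<le> log 2 w + 1" using l0 by (auto simp: m_def)
    have "w \<le> 2 ^ m" using m(1) w by (simp add: log_le_iff powr_realpow)
    then have "T / 2 ^ m \<le> T / w" using T0 w by (intro divide_left_mono) auto
    also have "\<dots> = ln T powr (- 2 / \<beta>)" using T0 by (simp add: w_def p_def powr_minus_divide)
    finally have mT: "T / 2 ^ m \<le> ln T powr (- 2 / \<beta>)" .
    have "2 ^ m = 2 powr (real m)" by (simp add: powr_realpow)
    also have "\<dots> \<le> 2 powr (log 2 w + 1)" using m(2) by simp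
    also have "\<dots> = 2 * w" using w by (simp add: powr_add)
    finally have "2 ^ m + 1 \<le> 3 * w" using w by simp
    then have "ln (2 ^ m + 1) \<le> ln (3 * w)" using w by (subst ln_le_cancel_iff) (auto simp: add_pos_pos)
    also have "\<dots> = ln 3 + ln T + p * ln (ln T)" using w lw by (simp add: ln_mult)
    finally have "sqrt (2 * ln (2 ^ m + 1)) \<le> sqrt 2 * sqrt (ln 3 + ln T + p * ln (ln T))"
      by (subst real_sqrt_mult[symmetric]) simp
    then have "sqrt (2 * ln (2 ^ m + 1)) \<le> sqrt 2 * (g1 T + sqrt (ln T))" by (simp add: g1_def)
    then have 1: "sqrt (r 0) * sqrt (2 * ln (2 ^ m + 1)) \<le> sqrt (r 0) * (sqrt 2 * (g1 T + sqrt (ln T)))"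
      using r0 by (intro mult_left_mono) simp_all
    have 2: "sqrt L / ln T * sqrt (2 * (real m + 2)) * S \<le> sqrt L * S * g2 T"
    proof -
      have "real m + 2 \<le> (ln T + p * ln (ln T)) / ln 2 + 3" using m(2) by (simp add: log_def lw)
      then have "sqrt (2 * (real m + 2)) \<le> sqrt (2 * ((ln T + p * ln (ln T)) / ln 2 + 3))"
        by (intro real_sqrt_le_mono mult_left_mono) simp_all
      then have "sqrt L * S / ln T * sqrt (2 * (real m + 2)) \<le> sqrt L * S / ln T * sqrt (2 * ((ln T + p * ln (ln T)) / ln 2 + 3))"
        using S L u by (intro mult_left_mono) auto
      then show ?thesis by (simp add: g2_def mult_ac)
    qed
    have "exp (- r 0 - 2 * sqrt (r 0) * sqrt (ln T) - f T)
       \<le> \<phi> (2 ^ n + 1) (\<lambda>i j. r \<bar>real i * T / 2 ^ n - real j * T / 2 ^ n\<bar>)" if n: "m \<le> n" for n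
    proof -
      let ?B = "sqrt (r 0) * sqrt (2 * ln (2 ^ m + 1)) +
        (\<Sum>l\<in>{m..<n}. sqrt (L * (T / 2 ^ Suc l) powr \<beta>) * sqrt (2 * ln (2 ^ Suc l + 1)))"
      have "?B \<le> sqrt (r 0) * (sqrt 2 * (g1 T + sqrt (ln T))) + sqrt L * S * g2 T"
        using chaining_sum_le[OF \<beta> L T0 _ mT, of n] u 1 2 unfolding S_def by linarith
      then have "sqrt 2 * ?B \<le> sqrt 2 * (sqrt (r 0) * (sqrt 2 * (g1 T + sqrt (ln T))) + sqrt L * S * g2 T)"
        by (intro mult_left_mono) auto
      also have "\<dots> = 2 * sqrt (r 0) * sqrt (ln T) + f T"
        by (simp add: f_def algebra_simps)
      finally have "exp (- r 0 - 2 * sqrt (r 0) * sqrt (ln T) - f T) \<le> exp (- r 0 - sqrt 2 * ?B)" by simp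
      also have "\<dots> \<le> \<phi> (2 ^ n + 1) (\<lambda>i j. r \<bar>real i * T / 2 ^ n - real j * T / 2 ^ n\<bar>)"
        by (rule phi_stationary_ge[OF psd T0 L r0 r n])
      finally show ?thesis .
    qed
    then show ?thesis by blast
  qed
  then show thesis using lim
    by (intro that[of f]) (auto intro: eventually_at_top_linorderI[of "exp 1"])
qed

subsection \<open>Gaussian processes\<close>

lemma lincomb_linear:
  "lincomb n c (\<lambda>i. lincomb m (A i) x) = lincomb m (\<lambda>k. \<Sum>i<n. c i * A i k) x"
  unfolding lincomb_def sum_distrib_left sum_distrib_right by (subst sum.swap) (simp add: mult.assoc)

definition bform :: "nat \<Rightarrow> (nat \<Rightarrow> nat \<Rightarrow> real) \<Rightarrow> (nat \<Rightarrow> real) \<Rightarrow> (nat \<Rightarrow> real) \<Rightarrow> real" where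
  "bform n C c d = (\<Sum>i<n. \<Sum>j<n. c i * d j * C i j)"

lemma bform_polar:
  assumes "\<And>i j. i < n \<Longrightarrow> j < n \<Longrightarrow> C i j = C j i"
  shows "bform n C c d = (qform n C c + qform n C d - qform n C (\<lambda>i. c i - d i)) / 2"
proof -
  have "bform n C d c = bform n C c d"
    unfolding bform_def by (subst sum.swap) (intro sum.cong refl, simp add: assms)
  moreover have "qform n C (\<lambda>i. c i - d i) = qform n C c + qform n C d - bform n C c d - bform n C d c"
    by (simp add: qform_def bform_def algebra_simps sum.distrib sum_subtractf)
  ultimately show ?thesis by simp
qed

lemma bform_sum: "bform m C (\<lambda>k. \<Sum>i<(n :: nat). c i * A i k) d = (\<Sum>i<n. c i * bform m C (A i) d)"
proof (induction n)
  case (Suc n)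
  have "bform m C (\<lambda>k. (\<Sum>i<n. c i * A i k) + c n * A n k) d =
    bform m C (\<lambda>k. \<Sum>i<n. c i * A i k) d + c n * bform m C (A n) d"
    by (simp add: bform_def algebra_simps sum.distrib sum_distrib_left)
  with Suc show ?case by simp
qed (simp add: bform_def)

lemma bform_sum': "bform m C d (\<lambda>k. \<Sum>i<(n :: nat). c i * A i k) = (\<Sum>i<n. c i * bform m C d (A i))"
proof (induction n)
  case (Suc n)
  have "bform m C d (\<lambda>k. (\<Sum>i<n. c i * A i k) + c n * A n k) =
    bform m C d (\<lambda>k. \<Sum>i<n. c i * A i k) + c n * bform m C d (A n)"
    by (simp add: bform_def algebra_simps sum.distrib sum_distrib_left)
  with Suc show ?case by simp
qed (simp add: bform_def)

text \<open>The covariance is written by polarisation because the variances of the differences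
  \<open>A i - A j\<close> are what can be computed directly in the applications.\<close>

lemma gvec_linear:
  assumes X: "gvec M X m C" and C: "\<And>i j. i < m \<Longrightarrow> j < m \<Longrightarrow> C i j = C j i"
  shows "gvec M (\<lambda>i \<omega>. lincomb m (A i) (\<lambda>k. X k \<omega>)) n
    (\<lambda>i j. (qform m C (A i) + qform m C (A j) - qform m C (\<lambda>k. A i k - A j k)) / 2)"
proof -
  have "qform m C (\<lambda>k. \<Sum>i<n. c i * A i k) = qform n (\<lambda>i j. bform m C (A i) (A j)) c" for c
  proof -
    have "qform m C (\<lambda>k. \<Sum>i<n. c i * A i k) = bform m C (\<lambda>k. \<Sum>i<n. c i * A i k) (\<lambda>k. \<Sum>i<n. c i * A i k)"
      by (simp add: qform_def bform_def)
    then show ?thesis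
      unfolding bform_sum bform_sum' by (simp add: qform_def sum_distrib_left mult.assoc)
  qed
  then show ?thesis
    using gvecD[OF X] by (auto simp: gvec_def lincomb_linear bform_polar[of m C, OF C])
qed

lemma gvec_AE_cong:
  assumes X: "gvec M X n C" and Y: "\<And>i. i < n \<Longrightarrow> Y i \<in> borel_measurable M"
    and eq: "\<And>i. i < n \<Longrightarrow> AE \<omega> in M. X i \<omega> = Y i \<omega>"
  shows "gvec M Y n C"
proof -
  have [measurable]: "\<And>i. i < n \<Longrightarrow> X i \<in> borel_measurable M" by (rule gvecD[OF X])
  note Y[measurable]
  have "AE \<omega> in M. \<forall>i\<in>{..<n}. X i \<omega> = Y i \<omega>" using eq by (intro AE_finite_allI) auto
  then have "(CLINT \<omega>|M. iexp (lincomb n c (\<lambda>i. Y i \<omega>))) = (CLINT \<omega>|M. iexp (lincomb n c (\<lambda>i. X i \<omega>)))" for c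
    by (intro integral_cong_AE; measurable?) (auto simp: lincomb_def elim!: eventually_mono)
  with gvecD[OF X] Y show ?thesis by (simp add: gvec_def)
qed

lemma char_distr_1: "U \<in> borel_measurable M \<Longrightarrow> char (distr M borel U) 1 = (CLINT \<omega>|M. iexp (U \<omega>))"
  unfolding char_def by (subst integral_distr) simp_all

lemma gvec_add_indep:
  assumes X: "gvec M X n C" and Y: "gvec M Y n D"
    and ind: "\<And>c. prob_space.indep_var M borel (\<lambda>\<omega>. lincomb n c (\<lambda>i. X i \<omega>)) borel (\<lambda>\<omega>. lincomb n c (\<lambda>i. Y i \<omega>))"
  shows "gvec M (\<lambda>i \<omega>. X i \<omega> + Y i \<omega>) n (\<lambda>i j. C i j + D i j)"
proof -
  interpret prob_space M by (rule gvecD[OF X])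
  have m[measurable]: "\<And>i. i < n \<Longrightarrow> X i \<in> borel_measurable M" "\<And>i. i < n \<Longrightarrow> Y i \<in> borel_measurable M"
    using gvecD[OF X] gvecD[OF Y] by auto
  have "(CLINT \<omega>|M. iexp (lincomb n c (\<lambda>i. X i \<omega> + Y i \<omega>))) =
      complex_of_real (exp (- qform n (\<lambda>i j. C i j + D i j) c / 2))" for c
  proof -
    have "(CLINT \<omega>|M. iexp (lincomb n c (\<lambda>i. X i \<omega> + Y i \<omega>))) =
       (CLINT \<omega>|M. iexp (lincomb n c (\<lambda>i. X i \<omega>))) * (CLINT \<omega>|M. iexp (lincomb n c (\<lambda>i. Y i \<omega>)))"
      using char_distr_add[OF ind[of c], of 1] unfolding lincomb_add_right
      by (subst (asm) (1 2 3) char_distr_1) simp_all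
    also have "\<dots> = complex_of_real (exp (- qform n (\<lambda>i j. C i j + D i j) c / 2))"
      unfolding gvecD(3)[OF X] gvecD(3)[OF Y] qform_add
      by (simp only: of_real_mult[symmetric] exp_add[symmetric]) (simp add: add_divide_distrib)
    finally show ?thesis .
  qed
  then show ?thesis using prob_space_axioms m by (auto simp: gvec_def)
qed

lemma char_lincomb_limit:
  assumes "prob_space M" and X: "\<And>N i. i < n \<Longrightarrow> X N i \<in> borel_measurable M"
    and lim: "\<And>i \<omega>. i < n \<Longrightarrow> \<omega> \<in> space M \<Longrightarrow> (\<lambda>N. X N i \<omega>) \<longlonglongrightarrow> Y i \<omega>"
  shows "(\<lambda>N. CLINT \<omega>|M. iexp (lincomb n c (\<lambda>i. X N i \<omega>))) \<longlonglongrightarrow> (CLINT \<omega>|M. iexp (lincomb n c (\<lambda>i. Y i \<omega>)))"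
proof (rule integral_dominated_convergence[where w = "\<lambda>_. 1"])
  interpret prob_space M by fact
  note X[measurable]
  have [measurable]: "Y i \<in> borel_measurable M" if "i < n" for i
    using lim[OF that] X[OF that] by (rule borel_measurable_LIMSEQ_real)
  show "AE \<omega> in M. (\<lambda>N. iexp (lincomb n c (\<lambda>i. X N i \<omega>))) \<longlonglongrightarrow> iexp (lincomb n c (\<lambda>i. Y i \<omega>))"
    unfolding lincomb_def by (intro AE_I2 tendsto_intros lim) auto
  show "(\<lambda>\<omega>. iexp (lincomb n c (\<lambda>i. Y i \<omega>))) \<in> borel_measurable M"
    "\<And>N. (\<lambda>\<omega>. iexp (lincomb n c (\<lambda>i. X N i \<omega>))) \<in> borel_measurable M" by measurable
  show "integrable M (\<lambda>_. 1 :: real)" by simp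
qed auto

text \<open>The characteristic functions converge by bounded convergence, without any control of
  moments. Applied to Riemann sums of paths.\<close>

lemma gvec_limit:
  assumes X: "\<And>N. gvec M (X N) n (C N)"
    and lim: "\<And>i \<omega>. i < n \<Longrightarrow> \<omega> \<in> space M \<Longrightarrow> (\<lambda>N. X N i \<omega>) \<longlonglongrightarrow> Y i \<omega>"
    and C: "\<And>i j. i < n \<Longrightarrow> j < n \<Longrightarrow> (\<lambda>N. C N i j) \<longlonglongrightarrow> D i j"
  shows "gvec M Y n D"
proof -
  have mY: "Y i \<in> borel_measurable M" if "i < n" for i
    using lim[OF that] gvecD(2)[OF X that] by (rule borel_measurable_LIMSEQ_real)
  have "(\<lambda>N. CLINT \<omega>|M. iexp (lincomb n c (\<lambda>i. X N i \<omega>))) \<longlonglongrightarrow> complex_of_real (exp (- qform n D c / 2))" for c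
    unfolding gvecD(3)[OF X] qform_def by (intro tendsto_intros C) auto
  then show ?thesis
    using LIMSEQ_unique[OF char_lincomb_limit[OF gvecD(1)[OF X] gvecD(2)[OF X] lim]] gvecD(1)[OF X] mY
    by (auto simp: gvec_def)
qed

lemma gvec_moments:
  assumes X: "gvec M X n C" and k: "k < n"
  shows "prob_space.expectation M (X k) = 0" "prob_space.variance M (X k) = C k k"
proof -
  interpret SN: real_distribution std_normal_distribution by (rule real_dist_normal_dist)
  have [measurable]: "X k \<in> borel_measurable M" by (rule gvecD(2)[OF X k])
  let ?s = "sqrt (C k k)"
  have s: "0 \<le> C k k" using gvec_qform_nonneg[OF X, of "\<lambda>i. if i = k then 1 else 0"] k by (simp add: qform_single)
  have d: "distr M borel (X k) = distr std_normal_distribution borel (\<lambda>z. ?s * z)"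
    using gvec_distr[OF X, of "\<lambda>i. if i = k then 1 else 0"] k by (simp add: lincomb_single qform_single)
  have E: "integral\<^sup>L M (\<lambda>\<omega>. h (X k \<omega>)) = (LINT z|std_normal_distribution. h (?s * z))"
    if [measurable]: "h \<in> borel_measurable borel" for h :: "real \<Rightarrow> real"
    using arg_cong[OF d, of "\<lambda>D. integral\<^sup>L D h"] by (subst (asm) (1 2) integral_distr) simp_all
  have "(LINT z|std_normal_distribution. z) = 0"
    using integral_std_normal_distribution_moment_odd[of 1] by simp
  then show 0: "prob_space.expectation M (X k) = 0" using E[of "\<lambda>x. x"] by simp
  have "(LINT z|std_normal_distribution. z\<^sup>2) = 1"
    using std_normal_distribution_even_moments(1)[of 1] by (simp add: numeral_2_eq_2)
  then show "prob_space.variance M (X k) = C k k"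
    unfolding 0 using E[of "\<lambda>x. x\<^sup>2"] s by (simp add: power_mult_distrib)
qed

lemma normal_iexp:
  assumes s: "0 < s" and d: "distributed M lborel U (normal_density 0 s)" and "prob_space M"
  shows "(CLINT \<omega>|M. iexp (u * U \<omega>)) = complex_of_real (exp (- (u * s)\<^sup>2 / 2))"
proof -
  interpret prob_space M by fact
  have [measurable]: "U \<in> borel_measurable M" using distributed_measurable[OF d] by simp
  have "distributed M lborel (\<lambda>\<omega>. (U \<omega> - 0) / s) std_normal_density"
    using normal_standard_normal_convert[OF s] d by blast
  then have D: "distr M lborel (\<lambda>\<omega>. U \<omega> / s) = std_normal_distribution"
    by (simp add: distributed_def)
  have "(CLINT \<omega>|M. iexp (u * U \<omega>)) = (CLINT z|distr M lborel (\<lambda>\<omega>. U \<omega> / s). iexp (u * s * z))"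
    using s by (subst integral_distr) auto
  also have "\<dots> = complex_of_real (exp (- (u * s)\<^sup>2 / 2))"
    unfolding D using fun_cong[OF char_std_normal_distribution, of "u * s"] by (simp add: char_def)
  finally show ?thesis .
qed

lemma gaussian_rv_char:
  assumes "prob_space M" and U: "gaussian_rv M U" and 0: "prob_space.expectation M U = 0"
  shows "integrable M (\<lambda>\<omega>. (U \<omega>)\<^sup>2)"
    and "(CLINT \<omega>|M. iexp (U \<omega>)) = complex_of_real (exp (- (LINT \<omega>|M. (U \<omega>)\<^sup>2) / 2))"
proof -
  interpret prob_space M by fact
  have [measurable]: "U \<in> borel_measurable M" using U by (simp add: gaussian_rv_def)
  have "integrable M (\<lambda>\<omega>. (U \<omega>)\<^sup>2) \<and>
    (CLINT \<omega>|M. iexp (U \<omega>)) = complex_of_real (exp (- (LINT \<omega>|M. (U \<omega>)\<^sup>2) / 2))"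
  proof (cases "\<exists>\<mu>. AE \<omega> in M. U \<omega> = \<mu>")
    case True
    then obtain \<mu> where \<mu>: "AE \<omega> in M. U \<omega> = \<mu>" by blast
    have "expectation U = \<mu>"
      using integral_cong_AE[of U M "\<lambda>_. \<mu>"] \<mu> by (simp add: prob_space)
    with 0 \<mu> have z: "AE \<omega> in M. U \<omega> = 0" by simp
    have "(CLINT \<omega>|M. iexp (U \<omega>)) = (CLINT \<omega>|M. 1)"
      using z by (intro integral_cong_AE) auto
    moreover have "(LINT \<omega>|M. (U \<omega>)\<^sup>2) = (LINT \<omega>|M. 0)" using z by (intro integral_cong_AE) auto
    moreover have "integrable M (\<lambda>\<omega>. (U \<omega>)\<^sup>2)"
      using z by (subst integrable_cong_AE[of _ _ "\<lambda>_. 0"]) auto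
    ultimately show ?thesis by (simp add: prob_space)
  next
    case False
    with U obtain \<mu> s where s: "0 < s" and d: "distributed M lborel U (normal_density \<mu> s)"
      unfolding gaussian_rv_def by blast
    have "\<mu> = 0" using normal_distributed_expectation[OF s d] 0 s by simp
    with d have d: "distributed M lborel U (normal_density 0 s)" by simp
    have V: "(LINT \<omega>|M. (U \<omega>)\<^sup>2) = s\<^sup>2" using normal_distributed_variance[OF s d] 0 by simp
    have "(CLINT \<omega>|M. iexp (U \<omega>)) = complex_of_real (exp (- (LINT \<omega>|M. (U \<omega>)\<^sup>2) / 2))"
      using normal_iexp[OF s d prob_space_axioms, of 1] by (simp add: V)
    \<comment> \<open>A function that is not integrable has integral 0 by default, so the nonzero
      second moment proves integrability.\<close>
    moreover have "integrable M (\<lambda>\<omega>. (U \<omega>)\<^sup>2)" using V s by (metis not_integrable_integral_eq power_not_zero less_irrefl)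
    ultimately show ?thesis by blast
  qed
  then show "integrable M (\<lambda>\<omega>. (U \<omega>)\<^sup>2)"
    and "(CLINT \<omega>|M. iexp (U \<omega>)) = complex_of_real (exp (- (LINT \<omega>|M. (U \<omega>)\<^sup>2) / 2))" by auto
qed

lemma integrable_mult_of_squares:
  fixes f g :: "'a \<Rightarrow> real"
  assumes "f \<in> borel_measurable M" "g \<in> borel_measurable M"
    and "integrable M (\<lambda>\<omega>. (f \<omega>)\<^sup>2)" "integrable M (\<lambda>\<omega>. (g \<omega>)\<^sup>2)"
  shows "integrable M (\<lambda>\<omega>. f \<omega> * g \<omega>)"
proof (rule Bochner_Integration.integrable_bound)
  show "integrable M (\<lambda>\<omega>. (f \<omega>)\<^sup>2 + (g \<omega>)\<^sup>2)" using assms by simp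
  show "(\<lambda>\<omega>. f \<omega> * g \<omega>) \<in> borel_measurable M" using assms(1,2) by simp
  have "\<bar>x * y\<bar> \<le> x\<^sup>2 + y\<^sup>2" for x y :: real

    using sum_squares_bound[of "\<bar>x\<bar>" "\<bar>y\<bar>"] mult_nonneg_nonneg[of "\<bar>x\<bar>" "\<bar>y\<bar>"]
    unfolding abs_mult power2_abs by linarith
  then show "AE \<omega> in M. norm (f \<omega> * g \<omega>) \<le> norm ((f \<omega>)\<^sup>2 + (g \<omega>)\<^sup>2)" by (intro AE_I2) simp
qed

lemma gvec_gaussian_process:
  assumes "prob_space M" and X: "gaussian_process M X" and c: "centered M X"
  shows "gvec M (\<lambda>i. X (t i)) n (\<lambda>i j. LINT \<omega>|M. X (t i) \<omega> * X (t j) \<omega>)"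
    and "\<And>s u. integrable M (\<lambda>\<omega>. X s \<omega> * X u \<omega>)"
proof -
  interpret prob_space M by fact
  have m[measurable]: "X s \<in> borel_measurable M" for s using X by (simp add: gaussian_process_def)
  have iX: "integrable M (X s)" "expectation (X s) = 0" for s using c by (auto simp: centered_def)
  have gr: "gaussian_rv M (\<lambda>\<omega>. \<Sum>s\<in>J. d s * X s \<omega>)" if "finite J" for J d
    using X that by (auto simp: gaussian_process_def)
  have "gaussian_rv M (X s)" for s using gr[of "{s}" "\<lambda>_. 1"] by simp
  then have sq: "integrable M (\<lambda>\<omega>. (X s \<omega>)\<^sup>2)" for s
    using gaussian_rv_char(1)[OF prob_space_axioms] iX by blast
  show ij: "integrable M (\<lambda>\<omega>. X s \<omega> * X u \<omega>)" for s u
    by (intro integrable_mult_of_squares m sq)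
  have "(CLINT \<omega>|M. iexp (lincomb n c (\<lambda>i. X (t i) \<omega>))) =
    complex_of_real (exp (- qform n (\<lambda>i j. LINT \<omega>|M. X (t i) \<omega> * X (t j) \<omega>) c / 2))" for c
  proof -
    let ?U = "\<lambda>\<omega>. lincomb n c (\<lambda>i. X (t i) \<omega>)"
    \<comment> \<open>The times \<open>t i\<close> may coincide, whereas a Gaussian process is
      tested on finite sets of times; coefficients of equal times are therefore collected.\<close>
    have "?U \<omega> = (\<Sum>s\<in>t ` {..<n}. (\<Sum>i\<in>{i. i \<in> {..<n} \<and> t i = s}. c i) * X s \<omega>)" for \<omega>
      unfolding lincomb_def
      by (subst sum.image_gen[of _ _ t]) (auto simp: sum_distrib_right intro!: sum.cong)
    then have U: "gaussian_rv M ?U" using gr[of "t ` {..<n}"] by simp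
    have U0: "expectation ?U = 0" unfolding lincomb_def using iX by simp
    have "(?U \<omega>)\<^sup>2 = (\<Sum>i<n. \<Sum>j<n. c i * c j * (X (t i) \<omega> * X (t j) \<omega>))" for \<omega>
      unfolding lincomb_def power2_eq_square sum_product by (simp add: mult_ac)
    then have "expectation (\<lambda>\<omega>. (?U \<omega>)\<^sup>2) = qform n (\<lambda>i j. LINT \<omega>|M. X (t i) \<omega> * X (t j) \<omega>) c"
      unfolding qform_def using ij by simp
    with gaussian_rv_char(2)[OF prob_space_axioms U U0] show ?thesis by simp
  qed
  then show "gvec M (\<lambda>i. X (t i)) n (\<lambda>i j. LINT \<omega>|M. X (t i) \<omega> * X (t j) \<omega>)"
    using prob_space_axioms by (simp add: gvec_def)
qed

lemma expectation_fdd: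
  fixes h :: "(real \<Rightarrow> real) \<Rightarrow> real"
  assumes "\<And>t. X t \<in> borel_measurable M" and [measurable]: "h \<in> borel_measurable (\<Pi>\<^sub>M t\<in>J. borel)"
  shows "integral\<^sup>L (fdd M X J) h = (LINT \<omega>|M. h (\<lambda>t\<in>J. X t \<omega>))"
  unfolding fdd_def using assms(1) by (subst integral_distr) (auto intro!: measurable_restrict)

text \<open>The finite-dimensional laws at the times \<open>0\<close> and \<open>t - s\<close>,
  shifted by \<open>s\<close> and unshifted, are tested with the product of the two
  coordinates.\<close>

lemma stationary_covariance:
  assumes X: "\<And>t. X t \<in> borel_measurable M" and st: "stationary M X"
  shows "(LINT \<omega>|M. X s \<omega> * X t \<omega>) = (LINT \<omega>|M. X 0 \<omega> * X (t - s) \<omega>)"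
proof -
  let ?J = "{0, t - s}" and ?h = "\<lambda>f :: real \<Rightarrow> real. f 0 * f (t - s)"
  have [measurable]: "?h \<in> borel_measurable (\<Pi>\<^sub>M t\<in>?J. borel)" by measurable
  have "integral\<^sup>L (fdd M (\<lambda>u. X (u + s)) ?J) ?h = integral\<^sup>L (fdd M X ?J) ?h"
    using st by (simp add: stationary_def)
  then show ?thesis by (subst (asm) (1 2) expectation_fdd) (simp_all add: X)
qed

lemma stationary_increments_variogram:
  assumes X: "\<And>t. X t \<in> borel_measurable M" and st: "stationary_increments M X"
  shows "(LINT \<omega>|M. (X t \<omega> - X s \<omega>)\<^sup>2) = 2 * variogram M X (t - s)"
proof -
  let ?J = "{t - s}" and ?h = "\<lambda>f :: real \<Rightarrow> real. (f (t - s))\<^sup>2"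
  have [measurable]: "?h \<in> borel_measurable (\<Pi>\<^sub>M t\<in>?J. borel)" by measurable
  have "integral\<^sup>L (fdd M (\<lambda>u \<omega>. X (u + s) \<omega> - X s \<omega>) ?J) ?h = integral\<^sup>L (fdd M (\<lambda>u \<omega>. X u \<omega> - X 0 \<omega>) ?J) ?h"
    using st by (simp add: stationary_increments_def)
  then show ?thesis unfolding variogram_def
    by (subst (asm) (1 2) expectation_fdd) (simp_all add: X borel_measurable_diff)
qed

text \<open>The covariance of a process that starts at 0 and whose increments over length
  \<open>h\<close> have variance \<open>w h\<close>.\<close>

definition polar :: "(real \<Rightarrow> real) \<Rightarrow> real \<Rightarrow> real \<Rightarrow> real" where
  "polar w s t = (w s + w t - w \<bar>s - t\<bar>) / 2"

lemma polar_commute: "polar w s t = polar w t s"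
  by (simp add: polar_def abs_minus_commute)

lemma polar_increment: "w 0 = 0 \<Longrightarrow> polar w s s + polar w t t - 2 * polar w s t = w \<bar>s - t\<bar>"
  by (simp add: polar_def field_simps)

section \<open>Finite-dimensional laws of Brownian motion\<close>

lemma qform_diag: "qform m (\<lambda>k l. if k = l then d l else 0) a = (\<Sum>l<m. (a l)\<^sup>2 * d l)"
  unfolding qform_def by (intro sum.cong refl)
    (simp add: power2_eq_square if_distrib[of "\<lambda>x. _ * x"] cong: if_cong)

lemma gvec_increments:
  assumes M: "prob_space M" and B: "standard_brownian_motion M B" and s: "strict_mono_on {..m} s"
  shows "gvec M (\<lambda>l \<omega>. B (s (Suc l)) \<omega> - B (s l) \<omega>) m (\<lambda>k l. if k = l then s (Suc l) - s l else 0)"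
proof -
  interpret prob_space M by fact
  have [measurable]: "B t \<in> borel_measurable M" for t
    using B by (simp add: standard_brownian_motion_def)
  let ?D = "\<lambda>l \<omega>. B (s (Suc l)) \<omega> - B (s l) \<omega>"
  have ind: "indep_vars (\<lambda>_. borel) ?D {..<m}"
    using B s by (auto simp: standard_brownian_motion_def)
  have one: "(CLINT \<omega>|M. iexp (c * ?D l \<omega>)) = complex_of_real (exp (- (c\<^sup>2 * (s (Suc l) - s l)) / 2))"
    if l: "l < m" for l c
  proof -
    have lt: "s l < s (Suc l)" using s l by (auto simp: strict_mono_on_def)
    then have "distributed M lborel (?D l) (normal_density 0 (sqrt (s (Suc l) - s l)))"
      using B by (simp add: standard_brownian_motion_def)
    from normal_iexp[OF _ this M, of c] lt show ?thesis by (simp add: power_mult_distrib)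
  qed
  have "(CLINT \<omega>|M. iexp (lincomb m c (\<lambda>l. ?D l \<omega>))) =
    complex_of_real (exp (- qform m (\<lambda>k l. if k = l then s (Suc l) - s l else 0) c / 2))" for c
  proof -
    have ind': "indep_vars (\<lambda>_. borel) (\<lambda>l \<omega>. c l * ?D l \<omega>) {..<m}"
      by (rule indep_vars_compose2[OF ind]) simp
    have "(CLINT \<omega>|M. iexp (lincomb m c (\<lambda>l. ?D l \<omega>))) = char (distr M borel (\<lambda>\<omega>. \<Sum>l<m. c l * ?D l \<omega>)) 1"
      unfolding lincomb_def by (subst char_distr_1) simp_all
    also have "\<dots> = (\<Prod>l<m. char (distr M borel (\<lambda>\<omega>. c l * ?D l \<omega>)) 1)"
      by (rule char_distr_sum[OF ind'])
    also have "\<dots> = (\<Prod>l<m. complex_of_real (exp (- ((c l)\<^sup>2 * (s (Suc l) - s l)) / 2)))"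
      by (intro prod.cong refl) (subst char_distr_1, simp_all add: one del: of_real_diff of_real_mult)
    also have "\<dots> = complex_of_real (exp (- (\<Sum>l<m. (c l)\<^sup>2 * (s (Suc l) - s l)) / 2))"
      by (simp only: of_real_prod[symmetric] exp_sum[symmetric] finite_lessThan sum_negf sum_divide_distrib[symmetric])
    finally show ?thesis unfolding qform_diag .
  qed
  then show ?thesis using M by (simp add: gvec_def)
qed

text \<open>Independence of increments is available only along strictly increasing times, while the
  \<open>t i\<close> are unsorted and possibly repeated. They are sorted without repetition, and
  each \<open>B (t i)\<close> is recovered as a sum of increments from 0, up to the null set where
  \<open>B 0\<close> differs from 0.\<close>

lemma brownian_gvec:
  assumes M: "prob_space M" and B: "standard_brownian_motion M B" and t: "\<And>i. i < n \<Longrightarrow> 0 \<le> t i"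
  shows "gvec M (\<lambda>i. B (t i)) n (\<lambda>i j. polar (\<lambda>h. h) (t i) (t j))"
proof -
  \<comment> \<open>Time 0 is inserted as the common starting point of all sums.\<close>
  define F where "F = insert 0 (t ` {..<n})"
  define xs where "xs = sorted_list_of_set F"
  define m where "m = length xs - 1"
  define s where "s k = xs ! k" for k
  have F: "finite F" "0 \<in> F" by (auto simp: F_def)
  have F3: "set xs = F" unfolding xs_def by (rule set_sorted_list_of_set[OF F(1)])
  with F(2) have len: "length xs = Suc m" by (cases xs) (auto simp: m_def)
  have "sorted_wrt (<) xs" by (simp add: xs_def)
  then have sm: "strict_mono_on {..m} s"
    by (auto simp: strict_mono_on_def s_def len sorted_wrt_nth_less)
  have idx: "\<exists>k\<le>m. s k = x" if "x \<in> F" for x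
    using that F3 len by (metis in_set_conv_nth less_Suc_eq_le s_def)
  have s0: "s 0 = 0"
  proof -
    obtain k where k: "k \<le> m" "s k = 0" using idx[OF F(2)] by blast
    have "s 0 \<in> F" using F3 len nth_mem[of 0 xs] by (simp add: s_def)
    then have "0 \<le> s 0" using t by (auto simp: F_def)
    moreover have "s 0 \<le> s k" using sm k(1) by (cases "k = 0") (auto simp: strict_mono_on_def less_imp_le)
    ultimately show ?thesis using k by simp
  qed
  have "\<exists>k. k \<le> m \<and> s k = t i" if "i < n" for i using idx[of "t i"] that by (auto simp: F_def)
  then obtain k where k: "\<And>i. i < n \<Longrightarrow> k i \<le> m \<and> s (k i) = t i" by metis
  define A where "A i l = (if l < k i then 1 else 0 :: real)" for i l :: nat
  let ?D = "\<lambda>k l. if k = l then s (Suc l) - s l else 0"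
  have sumA: "(\<Sum>l<m. A i l * (h (Suc l) - h l)) = h (k i) - h 0" if "i < n" for i and h :: "nat \<Rightarrow> real"
  proof -
    have "(\<Sum>l<m. A i l * (h (Suc l) - h l)) = (\<Sum>l<k i. h (Suc l) - h l)"
      using k[OF that] by (intro sum.mono_neutral_cong_right) (auto simp: A_def)
    then show ?thesis by (simp add: sum_lessThan_telescope)
  qed
  have qA: "qform m ?D (A i) = t i" if "i < n" for i

  proof -
    have "(A i l)\<^sup>2 = A i l" for l by (simp add: A_def)
    then show ?thesis using sumA[OF that, of s] k[OF that] s0 by (simp add: qform_diag)
  qed
  have qAA: "qform m ?D (\<lambda>l. A i l - A j l) = \<bar>t i - t j\<bar>" if ij: "i < n" "j < n" for i j
  proof -
    have main: "qform m ?D (\<lambda>l. A i l - A j l) = t j - t i \<and> qform m ?D (\<lambda>l. A j l - A i l) = t j - t i \<and> t i \<le> t j"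
      if ij: "i < n" "j < n" and le: "k i \<le> k j" for i j
    proof -
      \<comment> \<open>The rows of \<open>A\<close> are nested indicators of initial segments, so
        squaring their difference only fixes the sign.\<close>
      have 1: "(A i l - A j l)\<^sup>2 = A j l - A i l" "(A j l - A i l)\<^sup>2 = A j l - A i l" for l
        using le by (auto simp: A_def)
      have "(\<Sum>l<m. (A j l - A i l) * (s (Suc l) - s l)) = t j - t i"
        using sumA[OF ij(1), of s] sumA[OF ij(2), of s] k[OF ij(1)] k[OF ij(2)]
        by (simp add: left_diff_distrib sum_subtractf)
      moreover have "t i \<le> t j"
        using sm k[OF ij(1)] k[OF ij(2)] le unfolding strict_mono_on_def
        by (metis atMost_iff le_less order_refl)
      ultimately show ?thesis by (simp add: qform_diag 1)
    qed
    show ?thesis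
    proof (cases "k i \<le> k j")
      case True then show ?thesis using main[OF ij True] by simp
    next
      case False then have "k j \<le> k i" by simp
      then show ?thesis using main[OF ij(2,1)] by simp
    qed
  qed
  have "gvec M (\<lambda>i \<omega>. lincomb m (A i) (\<lambda>l. B (s (Suc l)) \<omega> - B (s l) \<omega>)) n
    (\<lambda>i j. (qform m ?D (A i) + qform m ?D (A j) - qform m ?D (\<lambda>l. A i l - A j l)) / 2)"
    by (rule gvec_linear[OF gvec_increments[OF M B sm]]) auto
  then have "gvec M (\<lambda>i \<omega>. lincomb m (A i) (\<lambda>l. B (s (Suc l)) \<omega> - B (s l) \<omega>)) n
    (\<lambda>i j. polar (\<lambda>h. h) (t i) (t j))"
    by (rule gvec_cong) (simp add: qA qAA polar_def)
  then show ?thesis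
  proof (rule gvec_AE_cong)
    show "B (t i) \<in> borel_measurable M" for i using B by (simp add: standard_brownian_motion_def)
    fix i assume i: "i < n"
    have "AE \<omega> in M. B 0 \<omega> = 0" using B by (simp add: standard_brownian_motion_def)
    then show "AE \<omega> in M. lincomb m (A i) (\<lambda>l. B (s (Suc l)) \<omega> - B (s l) \<omega>) = B (t i) \<omega>"
    proof eventually_elim
      fix \<omega> assume "B 0 \<omega> = 0"
      then show "lincomb m (A i) (\<lambda>l. B (s (Suc l)) \<omega> - B (s l) \<omega>) = B (t i) \<omega>"
        using sumA[OF i, of "\<lambda>l. B (s l) \<omega>"] k[OF i] s0 by (simp add: lincomb_def)
    qed
  qed
qed

section \<open>Riemann sums and the integrated process\<close>

lemma riemann_cell_bound:
  fixes f :: "real \<Rightarrow> real"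
  assumes f: "continuous_on UNIV f" and h: "0 \<le> h"
    and e: "\<And>x y. x \<in> {0..b} \<Longrightarrow> y \<in> {0..b} \<Longrightarrow> \<bar>x - y\<bar> \<le> h \<Longrightarrow> \<bar>f x - f y\<bar> \<le> e"
  shows "real D * h \<le> b \<Longrightarrow> \<bar>h * (\<Sum>k<D. f (real k * h)) - integral {0..real D * h} f\<bar> \<le> real D * h * e"
proof (induction D)
  case (Suc D)
  let ?p = "real D * h" and ?q = "real (Suc D) * h"
  have pq: "0 \<le> ?p" "?p \<le> ?q" "?q = ?p + h" using h by (auto simp: algebra_simps)
  have int: "f integrable_on {x..y}" for x y
    using f by (intro integrable_continuous_interval continuous_on_subset[OF f]) auto
  have comb: "integral {0..?q} f = integral {0..?p} f + integral {?p..?q} f"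
    using pq int by (intro Henstock_Kurzweil_Integration.integral_combine[symmetric]) auto
  have b: "\<bar>f x - f ?p\<bar> \<le> e" if "x \<in> {?p..?q}" for x
    using that pq Suc.prems by (intro e) (auto intro: order_trans[OF pq(1)])
  have "integral {?p..?q} f \<le> integral {?p..?q} (\<lambda>_. f ?p + e)"
    using b by (intro integral_le int integrable_const_ivl) (fastforce simp: abs_le_iff)+
  moreover have "integral {?p..?q} (\<lambda>_. f ?p - e) \<le> integral {?p..?q} f"
    using b by (intro integral_le int integrable_const_ivl) (fastforce simp: abs_le_iff)+
  ultimately have "\<bar>h * f ?p - integral {?p..?q} f\<bar> \<le> h * e"
    using pq h by (simp add: algebra_simps abs_le_iff)
  moreover have "\<bar>h * (\<Sum>k<D. f (real k * h)) - integral {0..?p} f\<bar> \<le> ?p * e"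
    using Suc pq by auto
  moreover have "?q * e = ?p * e + h * e" by (simp add: algebra_simps)
  moreover have "h * (\<Sum>k<Suc D. f (real k * h)) = h * (\<Sum>k<D. f (real k * h)) + h * f ?p"
    by (simp add: distrib_left)
  ultimately show ?case unfolding comb by linarith
qed simp

text \<open>The mesh \<open>1 / Suc N\<close> does not depend on the endpoint, so that one grid
  serves several times at once; the price is a last grid point that only converges to
  \<open>\<tau>\<close>. Uniform continuity controls the cells, and continuity of the indefinite
  integral the endpoint.\<close>

lemma riemann_sum_limit:
  fixes f :: "real \<Rightarrow> real"
  assumes f: "continuous_on UNIV f" and D: "(\<lambda>N. real (D N) * (1 / real (Suc N))) \<longlonglongrightarrow> \<tau>"
  shows "(\<lambda>N. 1 / real (Suc N) * (\<Sum>k<D N. f (real k * (1 / real (Suc N))))) \<longlonglongrightarrow> integral {0..\<tau>} f"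
proof -
  let ?h = "\<lambda>N. 1 / real (Suc N)"
  let ?x = "\<lambda>N. real (D N) * ?h N"
  define b where "b = \<bar>\<tau>\<bar> + 1"
  have b: "0 < b" "\<tau> < b" by (auto simp: b_def)
  have \<tau>0: "0 \<le> \<tau>" by (rule LIMSEQ_le_const[OF D]) auto
  have evb: "\<forall>\<^sub>F N in sequentially. ?x N \<le> b"
    using order_tendstoD(2)[OF D b(2)] by (auto elim: eventually_mono)
  have "(\<lambda>N. ?h N * (\<Sum>k<D N. f (real k * ?h N)) - integral {0..?x N} f) \<longlonglongrightarrow> 0"
  proof (rule tendstoI)
    fix e :: real assume e: "0 < e"
    define e' where "e' = e / (2 * b)"
    have e': "0 < e'" using e b by (simp add: e'_def)
    have "uniformly_continuous_on {0..b} f"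
      by (intro compact_uniformly_continuous continuous_on_subset[OF f]) auto
    from uniformly_continuous_onE[OF this e'] obtain d where d: "0 < d"
      "\<And>x y. x \<in> {0..b} \<Longrightarrow> y \<in> {0..b} \<Longrightarrow> dist y x < d \<Longrightarrow> dist (f y) (f x) < e'" by metis
    have "\<forall>\<^sub>F N in sequentially. ?h N < d"
      using order_tendstoD(2)[OF LIMSEQ_inverse_real_of_nat d(1)] by (simp add: inverse_eq_divide)
    with evb show "\<forall>\<^sub>F N in sequentially. dist (?h N * (\<Sum>k<D N. f (real k * ?h N)) - integral {0..?x N} f) 0 < e"
    proof eventually_elim
      case (elim N)
      have "\<bar>?h N * (\<Sum>k<D N. f (real k * ?h N)) - integral {0..?x N} f\<bar> \<le> ?x N * e'"
      proof (rule riemann_cell_bound[OF f _ _ elim(1)])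
        show "\<bar>f x - f y\<bar> \<le> e'" if "x \<in> {0..b}" "y \<in> {0..b}" "\<bar>x - y\<bar> \<le> ?h N" for x y
          using d(2)[OF that(2,1)] that(3) elim(2) by (simp add: dist_real_def)
      qed simp
      also have "\<dots> \<le> b * e'" using elim(1) e' by (intro mult_right_mono) auto
      also have "\<dots> < e" using b e by (simp add: e'_def)
      finally show ?case by simp
    qed
  qed
  moreover have "(\<lambda>N. integral {0..?x N} f) \<longlonglongrightarrow> integral {0..\<tau>} f"
  proof -
    have c: "continuous_on {0..b} (\<lambda>x. integral {0..x} f)"
      by (intro indefinite_integral_continuous_1 integrable_continuous_interval continuous_on_subset[OF f]) auto
    have ev: "\<forall>\<^sub>F N in sequentially. ?x N \<in> {0..b}" using evb by eventually_elim auto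
    have "\<tau> \<in> {0..b}" using \<tau>0 b by simp
    from continuous_on_tendsto_compose[OF c D this ev] show ?thesis .
  qed
  ultimately have "(\<lambda>N. (?h N * (\<Sum>k<D N. f (real k * ?h N)) - integral {0..?x N} f) + integral {0..?x N} f)
    \<longlonglongrightarrow> 0 + integral {0..\<tau>} f" by (rule tendsto_add)
  then show ?thesis by simp
qed

text \<open>The variance of the Riemann sum \<open>h * (\<Sum>k<D. Z (k * h))\<close> of a stationary process.\<close>

lemma double_to_single_sum:
  fixes R :: "real \<Rightarrow> real"
  assumes even: "\<And>x. R (- x) = R x"
  shows "(\<Sum>k<D. \<Sum>l<D. R (real k * h - real l * h)) =
    2 * (\<Sum>d<D. (real D - real d) * R (real d * h)) - real D * R 0"
proof (induction D)
  case (Suc D)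
  have rev: "(\<Sum>k<D. R (real k * h - real D * h)) = (\<Sum>d<D. R (real (Suc d) * h))"
  proof -
    have "(\<Sum>k<D. R (real k * h - real D * h)) = (\<Sum>k<D. R (real (D - Suc k) * h - real D * h))"
      by (rule sum.nat_diff_reindex[symmetric])
    also have "\<dots> = (\<Sum>d<D. R (real (Suc d) * h))"
    proof (rule sum.cong[OF refl])
      fix k assume "k \<in> {..<D}"
      then have "real (D - Suc k) * h - real D * h = - (real (Suc k) * h)"
        by (simp add: of_nat_diff algebra_simps)
      then show "R (real (D - Suc k) * h - real D * h) = R (real (Suc k) * h)" by (simp only: even)
    qed
    finally show ?thesis .
  qed
  have rev': "(\<Sum>l<D. R (real D * h - real l * h)) = (\<Sum>k<D. R (real k * h - real D * h))"
    by (intro sum.cong refl) (metis even minus_diff_eq)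
  have tele: "(\<Sum>d<D. R (real (Suc d) * h)) + R 0 = (\<Sum>d<D. R (real d * h)) + R (real D * h)"
    using sum.lessThan_Suc_shift[of "\<lambda>d. R (real d * h)" D] by simp
  have "(\<Sum>k<Suc D. \<Sum>l<Suc D. R (real k * h - real l * h)) =
    (\<Sum>k<D. \<Sum>l<D. R (real k * h - real l * h)) + (\<Sum>k<D. R (real k * h - real D * h))
      + (\<Sum>l<D. R (real D * h - real l * h)) + R 0"
    by (simp add: sum.distrib)
  also have "\<dots> = 2 * (\<Sum>d<D. (real D - real d) * R (real d * h)) - real D * R 0 + 2 * (\<Sum>d<D. R (real (Suc d) * h)) + R 0"
    by (simp only: Suc.IH rev rev')
  also have "\<dots> = 2 * (\<Sum>d<Suc D. (real (Suc D) - real d) * R (real d * h)) - real (Suc D) * R 0"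
  proof -
    have "(\<Sum>d<D. (real (Suc D) - real d) * R (real d * h)) =
      (\<Sum>d<D. (real D - real d) * R (real d * h)) + (\<Sum>d<D. R (real d * h))"
      by (simp add: sum.distrib[symmetric] algebra_simps)
    then show ?thesis using tele by (simp add: algebra_simps)
  qed
  finally show ?case .
qed simp

text \<open>Grouping the double sum by differences leaves two single Riemann sums and a diagonal
  correction with one more factor of the mesh, which vanishes. The limit is twice the integral of
  \<open>(\<tau> - u) * R u\<close> over \<open>[0, \<tau>]\<close>, the variance of the integral of
  \<open>Z\<close> up to \<open>\<tau>\<close>.\<close>

lemma riemann_variance_limit:
  fixes R :: "real \<Rightarrow> real"
  assumes R: "continuous_on UNIV R" "\<And>x. R (- x) = R x"
    and D: "(\<lambda>N. real (D N) * (1 / real (Suc N))) \<longlonglongrightarrow> \<tau>"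
  shows "(\<lambda>N. (1 / real (Suc N))\<^sup>2 * (\<Sum>k<D N. \<Sum>l<D N. R (real k * (1 / real (Suc N)) - real l * (1 / real (Suc N)))))
    \<longlonglongrightarrow> 2 * (\<tau> * integral {0..\<tau>} R - integral {0..\<tau>} (\<lambda>u. u * R u))"
proof -
  let ?h = "\<lambda>N. 1 / real (Suc N)"
  have eq: "(?h N)\<^sup>2 * (\<Sum>k<D N. \<Sum>l<D N. R (real k * ?h N - real l * ?h N)) =
    2 * ((real (D N) * ?h N) * (?h N * (\<Sum>d<D N. R (real d * ?h N)))
      - ?h N * (\<Sum>d<D N. (real d * ?h N) * R (real d * ?h N))) - ?h N * (real (D N) * ?h N) * R 0" for N
  proof -
    have alg: "h\<^sup>2 * (2 * (x * S1 - S2) - x * r) = 2 * ((x * h) * (h * S1) - h * (h * S2)) - h * (x * h) * r" for h x S1 S2 r :: real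
      by (simp add: power2_eq_square algebra_simps)
    have "(\<Sum>d<D N. (real (D N) - real d) * R (real d * ?h N)) =
      real (D N) * (\<Sum>d<D N. R (real d * ?h N)) - (\<Sum>d<D N. real d * R (real d * ?h N))"
      by (simp add: left_diff_distrib sum_subtractf sum_distrib_left)
    moreover have "(\<Sum>d<D N. (real d * ?h N) * R (real d * ?h N)) = ?h N * (\<Sum>d<D N. real d * R (real d * ?h N))"
      by (simp add: sum_distrib_left mult_ac)
    ultimately show ?thesis unfolding double_to_single_sum[of R, OF R(2)] by (simp only: alg)
  qed
  have h0: "?h \<longlonglongrightarrow> 0" using LIMSEQ_inverse_real_of_nat by (simp add: inverse_eq_divide)
  have uR: "continuous_on UNIV (\<lambda>u. u * R u)" by (intro continuous_intros R)
  have "(\<lambda>N. 2 * ((real (D N) * ?h N) * (?h N * (\<Sum>d<D N. R (real d * ?h N)))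
      - ?h N * (\<Sum>d<D N. (real d * ?h N) * R (real d * ?h N))) - ?h N * (real (D N) * ?h N) * R 0)
    \<longlonglongrightarrow> 2 * (\<tau> * integral {0..\<tau>} R - integral {0..\<tau>} (\<lambda>u. u * R u)) - 0 * \<tau> * R 0"
    by (intro tendsto_intros D riemann_sum_limit[OF R(1) D] riemann_sum_limit[OF uR D] h0)
  then show ?thesis unfolding eq by simp
qed

lemma floor_grid_limit:
  assumes "0 \<le> t" shows "(\<lambda>N. real (nat \<lfloor>t * real (Suc N)\<rfloor>) * (1 / real (Suc N))) \<longlonglongrightarrow> t"
proof (rule tendsto_sandwich)
  have h0: "(\<lambda>N. 1 / real (Suc N)) \<longlonglongrightarrow> 0" using LIMSEQ_inverse_real_of_nat by (simp add: inverse_eq_divide)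
  show "(\<lambda>N. t - 1 / real (Suc N)) \<longlonglongrightarrow> t" using tendsto_diff[OF tendsto_const h0, of t] by simp
  show "\<forall>\<^sub>F N in sequentially. t - 1 / real (Suc N) \<le> real (nat \<lfloor>t * real (Suc N)\<rfloor>) * (1 / real (Suc N))"
  proof (intro always_eventually allI)
    fix N
    have "t * real (Suc N) - 1 \<le> real (nat \<lfloor>t * real (Suc N)\<rfloor>)" using assms by linarith
    from divide_right_mono[OF this, of "real (Suc N)"]
    show "t - 1 / real (Suc N) \<le> real (nat \<lfloor>t * real (Suc N)\<rfloor>) * (1 / real (Suc N))"
      by (simp add: diff_divide_distrib del: of_nat_Suc)
  qed
  show "\<forall>\<^sub>F N in sequentially. real (nat \<lfloor>t * real (Suc N)\<rfloor>) * (1 / real (Suc N)) \<le> t"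
  proof (intro always_eventually allI)
    fix N
    have "0 \<le> t * real (Suc N)" using assms by simp
    then have "real (nat \<lfloor>t * real (Suc N)\<rfloor>) \<le> t * real (Suc N)" by linarith
    from divide_right_mono[OF this, of "real (Suc N)"]
    show "real (nat \<lfloor>t * real (Suc N)\<rfloor>) * (1 / real (Suc N)) \<le> t" by (simp del: of_nat_Suc)
  qed
qed simp

text \<open>Riemann sums on a common mesh are linear images of Gaussian vectors. By stationarity the
  variance of a difference of two such sums depends only on the number of cells between the
  endpoints, so every entry of the covariance converges through
  \<open>riemann_variance_limit\<close>.\<close>

lemma integral_process_gvec:
  fixes R :: "real \<Rightarrow> real" and t :: "nat \<Rightarrow> real"
  assumes Z: "\<And>n (t :: nat \<Rightarrow> real). gvec M (\<lambda>i. Z (t i)) n (\<lambda>i j. R (t i - t j))"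
    and R: "continuous_on UNIV R" "\<And>x. R (- x) = R x"
    and cont: "\<And>\<omega>. \<omega> \<in> space M \<Longrightarrow> continuous_on UNIV (\<lambda>t. Z t \<omega>)"
    and t: "\<And>i. i < n \<Longrightarrow> 0 \<le> t i"
  defines "w \<equiv> \<lambda>\<tau>. 2 * (\<tau> * integral {0..\<tau>} R - integral {0..\<tau>} (\<lambda>u. u * R u))"
  shows "gvec M (\<lambda>i \<omega>. integral {0..t i} (\<lambda>s. Z s \<omega>)) n (\<lambda>i j. polar w (t i) (t j))"
proof -
  let ?h = "\<lambda>N. 1 / real (Suc N)"
  define D where "D N i = nat \<lfloor>t i * real (Suc N)\<rfloor>" for N i
  define K where "K N = (\<Sum>i<n. D N i)" for N
  define A where "A N i k = (if k < D N i then ?h N else 0)" for N i k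
  define W where "W N d = (?h N)\<^sup>2 * (\<Sum>k<d. \<Sum>l<d. R (real k * ?h N - real l * ?h N))" for N d
  let ?C = "\<lambda>N k l. R (real k * ?h N - real l * ?h N)"
  have DK: "D N i \<le> K N" if "i < n" for N i
    unfolding K_def using that by (intro member_le_sum) auto
  have Dlim: "(\<lambda>N. real (D N i) * ?h N) \<longlonglongrightarrow> t i" if "i < n" for i
    unfolding D_def by (rule floor_grid_limit[OF t[OF that]])
  have q: "qform (K N) (?C N) (\<lambda>k. if p \<le> k \<and> k < q then ?h N else 0) = W N (q - p)" if "q \<le> K N" for N p q
  proof -
    have red: "(\<Sum>k<K N. (if p \<le> k \<and> k < q then ?h N else 0) * f k) = ?h N * (\<Sum>k<q - p. f (p + k))" for f
    proof -
      have "(\<Sum>k<K N. (if p \<le> k \<and> k < q then ?h N else 0) * f k) = (\<Sum>k=p..<q. ?h N * f k)"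
        using that by (intro sum.mono_neutral_cong_right) auto
      also have "\<dots> = (\<Sum>k<q - p. ?h N * f (p + k))"
        by (subst sum.atLeastLessThan_shift_0) (simp add: atLeast0LessThan)
      finally show ?thesis by (simp only: sum_distrib_left)
    qed
    let ?I = "\<lambda>k. if p \<le> k \<and> k < q then ?h N else 0"
    have "qform (K N) (?C N) ?I = (\<Sum>k<K N. ?I k * (\<Sum>l<K N. ?I l * ?C N k l))"
      by (simp only: qform_def sum_distrib_left mult.assoc)
    also have "\<dots> = ?h N * (\<Sum>k<q - p. ?h N * (\<Sum>l<q - p. ?C N (p + k) (p + l)))"
      by (simp only: red)
    also have "\<dots> = W N (q - p)"
    proof -
      have "real (p + k) * ?h N - real (p + l) * ?h N = real k * ?h N - real l * ?h N" for k l
        by (simp add: add_divide_distrib)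
      then show ?thesis unfolding W_def by (simp only: sum_distrib_left[symmetric] power2_eq_square mult.assoc)
    qed
    finally show ?thesis .
  qed
  have qA: "qform (K N) (?C N) (A N i) = W N (D N i)" if "i < n" for N i
    using q[OF DK[OF that], of N 0] unfolding A_def by simp
  \<comment> \<open>Of the two truncated differences of natural numbers at least one is 0, so their
    sum is the distance of \<open>D N i\<close> and \<open>D N j\<close>.\<close>
  have qAA: "qform (K N) (?C N) (\<lambda>k. A N i k - A N j k) = W N (D N j - D N i + (D N i - D N j))"
    if ij: "i < n" "j < n" for N i j
  proof (cases "D N i \<le> D N j")
    case True
    have "qform (K N) (?C N) (\<lambda>k. A N i k - A N j k) = qform (K N) (?C N) (\<lambda>k. (-1) * (if D N i \<le> k \<and> k < D N j then ?h N else 0))"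
      using True by (intro arg_cong[where f = "qform (K N) (?C N)"]) (auto simp: A_def)
    then show ?thesis unfolding qform_coeff_scale using q[OF DK[OF ij(2)], of N "D N i"] True by simp
  next
    case False
    have "qform (K N) (?C N) (\<lambda>k. A N i k - A N j k) = qform (K N) (?C N) (\<lambda>k. if D N j \<le> k \<and> k < D N i then ?h N else 0)"
      using False by (intro arg_cong[where f = "qform (K N) (?C N)"]) (auto simp: A_def)
    then show ?thesis using q[OF DK[OF ij(1)], of N "D N j"] False by simp
  qed
  have Wlim: "(\<lambda>N. W N (d N)) \<longlonglongrightarrow> w \<tau>" if "(\<lambda>N. real (d N) * ?h N) \<longlonglongrightarrow> \<tau>" for d \<tau>
    unfolding W_def w_def by (rule riemann_variance_limit[OF R that])
  have Ddiff: "(\<lambda>N. real (D N j - D N i + (D N i - D N j)) * ?h N) \<longlonglongrightarrow> \<bar>t i - t j\<bar>" if "i < n" "j < n" for i j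
  proof -
    have "real (D N j - D N i + (D N i - D N j)) * ?h N = \<bar>real (D N i) * ?h N - real (D N j) * ?h N\<bar>" for N
    proof -
      have "real (D N j - D N i + (D N i - D N j)) = \<bar>real (D N i) - real (D N j)\<bar>" by linarith
      then show ?thesis by (simp only: left_diff_distrib[symmetric] abs_mult) simp
    qed
    then show ?thesis using tendsto_rabs[OF tendsto_diff[OF Dlim[OF that(1)] Dlim[OF that(2)]]] by simp
  qed
  have g: "gvec M (\<lambda>i \<omega>. lincomb (K N) (A N i) (\<lambda>k. Z (real k * ?h N) \<omega>)) n
    (\<lambda>i j. (qform (K N) (?C N) (A N i) + qform (K N) (?C N) (A N j) - qform (K N) (?C N) (\<lambda>k. A N i k - A N j k)) / 2)" for N
    by (rule gvec_linear[OF Z[of "\<lambda>k. real k * ?h N"]]) (metis R(2) minus_diff_eq)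
  show ?thesis
  proof (rule gvec_limit[OF g])
    fix i \<omega> assume i: "i < n" and \<omega>: "\<omega> \<in> space M"
    have "lincomb (K N) (A N i) (\<lambda>k. Z (real k * ?h N) \<omega>) = ?h N * (\<Sum>k<D N i. Z (real k * ?h N) \<omega>)" for N
      unfolding lincomb_def sum_distrib_left using DK[OF i]
      by (intro sum.mono_neutral_cong_right) (auto simp: A_def intro: less_le_trans)
    then show "(\<lambda>N. lincomb (K N) (A N i) (\<lambda>k. Z (real k * ?h N) \<omega>)) \<longlonglongrightarrow> integral {0..t i} (\<lambda>s. Z s \<omega>)"
      using riemann_sum_limit[OF cont[OF \<omega>] Dlim[OF i]] by simp
  next
    fix i j assume ij: "i < n" "j < n"
    show "(\<lambda>N. (qform (K N) (?C N) (A N i) + qform (K N) (?C N) (A N j) - qform (K N) (?C N) (\<lambda>k. A N i k - A N j k)) / 2)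
      \<longlonglongrightarrow> polar w (t i) (t j)"
      unfolding polar_def qA[OF ij(1)] qA[OF ij(2)] qAA[OF ij]
      by (intro tendsto_intros Wlim Dlim Ddiff ij) simp
  qed
qed

subsection \<open>The functional in the limit of dyadic grids\<close>

text \<open>The characteristic functions converge, and taking logarithms shows that the forms do. In
  this way path continuity yields continuity of variances and covariances.\<close>

lemma gvec_qform_limit:
  assumes X: "\<And>N. gvec M (X N) n (C N)" and Y: "gvec M Y n D"
    and lim: "\<And>i \<omega>. i < n \<Longrightarrow> \<omega> \<in> space M \<Longrightarrow> (\<lambda>N. X N i \<omega>) \<longlonglongrightarrow> Y i \<omega>"
  shows "(\<lambda>N. qform n (C N) c) \<longlonglongrightarrow> qform n D c"
proof -
  note char_lincomb_limit[of M n X, OF gvecD(1)[OF Y] gvecD(2)[OF X] lim, of c]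
  then have "(\<lambda>N. exp (- qform n (C N) c / 2)) \<longlonglongrightarrow> exp (- qform n D c / 2)"
    unfolding gvecD(3)[OF X] gvecD(3)[OF Y] tendsto_of_real_iff .
  from tendsto_ln[OF this] have "(\<lambda>N. - qform n (C N) c / 2) \<longlonglongrightarrow> - qform n D c / 2" by simp
  from tendsto_mult_left[OF this, of "-2"] show ?thesis by simp
qed

lemma Min_grid_tendsto:
  fixes F :: "real \<Rightarrow> real"
  assumes F: "continuous_on {0..T} F" and T: "0 < T"
  shows "(\<lambda>n. Min ((\<lambda>i. F (real i * T / 2 ^ n)) ` {..<2 ^ n + 1})) \<longlonglongrightarrow> (INF t\<in>{0..T}. F t)"
    and "\<exists>t\<in>{0..T}. (INF t\<in>{0..T}. F t) = F t"
proof -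
  have "compact {0..T}" "{0..T} \<noteq> {}" using T by auto
  from continuous_attains_inf[OF this F] obtain s where s: "s \<in> {0..T}" "\<And>t. t \<in> {0..T} \<Longrightarrow> F s \<le> F t"
    by blast
  have inf: "(INF t\<in>{0..T}. F t) = F s" using s by (intro cInf_eq_minimum) auto
  then show "\<exists>t\<in>{0..T}. (INF t\<in>{0..T}. F t) = F t" using s by blast
  let ?g = "\<lambda>n i. real i * T / 2 ^ n"
  have g: "?g n i \<in> {0..T}" if "i < 2 ^ n + 1" for n i
  proof -
    have "real i \<le> real (2 ^ n)" using that by (intro of_nat_mono) simp
    then show ?thesis using T by (simp add: field_simps)
  qed
  \<comment> \<open>The last grid point to the left of the minimiser \<open>s\<close>; it lies
    within one mesh width of \<open>s\<close>.\<close>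
  define k where "k n = nat \<lfloor>s / T * 2 ^ n\<rfloor>" for n
  have sT: "0 \<le> s / T" "s / T \<le> 1" using s T by auto
  have k: "k n < 2 ^ n + 1" for n
  proof -
    have "s / T * 2 ^ n \<le> 2 ^ n" using mult_right_mono[OF sT(2), of "2 ^ n"] by simp
    then have "\<lfloor>s / T * 2 ^ n\<rfloor> \<le> \<lfloor>2 ^ n :: real\<rfloor>" by (rule floor_mono)
    also have "\<lfloor>2 ^ n :: real\<rfloor> = 2 ^ n" by (metis floor_of_int of_int_numeral of_int_power)
    finally show ?thesis by (simp add: k_def nat_less_iff less_Suc_eq_le nat_le_iff)
  qed
  have near: "\<bar>?g n (k n) - s\<bar> \<le> T * (1 / 2) ^ n" for n
  proof -
    have "0 \<le> s / T * 2 ^ n" by (intro mult_nonneg_nonneg sT) simp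
    then have "\<bar>real (k n) - s / T * 2 ^ n\<bar> \<le> 1" unfolding k_def by linarith
    then have le: "\<bar>real (k n) - s / T * 2 ^ n\<bar> * (T / 2 ^ n) \<le> 1 * (T / 2 ^ n)"
      using T by (intro mult_right_mono) auto
    have eq: "?g n (k n) - s = (real (k n) - s / T * 2 ^ n) * (T / 2 ^ n)" using T by (simp add: field_simps)
    have "\<bar>T / 2 ^ n\<bar> = T / 2 ^ n" "T * (1 / 2) ^ n = 1 * (T / 2 ^ n)" using T by (simp_all add: power_divide)
    then show ?thesis unfolding eq abs_mult using le by (simp only:)
  qed
  have "(\<lambda>n. T * (1 / 2) ^ n) \<longlonglongrightarrow> T * 0" by (intro tendsto_intros LIMSEQ_power_zero) simp
  then have "(\<lambda>n. ?g n (k n) - s) \<longlonglongrightarrow> 0"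
    by (intro Lim_null_comparison[of "\<lambda>n. ?g n (k n) - s" "\<lambda>n. T * (1 / 2) ^ n"]) (use near in auto)
  then have gs: "(\<lambda>n. ?g n (k n)) \<longlonglongrightarrow> s" using LIM_zero_iff by blast
  have ev: "\<forall>\<^sub>F n in sequentially. ?g n (k n) \<in> {0..T}" using g[OF k] by simp
  have up: "(\<lambda>n. F (?g n (k n))) \<longlonglongrightarrow> F s" by (rule continuous_on_tendsto_compose[OF F gs s(1) ev])
  show "(\<lambda>n. Min ((\<lambda>i. F (?g n i)) ` {..<2 ^ n + 1})) \<longlonglongrightarrow> (INF t\<in>{0..T}. F t)"
    unfolding inf
  proof (rule tendsto_sandwich[OF _ _ tendsto_const up])
    show "\<forall>\<^sub>F n in sequentially. F s \<le> Min ((\<lambda>i. F (?g n i)) ` {..<2 ^ n + 1})"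
      using s(2) g by (intro always_eventually allI) (subst Min_ge_iff, auto)
    show "\<forall>\<^sub>F n in sequentially. Min ((\<lambda>i. F (?g n i)) ` {..<2 ^ n + 1}) \<le> F (?g n (k n))"
      using k by (intro always_eventually allI Min_le) auto
  qed
qed

text \<open>Paths and variances are continuous, so the grid minima converge pointwise to the
  infimum. Every grid contains 0, hence the value at 0 is an integrable majorant. Positivity holds
  because the infimum is attained.\<close>

lemma G_limit:
  fixes V :: "real \<Rightarrow> 'a \<Rightarrow> real"
  assumes T: "0 < T"
    and V: "\<And>n (t :: nat \<Rightarrow> real). (\<And>i. i < n \<Longrightarrow> 0 \<le> t i) \<Longrightarrow> gvec M (\<lambda>i. V (t i)) n (\<lambda>i j. C (t i) (t j))"
    and sym: "\<And>s t. C s t = C t s"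
    and cont: "\<And>\<omega>. \<omega> \<in> space M \<Longrightarrow> continuous_on {0..T} (\<lambda>t. V t \<omega>)"
  shows "(\<lambda>n. \<phi> (2 ^ n + 1) (\<lambda>i j. C (real i * T / 2 ^ n) (real j * T / 2 ^ n))) \<longlonglongrightarrow> \<G> M V T"
    and "0 < \<G> M V T"
proof -
  have V1: "gvec M (\<lambda>_. V t) 1 (\<lambda>_ _. C t t)" if "0 \<le> t" for t
    using V[of 1 "\<lambda>_. t"] that by simp
  interpret prob_space M by (rule gvecD[OF V1[of 0]]) simp
  have m[measurable]: "V t \<in> borel_measurable M" if "0 \<le> t" for t using gvecD(2)[OF V1[OF that]] by simp
  have var: "variance (V t) = C t t" if "0 \<le> t" for t using gvec_moments(2)[OF V1[OF that]] by simp
  have contC: "continuous_on {0..T} (\<lambda>t. C t t)"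
    unfolding continuous_on_sequentially o_def
  proof (intro allI ballI impI, elim conjE)
    fix x :: "nat \<Rightarrow> real" and a assume a: "a \<in> {0..T}" and x: "\<forall>n. x n \<in> {0..T}" "x \<longlonglongrightarrow> a"
    have "(\<lambda>N. qform 1 (\<lambda>_ _. C (x N) (x N)) (\<lambda>_. 1)) \<longlonglongrightarrow> qform 1 (\<lambda>_ _. C a a) (\<lambda>_. 1)"
    proof (rule gvec_qform_limit)
      show "gvec M (\<lambda>_. V (x N)) 1 (\<lambda>_ _. C (x N) (x N))" for N using x by (intro V1) auto
      show "gvec M (\<lambda>_. V a) 1 (\<lambda>_ _. C a a)" using a by (intro V1) auto
      show "(\<lambda>N. V (x N) \<omega>) \<longlonglongrightarrow> V a \<omega>" if "\<omega> \<in> space M" for \<omega>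
        using cont[OF that] a x by (auto simp: continuous_on_sequentially o_def)
    qed
    then show "(\<lambda>n. C (x n) (x n)) \<longlonglongrightarrow> C a a" by (simp add: qform_def)
  qed
  define F where "F \<omega> t = exp (sqrt 2 * V t \<omega> - C t t)" for \<omega> t
  have contF: "continuous_on {0..T} (F \<omega>)" if "\<omega> \<in> space M" for \<omega>
    unfolding F_def by (intro continuous_intros cont[OF that] contC)
  let ?g = "\<lambda>n i. real i * T / 2 ^ n"
  have g: "gvec M (\<lambda>i. V (?g n i)) (2 ^ n + 1) (\<lambda>i j. C (?g n i) (?g n j))" for n
    using T by (intro V) auto
  have phi: "\<phi> (2 ^ n + 1) (\<lambda>i j. C (?g n i) (?g n j)) = expectation (\<lambda>\<omega>. Min ((\<lambda>i. F \<omega> (?g n i)) ` {..<2 ^ n + 1}))" for n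
    using phi_eq[OF g[of n]] sym by (simp add: emin_def F_def)
  have inf: "(INF t\<in>{0..T}. exp (sqrt 2 * V t \<omega> - variance (V t))) = (INF t\<in>{0..T}. F \<omega> t)" for \<omega>
    by (intro INF_cong refl) (simp add: F_def var)
  have mMin: "(\<lambda>\<omega>. Min ((\<lambda>i. F \<omega> (?g n i)) ` {..<2 ^ n + 1})) \<in> borel_measurable M" for n
    unfolding F_def using T by (intro borel_measurable_Min) auto
  have lim: "(\<lambda>n. Min ((\<lambda>i. F \<omega> (?g n i)) ` {..<2 ^ n + 1})) \<longlonglongrightarrow> (INF t\<in>{0..T}. F \<omega> t)" if "\<omega> \<in> space M" for \<omega>
    by (rule Min_grid_tendsto(1)[OF contF[OF that] T])
  have mI: "(\<lambda>\<omega>. INF t\<in>{0..T}. F \<omega> t) \<in> borel_measurable M"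
    using lim mMin by (rule borel_measurable_LIMSEQ_real)
  have dom: "integrable M (\<lambda>\<omega>. F \<omega> 0)"
    unfolding F_def using gvec_exp_coord(1)[OF V1[of 0], of 0 "sqrt 2"] by (simp add: exp_diff)
  have bd: "0 < Min ((\<lambda>i. F \<omega> (?g n i)) ` {..<2 ^ n + 1})" "Min ((\<lambda>i. F \<omega> (?g n i)) ` {..<2 ^ n + 1}) \<le> F \<omega> 0" for \<omega> n
  proof -
    show "0 < Min ((\<lambda>i. F \<omega> (?g n i)) ` {..<2 ^ n + 1})" unfolding F_def by (rule Min_exp_pos) simp
    have "Min ((\<lambda>i. F \<omega> (?g n i)) ` {..<2 ^ n + 1}) \<le> F \<omega> (?g n 0)"
      by (intro Min_le image_eqI[where x = 0]) auto
    then show "Min ((\<lambda>i. F \<omega> (?g n i)) ` {..<2 ^ n + 1}) \<le> F \<omega> 0" by simp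
  qed
  have "(\<lambda>n. expectation (\<lambda>\<omega>. Min ((\<lambda>i. F \<omega> (?g n i)) ` {..<2 ^ n + 1}))) \<longlonglongrightarrow> expectation (\<lambda>\<omega>. INF t\<in>{0..T}. F \<omega> t)"
    by (rule integral_dominated_convergence[OF mI mMin dom])
       (use lim bd in \<open>auto intro!: AE_I2 simp: less_imp_le abs_of_pos\<close>)
  then show "(\<lambda>n. \<phi> (2 ^ n + 1) (\<lambda>i j. C (?g n i) (?g n j))) \<longlonglongrightarrow> \<G> M V T"
    unfolding phi \<G>_def inf .
  have Fpos: "0 < (INF t\<in>{0..T}. F \<omega> t)" "(INF t\<in>{0..T}. F \<omega> t) \<le> F \<omega> 0" if "\<omega> \<in> space M" for \<omega>
  proof -
    show "0 < (INF t\<in>{0..T}. F \<omega> t)" using Min_grid_tendsto(2)[OF contF[OF that] T] by (auto simp: F_def)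
    show "(INF t\<in>{0..T}. F \<omega> t) \<le> F \<omega> 0" by (rule LIMSEQ_le_const2[OF lim[OF that]]) (use bd in auto)
  qed
  have iI: "integrable M (\<lambda>\<omega>. INF t\<in>{0..T}. F \<omega> t)"
    by (rule Bochner_Integration.integrable_bound[OF dom mI])
       (use Fpos in \<open>auto intro!: AE_I2 simp: abs_of_pos F_def\<close>)
  have "expectation (\<lambda>_. 0) < expectation (\<lambda>\<omega>. INF t\<in>{0..T}. F \<omega> t)"
    using iI Fpos(1) by (intro integral_less_AE_space) (auto simp: emeasure_space_1)
  then show "0 < \<G> M V T" unfolding \<G>_def inf by simp
qed

text \<open>Here \<open>v h\<close> and \<open>u h\<close> are the variances of increments of
  \<open>V\<close> and \<open>U\<close>. The larger variogram of \<open>V\<close> gives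
  \<open>\<G> M V T \<le> \<G> N U T\<close>. Conversely \<open>v\<close> lies below the variogram
  of \<open>U\<close> plus an independent stationary process with covariance \<open>r\<close>, whose
  functional splits off as a factor by \<open>phi_add_ge\<close>. For fixed \<open>T\<close> the
  grids are refined first.\<close>

theorem G_ratio_bounds:
  fixes V :: "real \<Rightarrow> 'a \<Rightarrow> real" and U :: "real \<Rightarrow> 'b \<Rightarrow> real" and r :: "real \<Rightarrow> real"
  assumes V: "\<And>n (t :: nat \<Rightarrow> real). (\<And>i. i < n \<Longrightarrow> 0 \<le> t i) \<Longrightarrow> gvec M (\<lambda>i. V (t i)) n (\<lambda>i j. C (t i) (t j))"
      "\<And>s t. C s t = C t s" "\<And>T \<omega>. \<omega> \<in> space M \<Longrightarrow> continuous_on {0..T} (\<lambda>t. V t \<omega>)"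
    and U: "\<And>n (t :: nat \<Rightarrow> real). (\<And>i. i < n \<Longrightarrow> 0 \<le> t i) \<Longrightarrow> gvec N (\<lambda>i. U (t i)) n (\<lambda>i j. D (t i) (t j))"
      "\<And>s t. D s t = D t s" "\<And>T \<omega>. \<omega> \<in> space N \<Longrightarrow> continuous_on {0..T} (\<lambda>t. U t \<omega>)"
    and r: "0 < \<beta>" "0 \<le> L" "0 \<le> r 0" "\<And>h. 0 \<le> h \<Longrightarrow> 2 * (r 0 - r h) \<le> L * h powr \<beta>"
      "\<And>n (t :: nat \<Rightarrow> real). psd n (\<lambda>i j. r \<bar>t i - t j\<bar>)"
    and C: "\<And>s t. 0 \<le> s \<Longrightarrow> 0 \<le> t \<Longrightarrow> C s s + C t t - 2 * C s t = v \<bar>s - t\<bar>"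
    and D: "\<And>s t. 0 \<le> s \<Longrightarrow> 0 \<le> t \<Longrightarrow> D s s + D t t - 2 * D s t = u \<bar>s - t\<bar>"
    and vu: "\<And>h. 0 \<le> h \<Longrightarrow> u h \<le> v h" "\<And>h. 0 \<le> h \<Longrightarrow> v h \<le> u h + 2 * (r 0 - r h)"
  obtains f where "(f \<longlongrightarrow> 0) at_top"
    "\<forall>\<^sub>F T in at_top. 0 < \<G> M V T \<and> 0 < \<G> N U T \<and> \<G> M V T \<le> \<G> N U T \<and>
      \<G> N U T * exp (- r 0 - 2 * sqrt (r 0) * sqrt (ln T) - f T) \<le> \<G> M V T"
proof -
  obtain f where f: "(f \<longlongrightarrow> 0) at_top"
    "\<forall>\<^sub>F T in at_top. \<exists>n0. \<forall>n\<ge>n0. exp (- r 0 - 2 * sqrt (r 0) * sqrt (ln T) - f T)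
       \<le> \<phi> (2 ^ n + 1) (\<lambda>i j. r \<bar>real i * T / 2 ^ n - real j * T / 2 ^ n\<bar>)"
    using phi_stationary_asymp[of \<beta> L r, OF r] by blast
  have "\<forall>\<^sub>F T in at_top. 0 < \<G> M V T \<and> 0 < \<G> N U T \<and> \<G> M V T \<le> \<G> N U T \<and>
      \<G> N U T * exp (- r 0 - 2 * sqrt (r 0) * sqrt (ln T) - f T) \<le> \<G> M V T"
    using f(2) eventually_gt_at_top[of 0]
  proof eventually_elim
    case (elim T)
    let ?g = "\<lambda>n i. real i * T / 2 ^ n"
    let ?C = "\<lambda>n i j. C (?g n i) (?g n j)" and ?D = "\<lambda>n i j. D (?g n i) (?g n j)"
      and ?R = "\<lambda>n i j. r \<bar>?g n i - ?g n j\<bar>"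
    have g0: "0 \<le> ?g n i" for n i using elim by simp
    have pC: "psd k (?C n)" for k n using V(1)[of k "?g n"] g0 V(2) by (blast intro: gvec_psd)
    have pD: "psd k (?D n)" for k n using U(1)[of k "?g n"] g0 U(2) by (blast intro: gvec_psd)
    note limC = G_limit(1)[OF elim(2) V(1) V(2) V(3)]
    note limD = G_limit(1)[OF elim(2) U(1) U(2) U(3)]
    have le: "\<phi> (2 ^ n + 1) (?C n) \<le> \<phi> (2 ^ n + 1) (?D n)" for n
      by (intro phi_antimono_vgram pC pD) (simp_all add: vgram_def C D g0 vu(1))
    have ge: "\<phi> (2 ^ n + 1) (?D n) * \<phi> (2 ^ n + 1) (?R n) \<le> \<phi> (2 ^ n + 1) (?C n)" for n
    proof -
      have "\<phi> (2 ^ n + 1) (?D n) * \<phi> (2 ^ n + 1) (?R n) \<le> \<phi> (2 ^ n + 1) (\<lambda>i j. ?D n i j + ?R n i j)"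
        by (intro phi_add_ge pD r) simp
      also have "\<dots> \<le> \<phi> (2 ^ n + 1) (?C n)"
      proof (intro phi_antimono_vgram pC psd_add pD r)
        show "vgram (?C n) i j \<le> vgram (\<lambda>i j. ?D n i j + ?R n i j) i j" for i j
          using vu(2)[of "\<bar>?g n i - ?g n j\<bar>"] C[OF g0 g0, of i n j n] D[OF g0 g0, of i n j n] by (simp add: vgram_def)
      qed simp
      finally show ?thesis .
    qed
    from elim(1) obtain n0 where n0: "\<And>n. n \<ge> n0 \<Longrightarrow> exp (- r 0 - 2 * sqrt (r 0) * sqrt (ln T) - f T)
       \<le> \<phi> (2 ^ n + 1) (?R n)" by blast
    have "\<phi> (2 ^ n + 1) (?D n) * exp (- r 0 - 2 * sqrt (r 0) * sqrt (ln T) - f T) \<le> \<phi> (2 ^ n + 1) (?C n)"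
      if "n \<ge> n0" for n
    proof -
      have "\<phi> (2 ^ n + 1) (?D n) * exp (- r 0 - 2 * sqrt (r 0) * sqrt (ln T) - f T)
        \<le> \<phi> (2 ^ n + 1) (?D n) * \<phi> (2 ^ n + 1) (?R n)"
        using phi_pos[OF pD, of "2 ^ n + 1" n] n0[OF that] by (intro mult_left_mono) auto
      with ge[of n] show ?thesis by linarith
    qed
    then have "\<G> N U T * exp (- r 0 - 2 * sqrt (r 0) * sqrt (ln T) - f T) \<le> \<G> M V T"
      by (intro LIMSEQ_le[OF tendsto_mult_right[OF limD] limC]) auto
    moreover have "\<G> M V T \<le> \<G> N U T" by (rule LIMSEQ_le[OF limC limD]) (use le in auto)
    ultimately show ?case
      using G_limit(2)[OF elim(2) V(1) V(2) V(3)] G_limit(2)[OF elim(2) U(1) U(2) U(3)] by blast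
  qed
  with f(1) show thesis by (rule that)
qed

text \<open>A mere reparametrisation of the interval: the variance in \<open>\<G>\<close> is that of
  the process itself and is carried along.\<close>

lemma G_time_scale:
  assumes "0 < k" "0 \<le> T"
  shows "\<G> M (\<lambda>t. V (k * t)) T = \<G> M V (k * T)"
proof -
  have "(\<lambda>t. k * t) ` {0..T} = {0..k * T}" using assms by (auto simp: image_mult_atLeastAtMost)
  then have "(INF t\<in>{0..k * T}. h t) = (INF t\<in>{0..T}. h (k * t))" for h :: "real \<Rightarrow> real"
    by (metis image_image)
  then show ?thesis by (simp add: \<G>_def)
qed

text \<open>The triangle function is the overlap length of two unit intervals starting at
  \<open>t i\<close> and \<open>t j\<close>, so the quadratic form is the integral of the square of
  a sum of indicators.\<close>

lemma psd_triangle: "psd n (\<lambda>i j. max 0 (1 - \<bar>t i - t j\<bar>))"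
proof -
  have "0 \<le> qform n (\<lambda>i j. max 0 (1 - \<bar>t i - t j\<bar>)) c" for c
  proof -
    let ?I = "\<lambda>i. indicator {t i..t i + 1} :: real \<Rightarrow> real"
    have ov: "integrable lborel (\<lambda>x. ?I i x * ?I j x)" "(LINT x|lborel. ?I i x * ?I j x) = max 0 (1 - \<bar>t i - t j\<bar>)" for i j
    proof -
      have e: "?I i x * ?I j x = indicator {max (t i) (t j)..min (t i) (t j) + 1} x" for x
        by (auto simp: indicator_def)
      have "measure lborel {max (t i) (t j)..min (t i) (t j) + 1} = max 0 (1 - \<bar>t i - t j\<bar>)"
        by (cases "max (t i) (t j) \<le> min (t i) (t j) + 1") (auto simp: max_def min_def abs_if split: if_splits)
      then show "integrable lborel (\<lambda>x. ?I i x * ?I j x)" "(LINT x|lborel. ?I i x * ?I j x) = max 0 (1 - \<bar>t i - t j\<bar>)"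
        unfolding e by (auto intro!: integrable_real_indicator simp: emeasure_lborel_Icc_eq)
    qed
    have sq: "(\<Sum>i<n. c i * ?I i x)\<^sup>2 = (\<Sum>i<n. \<Sum>j<n. c i * c j * (?I i x * ?I j x))" for x
      unfolding power2_eq_square sum_product by (intro sum.cong refl) (simp only: mult_ac)
    have "(LINT x|lborel. (\<Sum>i<n. c i * ?I i x)\<^sup>2) =
      (\<Sum>i<n. \<Sum>j<n. c i * c j * (LINT x|lborel. ?I i x * ?I j x))"
      unfolding sq by (subst Bochner_Integration.integral_sum, intro Bochner_Integration.integrable_sum integrable_mult_right ov)
        (subst Bochner_Integration.integral_sum, intro integrable_mult_right ov, simp only: integral_mult_right_zero)
    then have "(LINT x|lborel. (\<Sum>i<n. c i * ?I i x)\<^sup>2) = qform n (\<lambda>i j. max 0 (1 - \<bar>t i - t j\<bar>)) c"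
      unfolding ov(2) by (simp only: qform_def)
    moreover have "0 \<le> (LINT x|lborel. (\<Sum>i<n. c i * ?I i x)\<^sup>2)"
      by (rule Bochner_Integration.integral_nonneg) simp
    ultimately show ?thesis by (simp only:)
  qed
  then show ?thesis by (auto simp: psd_def abs_minus_commute)
qed

subsection \<open>The three examples\<close>

lemma brownian_continuous: "standard_brownian_motion M B \<Longrightarrow> \<omega> \<in> space M \<Longrightarrow> continuous_on S (\<lambda>t. B t \<omega>)"
  unfolding standard_brownian_motion_def continuous_paths_def by (blast intro: continuous_on_subset)

text \<open>Near 0 the error term is at most \<open>\<bar>t\<bar> powr \<alpha>\<close>, which gives
  the constant \<open>2 * (A + 1)\<close>; at distance \<open>d\<close> or more the trivial bound
  \<open>4 * R 0\<close> is compared with \<open>d powr \<alpha>\<close>.\<close>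

lemma pickands_holder:
  fixes R :: "real \<Rightarrow> real"
  assumes "0 < A" "0 < \<alpha>" and o: "(\<lambda>t. R 0 - R t - A * \<bar>t\<bar> powr \<alpha>) \<in> o[at 0](\<lambda>t. \<bar>t\<bar> powr \<alpha>)"
    and bd: "\<And>t. \<bar>R t\<bar> \<le> R 0"
  obtains L where "0 \<le> L" "\<And>h. 0 \<le> h \<Longrightarrow> 2 * (R 0 - R h) \<le> L * h powr \<alpha>"
proof -
  have R0: "0 \<le> R 0" using bd[of 0] by simp
  have "\<forall>\<^sub>F t in at 0. norm (R 0 - R t - A * \<bar>t\<bar> powr \<alpha>) \<le> 1 * norm (\<bar>t\<bar> powr \<alpha>)"
    by (rule landau_o.smallD[OF o]) simp
  then obtain d where d: "0 < d" "\<And>t. t \<noteq> 0 \<Longrightarrow> \<bar>t\<bar> < d \<Longrightarrow> \<bar>R 0 - R t - A * \<bar>t\<bar> powr \<alpha>\<bar> \<le> \<bar>t\<bar> powr \<alpha>"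
    unfolding eventually_at by (auto simp: dist_real_def)
  define L where "L = max (2 * (A + 1)) (4 * R 0 / d powr \<alpha>)"
  have "2 * (R 0 - R h) \<le> L * h powr \<alpha>" if h: "0 \<le> h" for h
  proof -
    consider "h = 0" | "0 < h" "h < d" | "d \<le> h" using h by linarith
    then show ?thesis
    proof cases
      case 2
      then have "2 * (R 0 - R h) \<le> 2 * (A + 1) * h powr \<alpha>" using d(2)[of h] by (simp add: algebra_simps)
      also have "\<dots> \<le> L * h powr \<alpha>" unfolding L_def by (intro mult_right_mono) auto
      finally show ?thesis .
    next
      case 3
      have "2 * (R 0 - R h) \<le> 4 * R 0" using bd[of h] by (simp add: abs_le_iff)
      also have "\<dots> = 4 * R 0 / d powr \<alpha> * d powr \<alpha>" using d(1) by simp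
      also have "\<dots> \<le> 4 * R 0 / d powr \<alpha> * h powr \<alpha>"
        using R0 3 d(1) assms(2) by (intro mult_left_mono powr_mono2) auto
      also have "\<dots> \<le> L * h powr \<alpha>" unfolding L_def by (intro mult_right_mono) auto
      finally show ?thesis .
    qed simp
  qed
  moreover have "0 \<le> L" using assms(1) by (simp add: L_def)
  ultimately show thesis using that by blast
qed

lemma stationary_process_gvec:
  assumes M: "prob_space M" and Z: "gaussian_process M Z" "centered M Z" "stationary M Z"
    and R: "\<And>t. R t = covariance M (Z 0) (Z t)"
  shows "R (- x) = R x" "gvec M (\<lambda>i. Z (t i)) n (\<lambda>i j. R (t i - t j))"
proof -
  have m: "Z t \<in> borel_measurable M" for t using Z(1) by (simp add: gaussian_process_def)
  have R': "R t = (LINT \<omega>|M. Z 0 \<omega> * Z t \<omega>)" for t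
    using Z(2) by (simp add: R covariance_def centered_def)
  have cov: "(LINT \<omega>|M. Z s \<omega> * Z t \<omega>) = R (t - s)" for s t
    unfolding R' by (rule stationary_covariance[OF m Z(3)])
  show even: "R (- x) = R x" for x
    using cov[of x 0] cov[of 0 x] by (simp add: mult.commute)
  show "gvec M (\<lambda>i. Z (t i)) n (\<lambda>i j. R (t i - t j))"
  proof (rule gvec_cong[OF gvec_gaussian_process(1)[OF M Z(1,2), of t n]])
    show "(LINT \<omega>|M. Z (t i) \<omega> * Z (t j) \<omega>) = R (t i - t j)" for i j
      unfolding cov using even[of "t i - t j"] by simp
  qed
qed

text \<open>The variance of \<open>Z 0 + Z a\<close> is \<open>2 * R 0 + 2 * R a\<close>, and it is
  continuous in \<open>a\<close> by \<open>gvec_qform_limit\<close>.\<close>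

lemma stationary_covariance_continuous:
  fixes R :: "real \<Rightarrow> real"
  assumes Z: "\<And>n (t :: nat \<Rightarrow> real). gvec M (\<lambda>i. Z (t i)) n (\<lambda>i j. R (t i - t j))"
    and even: "\<And>x. R (- x) = R x" and cont: "continuous_paths M Z"
  shows "continuous_on UNIV R"
  unfolding continuous_on_sequentially o_def
proof (intro allI ballI impI, elim conjE)
  fix x :: "nat \<Rightarrow> real" and a assume x: "x \<longlonglongrightarrow> a"
  define t where "t y i = (if i = 0 then 0 else y)" for y :: real and i :: nat
  have "(\<lambda>N. qform 2 (\<lambda>i j. R (t (x N) i - t (x N) j)) (\<lambda>_. 1)) \<longlonglongrightarrow> qform 2 (\<lambda>i j. R (t a i - t a j)) (\<lambda>_. 1)"
  proof (rule gvec_qform_limit[OF Z[of "t (x N)" for N] Z[of "t a"]])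
    fix i \<omega> assume "\<omega> \<in> space M"
    then have "continuous_on UNIV (\<lambda>t. Z t \<omega>)" using cont by (simp add: continuous_paths_def)
    then show "(\<lambda>N. Z (t (x N) i) \<omega>) \<longlonglongrightarrow> Z (t a i) \<omega>"
      using x by (auto simp: t_def continuous_on_sequentially o_def)
  qed
  then have "(\<lambda>N. 2 * R 0 + 2 * R (x N)) \<longlonglongrightarrow> 2 * R 0 + 2 * R a"
    by (simp add: qform_def t_def numeral_2_eq_2 even add.commute)
  from tendsto_diff[OF this tendsto_const[of "2 * R 0"]] have "(\<lambda>N. 2 * R (x N)) \<longlonglongrightarrow> 2 * R a" by simp
  from tendsto_mult_left[OF this, of "1/2"] show "(\<lambda>N. R (x N)) \<longlonglongrightarrow> R a" by simp
qed

lemma perturbed_brownian_gvec: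
  assumes M: "prob_space M" and B: "standard_brownian_motion M B"
    and Z: "\<And>n (t :: nat \<Rightarrow> real). gvec M (\<lambda>i. Z (t i)) n (\<lambda>i j. R (t i - t j))"
    and even: "\<And>x. R (- x) = R x" and mZ: "\<And>t. Z t \<in> borel_measurable M" and ind: "indep_processes M B Z"
    and t: "\<And>i. i < n \<Longrightarrow> 0 \<le> t i"
  shows "gvec M (\<lambda>i \<omega>. B (t i) \<omega> + Z (t i) \<omega> - Z 0 \<omega>) n
    (\<lambda>i j. polar (\<lambda>h. h + 2 * (R 0 - R h)) (t i) (t j))"
proof -
  interpret prob_space M by fact
  \<comment> \<open>Time 0 is appended as coordinate \<open>n\<close>, so that
    \<open>Z (t i) - Z 0\<close> becomes a linear image of one Gaussian vector.\<close>
  define u where "u i = (if i < n then t i else 0)" for i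
  define A where "A i = (\<lambda>k. (if k = i then 1 else 0) + (if k = n then - 1 else 0 :: real))" for i :: nat
  let ?C = "\<lambda>i j. R (u i - u j)"
  have sym: "?C i j = ?C j i" for i j by (metis even minus_diff_eq)
  have q: "qform (Suc n) ?C (A i) = 2 * (R 0 - R (t i))" if "i < n" for i
    unfolding A_def using that by (subst vgram_eq_qform[OF sym]) (auto simp: vgram_def u_def)
  have qd: "qform (Suc n) ?C (\<lambda>k. A i k - A j k) = 2 * (R 0 - R (t i - t j))" if "i < n" "j < n" for i j
  proof -
    have "(\<lambda>k. A i k - A j k) = (\<lambda>k. (if k = i then 1 else 0) + (if k = j then - 1 else 0))"
      by (auto simp: A_def)
    then show ?thesis using that by (simp only:) (subst vgram_eq_qform[OF sym], auto simp: vgram_def u_def)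
  qed
  have "gvec M (\<lambda>i \<omega>. lincomb (Suc n) (A i) (\<lambda>k. Z (u k) \<omega>)) n
    (\<lambda>i j. (qform (Suc n) ?C (A i) + qform (Suc n) ?C (A j) - qform (Suc n) ?C (\<lambda>k. A i k - A j k)) / 2)"
    by (rule gvec_linear[OF Z sym])
  then have W': "gvec M (\<lambda>i \<omega>. lincomb (Suc n) (A i) (\<lambda>k. Z (u k) \<omega>)) n (\<lambda>i j. R 0 - R (t i) - R (t j) + R (t i - t j))"
    by (rule gvec_cong) (simp add: q qd field_simps)
  have lc: "lincomb (Suc n) (A i) (\<lambda>k. Z (u k) \<omega>) = Z (t i) \<omega> - Z 0 \<omega>" if "i < n" for i \<omega>
    using that by (simp add: A_def lincomb_add lincomb_single u_def)
  have W: "gvec M (\<lambda>i \<omega>. Z (t i) \<omega> - Z 0 \<omega>) n (\<lambda>i j. R 0 - R (t i) - R (t j) + R (t i - t j))"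
    by (rule gvec_AE_cong[OF W']) (simp_all add: lc mZ borel_measurable_diff)
  have "gvec M (\<lambda>i \<omega>. B (t i) \<omega> + (Z (t i) \<omega> - Z 0 \<omega>)) n
    (\<lambda>i j. polar (\<lambda>h. h) (t i) (t j) + (R 0 - R (t i) - R (t j) + R (t i - t j)))"
  proof (rule gvec_add_indep[OF brownian_gvec[OF M B t] W])
    fix c
    let ?P = "\<Pi>\<^sub>M t\<in>(UNIV :: real set). (borel :: real measure)"
    have "indep_var borel ((\<lambda>x. lincomb n c (\<lambda>i. x (t i))) \<circ> (\<lambda>\<omega> t. B t \<omega>))
      borel ((\<lambda>x. lincomb n c (\<lambda>i. x (t i) - x 0)) \<circ> (\<lambda>\<omega> t. Z t \<omega>))"
    proof (rule indep_var_compose)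
      show "indep_var ?P (\<lambda>\<omega> t. B t \<omega>) ?P (\<lambda>\<omega> t. Z t \<omega>)" using ind by (simp add: indep_processes_def)
      show "(\<lambda>x. lincomb n c (\<lambda>i. x (t i))) \<in> borel_measurable ?P"
        by (intro measurable_lincomb) measurable
      show "(\<lambda>x. lincomb n c (\<lambda>i. x (t i) - x 0)) \<in> borel_measurable ?P"
        by (intro measurable_lincomb) measurable
    qed
    then show "indep_var borel (\<lambda>\<omega>. lincomb n c (\<lambda>i. B (t i) \<omega>)) borel (\<lambda>\<omega>. lincomb n c (\<lambda>i. Z (t i) \<omega> - Z 0 \<omega>))"
      by (simp add: o_def)
  qed
  then have BW: "gvec M (\<lambda>i \<omega>. B (t i) \<omega> + Z (t i) \<omega> - Z 0 \<omega>) n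
    (\<lambda>i j. polar (\<lambda>h. h) (t i) (t j) + (R 0 - R (t i) - R (t j) + R (t i - t j)))"
    by (simp add: add_diff_eq)
  show ?thesis
  proof (rule gvec_cong[OF BW])
    fix i j
    have "R (t i - t j) = R \<bar>t i - t j\<bar>" using even[of "t i - t j"] by (simp add: abs_if)
    moreover have "(x + y - z) / 2 + (q - a - b + d) = (x + 2 * (q - a) + (y + 2 * (q - b)) - (z + 2 * (q - d))) / 2"
      for x y z q a b d :: real by (simp add: field_simps)
    ultimately show "polar (\<lambda>h. h) (t i) (t j) + (R 0 - R (t i) - R (t j) + R (t i - t j)) =
      polar (\<lambda>h. h + 2 * (R 0 - R h)) (t i) (t j)"
      unfolding polar_def by (simp only:)
  qed
qed

text \<open>The forms at the two points 0 and \<open>x\<close> with coefficients \<open>1, 1\<close>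
  and \<open>1, - 1\<close>.\<close>

lemma psd_stationary_bound:
  assumes "\<And>n (t :: nat \<Rightarrow> real). psd n (\<lambda>i j. r \<bar>t i - t j\<bar>)" and x: "0 \<le> x"
  shows "\<bar>r x\<bar> \<le> r 0"
proof -
  have "0 \<le> qform 2 (\<lambda>i j. r \<bar>(if i = 0 then 0 else x) - (if j = 0 then 0 else x)\<bar>) (\<lambda>i. if i = 0 then 1 else s)" for s
    by (rule psdD(2)[OF assms(1)])
  from this[of 1] this[of "-1"] show ?thesis using x by (simp add: qform_def numeral_2_eq_2 abs_le_iff)
qed

text \<open>The square of the sine is at most \<open>\<bar>h\<bar> * min 1 \<bar>h\<bar>\<close>,
  and \<open>c\<close> times this is the mixed term in the square of
  \<open>\<bar>h\<bar> + c / 2 * min 1 \<bar>h\<bar>\<close>. The excess over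
  \<open>\<bar>h\<bar>\<close> thus takes the form of a triangle variogram.\<close>

lemma sqrt_variogram_bounds:
  fixes c h :: real
  assumes "0 < c"
  shows "\<bar>h\<bar> \<le> sqrt (h\<^sup>2 + c * (sin (h / 2))\<^sup>2)"
    and "sqrt (h\<^sup>2 + c * (sin (h / 2))\<^sup>2) \<le> \<bar>h\<bar> + c / 2 * min 1 \<bar>h\<bar>"
proof -
  have "sqrt (h\<^sup>2) \<le> sqrt (h\<^sup>2 + c * (sin (h / 2))\<^sup>2)" using assms by (intro real_sqrt_le_mono) simp
  then show "\<bar>h\<bar> \<le> sqrt (h\<^sup>2 + c * (sin (h / 2))\<^sup>2)" by simp
  have "(sin (h / 2))\<^sup>2 \<le> \<bar>h\<bar> * min 1 \<bar>h\<bar>"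
  proof (cases "\<bar>h\<bar> \<le> 1")
    case True
    have "\<bar>sin (h / 2)\<bar> \<le> \<bar>h\<bar>" using abs_sin_x_le_abs_x[of "h / 2"] by simp
    then have "(sin (h / 2))\<^sup>2 \<le> h\<^sup>2" by (simp add: abs_le_square_iff)
    then show ?thesis using True by (simp add: min_def power2_eq_square)
  next
    case False
    have "(sin (h / 2))\<^sup>2 \<le> 1" by (simp add: abs_square_le_1)
    then show ?thesis using False by (simp add: min_def)
  qed
  then have "c * (sin (h / 2))\<^sup>2 \<le> c * (\<bar>h\<bar> * min 1 \<bar>h\<bar>)" using assms by (intro mult_left_mono) auto
  moreover have "(\<bar>h\<bar> + c / 2 * min 1 \<bar>h\<bar>)\<^sup>2 = h\<^sup>2 + c * (\<bar>h\<bar> * min 1 \<bar>h\<bar>) + (c / 2 * min 1 \<bar>h\<bar>)\<^sup>2"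
    by (simp add: power2_sum)
  moreover have "0 \<le> (c / 2 * min 1 \<bar>h\<bar>)\<^sup>2" by simp
  ultimately have "h\<^sup>2 + c * (sin (h / 2))\<^sup>2 \<le> (\<bar>h\<bar> + c / 2 * min 1 \<bar>h\<bar>)\<^sup>2" by linarith
  then show "sqrt (h\<^sup>2 + c * (sin (h / 2))\<^sup>2) \<le> \<bar>h\<bar> + c / 2 * min 1 \<bar>h\<bar>"
    using assms by (intro real_le_lsqrt) auto
qed

text \<open>Both integrals over \<open>[0, h]\<close> are complements of tails, and the two tails
  combine to the integral of \<open>(s - h) * R s\<close> beyond \<open>h\<close>, which is
  \<open>g h\<close>.\<close>

lemma integrated_variance:
  fixes R g :: "real \<Rightarrow> real"
  assumes iR: "set_integrable lborel {0..} R" and isR: "set_integrable lborel {0..} (\<lambda>s. s * R s)"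
    and a: "a = (LINT s:{0..}|lborel. R s)" and m: "m = (LINT s:{0..}|lborel. s * R s)"
    and g: "\<And>t. g t = (LINT s:{t..}|lborel. (s - t) * R s)" and h: "0 \<le> h"
  shows "h * integral {0..h} R - integral {0..h} (\<lambda>u. u * R u) = a * h - m + g h"
proof -
  have sub: "set_integrable lborel {0..h} f" "set_integrable lborel {h<..} f" if "set_integrable lborel {0..} f" for f :: "real \<Rightarrow> real"
    using h by (auto intro!: set_integrable_subset[OF that])
  have split: "(LINT s:{0..}|lborel. f s) = integral {0..h} f + (LINT s:{h<..}|lborel. f s)"
    if f: "set_integrable lborel {0..} f" for f :: "real \<Rightarrow> real"
  proof -
    have "{0..} = {0..h} \<union> {h<..}" using h by auto
    moreover have "{0..h} \<inter> {h<..} = {}" by auto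
    ultimately have "(LINT s:{0..}|lborel. f s) = (LINT s:{0..h}|lborel. f s) + (LINT s:{h<..}|lborel. f s)"
      using set_integral_Un[OF _ sub[OF f]] by (simp only:)
    then show ?thesis using set_borel_integral_eq_integral(2)[OF sub(1)[OF f]] by simp
  qed
  have "g h = (LINT s:{h<..}|lborel. s * R s - h * R s)"
    unfolding g set_lebesgue_integral_def
    by (intro Bochner_Integration.integral_cong refl) (auto simp: indicator_def algebra_simps)
  also have "\<dots> = (LINT s:{h<..}|lborel. s * R s) - h * (LINT s:{h<..}|lborel. R s)"
    using sub(2)[OF isR] sub(2)[OF iR] by (subst set_integral_diff) (auto intro: set_integrable_mult_right)
  finally show ?thesis unfolding a m split[OF iR] split[OF isR] by (simp add: algebra_simps)
qed

theorem corollary2p11: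
  fixes M :: "'a measure" and B Z :: "real \<Rightarrow> 'a \<Rightarrow> real"
    and N :: "'b measure" and Vc :: "real \<Rightarrow> 'b \<Rightarrow> real"
    and R g :: "real \<Rightarrow> real" and \<sigma> A \<alpha> c a m :: real
  assumes "prob_space M"
    and B: "standard_brownian_motion M B"
    and Z: "gaussian_process M Z" "centered M Z" "stationary M Z" "continuous_paths M Z"
    and indep: "indep_processes M B Z"
    and sigma: "0 < \<sigma>" "\<And>t. prob_space.variance M (Z t) = \<sigma>\<^sup>2"
    and R: "\<And>t. R t = covariance M (Z 0) (Z t)"
    and Pickands: "0 < A" "0 < \<alpha>" "\<alpha> \<le> 2"
      "(\<lambda>t. R 0 - R t - A * \<bar>t\<bar> powr \<alpha>) \<in> o[at 0](\<lambda>t. \<bar>t\<bar> powr \<alpha>)"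
    and a: "a = (LINT s:{0..}|lborel. R s)"
    and m: "m = (LINT s:{0..}|lborel. s * R s)"
    and g: "\<And>t. g t = (LINT s:{t..}|lborel. (s - t) * R s)"
  shows
    "(((\<lambda>T. ln T * R T) \<longlongrightarrow> 0) at_top \<longrightarrow>
       (\<exists>f. f \<in> O[at_top](\<lambda>_. 1) \<and>
         (\<forall>\<^sub>F T in at_top.
            exp (- 2 * \<sigma> * sqrt (ln T) + f T)
              \<le> \<G> M (\<lambda>t \<omega>. B t \<omega> + Z t \<omega> - Z 0 \<omega>) T / \<G> M B T \<and>
            \<G> M (\<lambda>t \<omega>. B t \<omega> + Z t \<omega> - Z 0 \<omega>) T / \<G> M B T \<le> 1)))
     \<and>
     (0 < c \<and> prob_space N \<and> gaussian_process N Vc \<and> centered N Vc \<and>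
      stationary_increments N Vc \<and> continuous_paths N Vc \<and>
      (\<forall>t. variogram N Vc t = 1 / 2 * sqrt (t\<^sup>2 + c * (sin (t / 2))\<^sup>2)) \<longrightarrow>
       (\<exists>\<sigma>'>0. \<exists>f. f \<in> O[at_top](\<lambda>_. 1) \<and>
         (\<forall>\<^sub>F T in at_top.
            exp (- 2 * \<sigma>' * sqrt (ln T) + f T) \<le> \<G> N Vc T / \<G> M B T \<and>
            \<G> N Vc T / \<G> M B T \<le> 1)))
     \<and>
     ((\<forall>t\<ge>0. 0 \<le> R t) \<and>
      set_integrable lborel {0..} R \<and> 0 < a \<and>
      set_integrable lborel {0..} (\<lambda>s. s * R s) \<and>
      abs_positive_definite g \<and>
      ((\<lambda>t. ln t * g t) \<longlongrightarrow> 0) at_top \<longrightarrow>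
       (\<exists>f. f \<in> o[at_top](\<lambda>_. 1) \<and>
         (\<forall>\<^sub>F T in at_top.
            1 \<le> \<G> M (\<lambda>t \<omega>. integral {0..t} (\<lambda>s. Z s \<omega>)) T / \<G> M B (2 * a * T) \<and>
            \<G> M (\<lambda>t \<omega>. integral {0..t} (\<lambda>s. Z s \<omega>)) T / \<G> M B (2 * a * T)
              \<le> exp (2 * sqrt m * sqrt (ln T) + m + f T))))"
proof -
  interpret prob_space M by fact
  note gB = brownian_gvec[OF \<open>prob_space M\<close> B]
  have mZ: "Z t \<in> borel_measurable M" for t using Z(1) by (simp add: gaussian_process_def)
  note even = stationary_process_gvec(1)[OF \<open>prob_space M\<close> Z(1-3) R]
  note gZ = stationary_process_gvec(2)[OF \<open>prob_space M\<close> Z(1-3) R]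
  have cR: "continuous_on UNIV R" by (rule stationary_covariance_continuous[OF gZ even Z(4)])
  have R0: "R 0 = \<sigma>\<^sup>2" using sigma(2)[of 0] by (simp add: R covariance_def power2_eq_square)
  have psdR: "psd n (\<lambda>i j. R \<bar>t i - t j\<bar>)" for n and t :: "nat \<Rightarrow> real"
  proof -
    have "R (t i - t j) = R \<bar>t i - t j\<bar>" for i j using even[of "t i - t j"] by (simp add: abs_if)
    moreover have "psd n (\<lambda>i j. R (t i - t j))" by (rule gvec_psd[OF gZ]) (metis even minus_diff_eq)
    ultimately show ?thesis by simp
  qed
  have bd: "\<bar>R x\<bar> \<le> R 0" for x
  proof -
    have "R x = R \<bar>x\<bar>" using even[of x] by (simp add: abs_if)
    then show ?thesis using psd_stationary_bound[of R "\<bar>x\<bar>", OF psdR] by simp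
  qed
  show ?thesis
  proof (intro conjI impI)
    let ?V = "\<lambda>t \<omega>. B t \<omega> + Z t \<omega> - Z 0 \<omega>"
    show "\<exists>f. f \<in> O[at_top](\<lambda>_. 1) \<and> (\<forall>\<^sub>F T in at_top.
        exp (- 2 * \<sigma> * sqrt (ln T) + f T) \<le> \<G> M ?V T / \<G> M B T \<and> \<G> M ?V T / \<G> M B T \<le> 1)"
    proof -
      obtain L where L: "0 \<le> L" "\<And>h. 0 \<le> h \<Longrightarrow> 2 * (R 0 - R h) \<le> L * h powr \<alpha>"
        using pickands_holder[OF Pickands(1,2,4) bd] by blast
      have cV: "continuous_on {0..T} (\<lambda>t. ?V t \<omega>)" if "\<omega> \<in> space M" for T \<omega>
        using Z(4) that brownian_continuous[OF B that]
        by (intro continuous_intros) (auto simp: continuous_paths_def intro: continuous_on_subset)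
      have R0': "0 \<le> R 0" by (simp add: R0)
      obtain f where f: "(f \<longlongrightarrow> 0) at_top"
        "\<forall>\<^sub>F T in at_top. 0 < \<G> M ?V T \<and> 0 < \<G> M B T \<and> \<G> M ?V T \<le> \<G> M B T \<and>
          \<G> M B T * exp (- R 0 - 2 * sqrt (R 0) * sqrt (ln T) - f T) \<le> \<G> M ?V T"
      proof (rule G_ratio_bounds[where V = ?V and M = M and N = M and U = B and r = R and \<beta> = \<alpha> and L = L
          and C = "polar (\<lambda>h. h + 2 * (R 0 - R h))" and v = "\<lambda>h. h + 2 * (R 0 - R h)"
          and D = "polar (\<lambda>h. h)" and u = "\<lambda>h. h"])
        show "h \<le> h + 2 * (R 0 - R h)" for h using bd[of h] by simp
      qed (use perturbed_brownian_gvec[OF \<open>prob_space M\<close> B gZ even mZ indep] gB cV brownian_continuous[OF B]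
          L R0' psdR Pickands(2) polar_commute in \<open>auto simp: polar_increment\<close>)
      have "(\<lambda>T. - R 0 - f T) \<in> O[at_top](\<lambda>_. 1)"
        by (rule bigoI_tendsto[where c = "- R 0 - 0"]) (auto intro!: tendsto_eq_intros f(1))
      moreover have "\<forall>\<^sub>F T in at_top. exp (- 2 * \<sigma> * sqrt (ln T) + (- R 0 - f T)) \<le> \<G> M ?V T / \<G> M B T \<and> \<G> M ?V T / \<G> M B T \<le> 1"
        using f(2)
      proof eventually_elim
        case (elim T)
        have "- 2 * \<sigma> * sqrt (ln T) + (- R 0 - f T) = - R 0 - 2 * sqrt (R 0) * sqrt (ln T) - f T"
          using sigma(1) by (simp add: R0)
        then show ?case using elim by (simp only:) (simp add: pos_le_divide_eq mult.commute)
      qed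
      ultimately show ?thesis by blast
    qed
  next
    assume "0 < c \<and> prob_space N \<and> gaussian_process N Vc \<and> centered N Vc \<and>
        stationary_increments N Vc \<and> continuous_paths N Vc \<and>
        (\<forall>t. variogram N Vc t = 1 / 2 * sqrt (t\<^sup>2 + c * (sin (t / 2))\<^sup>2))"
    then have c: "0 < c" and N: "prob_space N" and V: "gaussian_process N Vc" "centered N Vc" "stationary_increments N Vc" "continuous_paths N Vc"
      and vg: "\<And>t. variogram N Vc t = 1 / 2 * sqrt (t\<^sup>2 + c * (sin (t / 2))\<^sup>2)" by auto
    have mV: "Vc t \<in> borel_measurable N" for t using V(1) by (simp add: gaussian_process_def)
    define C where "C s t = (LINT \<omega>|N. Vc s \<omega> * Vc t \<omega>)" for s t
    note iV = gvec_gaussian_process(2)[OF N V(1,2)]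
    have vC: "C s s + C t t - 2 * C s t = sqrt ((s - t)\<^sup>2 + c * (sin ((s - t) / 2))\<^sup>2)" for s t
    proof -
      have "C s s + C t t - 2 * C s t = (LINT \<omega>|N. Vc s \<omega> * Vc s \<omega> + Vc t \<omega> * Vc t \<omega> - 2 * (Vc s \<omega> * Vc t \<omega>))"
        unfolding C_def using iV by simp
      also have "\<dots> = (LINT \<omega>|N. (Vc s \<omega> - Vc t \<omega>)\<^sup>2)"
        by (simp add: power2_eq_square algebra_simps)
      also have "\<dots> = sqrt ((s - t)\<^sup>2 + c * (sin ((s - t) / 2))\<^sup>2)"
        using stationary_increments_variogram[OF mV V(3), of s t] by (simp add: vg)
      finally show ?thesis .
    qed
    \<comment> \<open>The height \<open>c / 4\<close> makes \<open>2 * (?r 0 - ?r h)\<close> equal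
      to \<open>c / 2 * min 1 h\<close>, the excess allowed by \<open>sqrt_variogram_bounds\<close>.
      Its root becomes \<open>\<sigma>'\<close> below.\<close>
    let ?r = "\<lambda>h. c / 4 * max 0 (1 - h)"
    have psdr: "psd n (\<lambda>i j. ?r \<bar>t i - t j\<bar>)" for n and t :: "nat \<Rightarrow> real"
      using psd_scale[OF psd_triangle[of n t], of "c / 4"] c by simp
    obtain f where f: "(f \<longlongrightarrow> 0) at_top"
      "\<forall>\<^sub>F T in at_top. 0 < \<G> N Vc T \<and> 0 < \<G> M B T \<and> \<G> N Vc T \<le> \<G> M B T \<and>
        \<G> M B T * exp (- ?r 0 - 2 * sqrt (?r 0) * sqrt (ln T) - f T) \<le> \<G> N Vc T"
    proof (rule G_ratio_bounds[where V = Vc and M = N and N = M and U = B and r = ?r and \<beta> = 1 and L = "c / 2"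
        and C = C and v = "\<lambda>h. sqrt (h\<^sup>2 + c * (sin (h / 2))\<^sup>2)" and D = "polar (\<lambda>h. h)" and u = "\<lambda>h. h"])
      show "gvec N (\<lambda>i. Vc (t i)) n (\<lambda>i j. C (t i) (t j))" for n and t :: "nat \<Rightarrow> real"
        unfolding C_def by (rule gvec_gaussian_process(1)[OF N V(1,2)])
      show "C s t = C t s" for s t by (simp add: C_def mult.commute)
      show "C s s + C t t - 2 * C s t = sqrt (\<bar>s - t\<bar>\<^sup>2 + c * (sin (\<bar>s - t\<bar> / 2))\<^sup>2)" for s t
        unfolding vC by (cases "s \<le> t") (simp_all add: abs_if power2_commute[of s t] minus_diff_eq[of t s, symmetric]
          minus_divide_left[symmetric] del: minus_diff_eq)
      show "continuous_on {0..T} (\<lambda>t. Vc t \<omega>)" if "\<omega> \<in> space N" for T \<omega>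
        using V(4) that by (auto simp: continuous_paths_def intro: continuous_on_subset)
      show "2 * (?r 0 - ?r h) \<le> c / 2 * h powr 1" if "0 \<le> h" for h
        using c that by (auto simp: max_def algebra_simps)
      show "h \<le> sqrt (h\<^sup>2 + c * (sin (h / 2))\<^sup>2)" if "0 \<le> h" for h
        using sqrt_variogram_bounds(1)[OF c, of h] that by simp
      show "sqrt (h\<^sup>2 + c * (sin (h / 2))\<^sup>2) \<le> h + 2 * (?r 0 - ?r h)" if "0 \<le> h" for h
      proof -
        have "c / 2 * min 1 h = 2 * (?r 0 - ?r h)" by (simp add: min_def max_def algebra_simps)
        moreover have "\<bar>h\<bar> = h" using that by simp
        ultimately show ?thesis using sqrt_variogram_bounds(2)[OF c, of h] by (simp only:)
      qed
      show "psd n (\<lambda>i j. ?r \<bar>t i - t j\<bar>)" for n and t :: "nat \<Rightarrow> real" by (rule psdr)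
    qed (use c gB brownian_continuous[OF B] polar_commute in \<open>auto simp: polar_increment\<close>)
    have "(\<lambda>T. - c / 4 - f T) \<in> O[at_top](\<lambda>_. 1)"
      by (rule bigoI_tendsto[where c = "- c / 4 - 0"]) (auto intro!: tendsto_eq_intros f(1))
    moreover have "\<forall>\<^sub>F T in at_top. exp (- 2 * sqrt (c / 4) * sqrt (ln T) + (- c / 4 - f T)) \<le> \<G> N Vc T / \<G> M B T \<and> \<G> N Vc T / \<G> M B T \<le> 1"
      using f(2)
    proof eventually_elim
      case (elim T)
      have "- 2 * sqrt (c / 4) * sqrt (ln T) + (- c / 4 - f T) = - ?r 0 - 2 * sqrt (?r 0) * sqrt (ln T) - f T" by simp
      then show ?case using elim by (simp only:) (simp add: pos_le_divide_eq mult.commute)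
    qed
    moreover have "0 < sqrt (c / 4)" using c by simp
    ultimately show "\<exists>\<sigma>'>0. \<exists>f. f \<in> O[at_top](\<lambda>_. 1) \<and> (\<forall>\<^sub>F T in at_top.
        exp (- 2 * \<sigma>' * sqrt (ln T) + f T) \<le> \<G> N Vc T / \<G> M B T \<and> \<G> N Vc T / \<G> M B T \<le> 1)"
      by blast
  next
    assume "(\<forall>t\<ge>0. 0 \<le> R t) \<and> set_integrable lborel {0..} R \<and> 0 < a \<and>
        set_integrable lborel {0..} (\<lambda>s. s * R s) \<and> abs_positive_definite g \<and>
        ((\<lambda>t. ln t * g t) \<longlongrightarrow> 0) at_top"
    then have Rnn: "\<And>t. 0 \<le> t \<Longrightarrow> 0 \<le> R t" and iR: "set_integrable lborel {0..} R" and a0: "0 < a"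
      and isR: "set_integrable lborel {0..} (\<lambda>s. s * R s)" and pd: "abs_positive_definite g" by auto
    let ?V = "\<lambda>t \<omega>. integral {0..t} (\<lambda>s. Z s \<omega>)"
    define w where "w \<tau> = 2 * (\<tau> * integral {0..\<tau>} R - integral {0..\<tau>} (\<lambda>u. u * R u))" for \<tau>
    have g0: "g 0 = m" unfolding g m by simp
    have psdg: "psd n (\<lambda>i j. g \<bar>t i - t j\<bar>)" for n and t :: "nat \<Rightarrow> real"
      using pd by (simp add: psd_def qform_def abs_positive_definite_def abs_minus_commute)
    have w: "w h = 2 * (a * h - m + g h)" if "0 \<le> h" for h
      unfolding w_def using integrated_variance[OF iR isR a m g that] by simp
    have w0: "w 0 = 0" by (simp add: w_def)
    have m0: "0 \<le> m" using psd_stationary_bound[of g 0, OF psdg] g0 by simp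
    have cZ: "continuous_on S (\<lambda>t. Z t \<omega>)" if "\<omega> \<in> space M" for S \<omega>
      using Z(4) that by (auto simp: continuous_paths_def intro: continuous_on_subset)
    have gV: "gvec M (\<lambda>i. ?V (t i)) n (\<lambda>i j. polar w (t i) (t j))"
      if "\<And>i. i < n \<Longrightarrow> 0 \<le> t i" for n and t :: "nat \<Rightarrow> real"
      unfolding w_def by (rule integral_process_gvec[OF gZ cR even cZ that])
    have wnn: "0 \<le> w h" if "0 \<le> h" for h
      using gvec_qform_nonneg[OF gV[of 1 "\<lambda>_. h"], of "\<lambda>_. 1"] that w0 by (simp add: qform_def polar_def)
    \<comment> \<open>The roles are exchanged: Brownian motion at speed \<open>2 * a\<close> has the
      larger variogram, and the integrated process takes the place of \<open>U\<close>.\<close>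
    obtain f where f: "(f \<longlongrightarrow> 0) at_top"
      "\<forall>\<^sub>F T in at_top. 0 < \<G> M (\<lambda>t. B (2 * a * t)) T \<and> 0 < \<G> M ?V T \<and> \<G> M (\<lambda>t. B (2 * a * t)) T \<le> \<G> M ?V T \<and>
        \<G> M ?V T * exp (- g 0 - 2 * sqrt (g 0) * sqrt (ln T) - f T) \<le> \<G> M (\<lambda>t. B (2 * a * t)) T"
    proof (rule G_ratio_bounds[where V = "\<lambda>t. B (2 * a * t)" and M = M and N = M and U = ?V and r = g and \<beta> = 1 and L = "2 * a"
        and C = "polar (\<lambda>h. 2 * a * h)" and v = "\<lambda>h. 2 * a * h" and D = "polar w" and u = w])
      show "gvec M (\<lambda>i. B (2 * a * t i)) n (\<lambda>i j. polar (\<lambda>h. 2 * a * h) (t i) (t j))"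
        if "\<And>i. i < n \<Longrightarrow> 0 \<le> t i" for n and t :: "nat \<Rightarrow> real"
      proof (rule gvec_cong[OF gB[of n "\<lambda>i. 2 * a * t i"]])
        show "polar (\<lambda>h. h) (2 * a * t i) (2 * a * t j) = polar (\<lambda>h. 2 * a * h) (t i) (t j)" for i j
          using a0 by (simp add: polar_def abs_mult right_diff_distrib[symmetric])
      qed (use that a0 in simp)
      show "continuous_on {0..T} (\<lambda>t. B (2 * a * t) \<omega>)" if "\<omega> \<in> space M" for T \<omega>
        by (rule continuous_on_compose2[OF brownian_continuous[OF B that, of UNIV]]) (auto intro!: continuous_intros)
      show "continuous_on {0..T} (\<lambda>t. ?V t \<omega>)" if "\<omega> \<in> space M" for T \<omega>
        by (intro indefinite_integral_continuous_1 integrable_continuous_interval cZ that)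
      \<comment> \<open>The left side equals \<open>2 * a * h - w h\<close>, and \<open>w h\<close>
        is a variance; so \<open>g\<close> meets the chaining hypothesis with exponent 1 and
        constant \<open>2 * a\<close>.\<close>
      show "2 * (g 0 - g h) \<le> 2 * a * h powr 1" if "0 \<le> h" for h
        using w[OF that] wnn[OF that] that by (simp add: g0)
      show "w h \<le> 2 * a * h" if "0 \<le> h" for h
        using w[OF that] psd_stationary_bound[of g h, OF psdg that] g0 by simp
      show "2 * a * h \<le> w h + 2 * (g 0 - g h)" if "0 \<le> h" for h using w[OF that] by (simp add: g0)
      show "psd n (\<lambda>i j. g \<bar>t i - t j\<bar>)" for n and t :: "nat \<Rightarrow> real" by (rule psdg)
    qed (use a0 m0 g0 w0 gV polar_commute in \<open>auto simp: polar_increment\<close>)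
    have "f \<in> o[at_top](\<lambda>_. 1)" by (rule smalloI_tendsto) (use f(1) in auto)
    moreover have "\<forall>\<^sub>F T in at_top. 1 \<le> \<G> M ?V T / \<G> M B (2 * a * T) \<and>
        \<G> M ?V T / \<G> M B (2 * a * T) \<le> exp (2 * sqrt m * sqrt (ln T) + m + f T)"
      using f(2) eventually_ge_at_top[of 0]
    proof eventually_elim
      case (elim T)
      let ?e = "2 * sqrt m * sqrt (ln T) + m + f T"
      have sc: "\<G> M (\<lambda>t. B (2 * a * t)) T = \<G> M B (2 * a * T)" using a0 elim(2) by (intro G_time_scale) auto
      have pos: "0 < \<G> M B (2 * a * T)" "\<G> M B (2 * a * T) \<le> \<G> M ?V T" using elim(1) unfolding sc by auto
      have "- g 0 - 2 * sqrt (g 0) * sqrt (ln T) - f T = - ?e" by (simp add: g0)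
      then have "\<G> M ?V T * exp (- ?e) \<le> \<G> M B (2 * a * T)" using elim(1) unfolding sc by metis
      then have "\<G> M ?V T * exp (- ?e) * exp ?e \<le> \<G> M B (2 * a * T) * exp ?e" by (rule mult_right_mono) simp
      moreover have "\<G> M ?V T * exp (- ?e) * exp ?e = \<G> M ?V T"
        by (simp only: mult.assoc exp_add[symmetric] add.left_inverse exp_zero mult_1_right)
      ultimately have "\<G> M ?V T \<le> exp ?e * \<G> M B (2 * a * T)" by (simp only: mult.commute)
      with pos show ?case by (simp add: pos_divide_le_eq)
    qed
    ultimately show "\<exists>f. f \<in> o[at_top](\<lambda>_. 1) \<and> (\<forall>\<^sub>F T in at_top.
        1 \<le> \<G> M ?V T / \<G> M B (2 * a * T) \<and>
        \<G> M ?V T / \<G> M B (2 * a * T) \<le> exp (2 * sqrt m * sqrt (ln T) + m + f T))"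
      by blast
  qed
qed

end
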